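(* Let $\frac12<s<1$. There exist positive constants $C_0(j),C_1(j),C_2(j)$, $j\ge2$, decaying faster than any exponential rate as $j\to\infty$, such that for every $N\in\mathbb N\cup\{\infty\}$ there exist multilinear forms $\{\mathcal N^{(j)}_{0,N}\}_{j=2}^\infty$, $\{\mathcal N^{(j)}_{1,N}\}_{j=2}^\infty$ and $\{\mathcal R^{(j)}_{N}\}_{j=2}^\infty$, where $\mathcal N^{(j)}_{0,N}$ is $2j$-linear and $\mathcal N^{(j)}_{1,N}$, $\mathcal R^{(j)}_N$ are $(2j+2)$-linear, with the following properties. (a) For any solution $v\in C(\mathbb R;H^s(\mathbb T))$ to $(\mathrm{E}_N)$, $$\frac{d}{dt}\Big(\frac12\|v(t)\|_{H^s}^2\Big)=\frac{d}{dt}\Big(\sum_{j=2}^\infty\mathcal N^{(j)}_{0,N}(v)(t)\Big)+\sum_{j=2}^\infty\mathcal N^{(j)}_{1,N}(v)(t)+\sum_{j=2}^\infty\mathcal R^{(j)}_N(v)(t).$$ (b) The forms are bounded on $L^2(\mathbb T)$: for $j=2,3,\dots$, $$|\mathcal N^{(j)}_{0,N}(v)(t)|\lesssim C_0(j)\|v\|_{L^2}^{2j},\qquad |\mathcal N^{(j)}_{1,N}(v)(t)|\lesssim C_1(j)\|v\|_{L^2}^{2j+2},\qquad |\mathcal R^{(j)}_{N}(v)(t)|\lesssim C_2(j)\|v\|_{L^2}^{2j+2},$$ where the constants $C_0(j),C_1(j),C_2(j)$ (and the implicit constants) are independent of $N\in\mathbb N\cup\{\infty\}$ and $t\in\mathbb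 R$. (c) Defining the modified energy $$\mathcal E_{N,t}(v):=\frac12\|v(t)\|_{H^s}^2-\sum_{j=2}^\infty\mathcal N^{(j)}_{0,N}(v)(t),$$ the energy estimate $$\Big|\frac{d}{dt}\mathcal E_{N,t}(v)\Big|\le C_s(\|v\|_{L^2})$$ holds for any solution $v\in C(\mathbb R;H^s(\mathbb T))$ to $(\mathrm{E}_N)$, uniformly in $N\in\mathbb N\cup\{\infty\}$ and $t\in\mathbb R$, where $C_s(\|v\|_{L^2})$ is a constant depending only on $s$ and $\|v\|_{L^2}$.
   Context: $\mathbb T=\mathbb R/(2\pi\mathbb Z)$, $\langle n\rangle=(1+n^2)^{1/2}$. For a function $v$ on $\mathbb T$, $v_n$ denotes its $n$-th Fourier coefficient; $\|v\|_{H^s}^2=\sum_n\langle n\rangle^{2s}|v_n|^2$, $\|v\|_{L^2}=\|v\|_{H^0}$. Let $\phi(\bar n)=n_1^4-n_2^4+n_3^4-n^4$ and $\Gamma(n)=\{(n_1,n_2,n_3)\in\mathbb Z^3: n=n_1-n_2+n_3,\ n_1,n_3\ne n\}$; for $N\in\mathbb N$, $\Gamma_N(n)=\Gamma(n)\cap\{|n_1|,|n_2|,|n_3|\le N\}$, and $\Gamma_\infty(n)=\Gamma(n)$. For $N=\infty$, $(\mathrm E_\infty)$ is the system $$\partial_tv_n=-i\sum_{\Gamma(n)}e^{-i\phi(\bar n)t}v_{n_1}\overline{v_{n_2}}v_{n_3}+i|v_n|^2v_n,\qquad n\in\mathbb Z.$$ For $N\in\mathbb N$, $(\mathrm E_N)$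 is the finite-dimensional system $$\partial_tv_n=-i\sum_{\Gamma_N(n)}e^{-i\phi(\bar n)t}v_{n_1}\overline{v_{n_2}}v_{n_3}+i|v_n|^2v_n,\qquad |n|\le N,$$ with $v_n=0$ for $|n|>N$. "$k$-linear form" here means a real-valued functional of $v$, allowed to depend on the time $t$ through its coefficients, obtained by evaluating on the diagonal (all entries equal to $v(t)$) the real part of a form with $k$ entries that is linear or conjugate-linear in each entry. The value at time $t$ along a function $v$ is written $\mathcal N(v)(t)$. *)

theory Defs
  imports "HOL-Analysis.Analysis" "HOL-Library.Extended_Nat" "HOL-Library.Landau_Symbols"
begin

section \<open>Functions on the torus\<close>

text \<open>A function on \<open>\<real>/(2\<pi>\<int>)\<close> is a \<open>2\<pi>\<close>-periodic function on the real line. The Fourier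
  coefficients are normalised so that \<open>v(x) = \<Sum>\<^sub>n v\<^sub>n e\<^sup>i\<^sup>n\<^sup>x\<close>.\<close>

definition fourier_coeff :: "(real \<Rightarrow> complex) \<Rightarrow> int \<Rightarrow> complex" where
  "fourier_coeff v n =
     (LINT x:{0..2*pi}|lborel. v x * cis (- (of_int n * x))) / of_real (2 * pi)"

definition jbracket :: "int \<Rightarrow> real" where
  "jbracket n = sqrt (1 + (of_int n)\<^sup>2)"

definition sobolev_norm :: "real \<Rightarrow> (real \<Rightarrow> complex) \<Rightarrow> real" where
  "sobolev_norm s v =
     sqrt (\<Sum>\<^sub>\<infinity>n\<in>UNIV. jbracket n powr (2 * s) * (cmod (fourier_coeff v n))\<^sup>2)"

text \<open>\<open>H\<^sup>s(\<T>)\<close> for \<open>s \<ge> 0\<close>, as a set of square integrable functions (not of classes modulo null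
  sets). For \<open>s = 0\<close> the last condition is automatic by Bessel's inequality.\<close>

definition sobolev :: "real \<Rightarrow> (real \<Rightarrow> complex) set" where
  "sobolev s = {v. v \<in> borel_measurable borel
     \<and> (\<forall>x. v (x + 2 * pi) = v x)
     \<and> set_integrable lborel {0..2*pi} (\<lambda>x. (cmod (v x))\<^sup>2)
     \<and> (\<lambda>n. jbracket n powr (2 * s) * (cmod (fourier_coeff v n))\<^sup>2) summable_on UNIV}"

abbreviation L2_torus :: "(real \<Rightarrow> complex) set" where
  "L2_torus \<equiv> sobolev 0"

abbreviation L2_torus_norm :: "(real \<Rightarrow> complex) \<Rightarrow> real" where
  "L2_torus_norm \<equiv> sobolev_norm 0"

section \<open>The systems \<open>(E\<^sub>N)\<close>\<close>

definition phase :: "int \<Rightarrow> int \<Rightarrow> int \<Rightarrow> int \<Rightarrow> int" where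
  "phase n\<^sub>1 n\<^sub>2 n\<^sub>3 n = n\<^sub>1 ^ 4 - n\<^sub>2 ^ 4 + n\<^sub>3 ^ 4 - n ^ 4"

definition Gamma_set :: "int \<Rightarrow> (int \<times> int \<times> int) set" where
  "Gamma_set n = {(n\<^sub>1, n\<^sub>2, n\<^sub>3). n = n\<^sub>1 - n\<^sub>2 + n\<^sub>3 \<and> n\<^sub>1 \<noteq> n \<and> n\<^sub>3 \<noteq> n}"

text \<open>\<open>|n| \<le> N\<close> for \<open>N \<in> \<nat> \<union> {\<infinity>}\<close>; it holds for every \<open>n\<close> if \<open>N = \<infinity>\<close>.\<close>

definition freq_le :: "enat \<Rightarrow> int \<Rightarrow> bool" where
  "freq_le N n \<longleftrightarrow> enat (nat \<bar>n\<bar>) \<le> N"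

definition Gamma_trunc :: "enat \<Rightarrow> int \<Rightarrow> (int \<times> int \<times> int) set" where
  "Gamma_trunc N n =
     Gamma_set n \<inter> {(n\<^sub>1, n\<^sub>2, n\<^sub>3). freq_le N n\<^sub>1 \<and> freq_le N n\<^sub>2 \<and> freq_le N n\<^sub>3}"

text \<open>The vector field of \<open>(E\<^sub>N)\<close> in terms of the sequence \<open>a\<close> of Fourier coefficients. For
  \<open>N = \<infinity>\<close> the sum converges absolutely if \<open>a\<close> is summable, hence on \<open>H\<^sup>s(\<T>)\<close> with \<open>s > 1/2\<close>.\<close>

definition vector_field :: "enat \<Rightarrow> real \<Rightarrow> (int \<Rightarrow> complex) \<Rightarrow> int \<Rightarrow> complex" where
  "vector_field N t a n =
     - \<i> * (\<Sum>\<^sub>\<infinity>(n\<^sub>1, n\<^sub>2, n\<^sub>3)\<in>Gamma_trunc N n.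
              exp (- \<i> * of_int (phase n\<^sub>1 n\<^sub>2 n\<^sub>3 n) * of_real t) * a n\<^sub>1 * cnj (a n\<^sub>2) * a n\<^sub>3)
     + \<i> * of_real ((cmod (a n))\<^sup>2) * a n"

definition continuous_into_sobolev :: "real \<Rightarrow> (real \<Rightarrow> real \<Rightarrow> complex) \<Rightarrow> bool" where
  "continuous_into_sobolev s v \<longleftrightarrow> (\<forall>t. v t \<in> sobolev s)
     \<and> (\<forall>t\<^sub>0. ((\<lambda>t. sobolev_norm s (\<lambda>x. v t x - v t\<^sub>0 x)) \<longlongrightarrow> 0) (at t\<^sub>0))"

definition solves_E :: "real \<Rightarrow> enat \<Rightarrow> (real \<Rightarrow> real \<Rightarrow> complex) \<Rightarrow> bool" where
  "solves_E s N v \<longleftrightarrow> continuous_into_sobolev s v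
     \<and> (\<forall>t n. freq_le N n \<longrightarrow>
          ((\<lambda>\<tau>. fourier_coeff (v \<tau>) n) has_vector_derivative
             vector_field N t (fourier_coeff (v t)) n) (at t))
     \<and> (\<forall>t n. \<not> freq_le N n \<longrightarrow> fourier_coeff (v t) n = 0)"

section \<open>Multilinear forms\<close>

text \<open>A form with \<open>k\<close> entries in \<open>L\<^sup>2(\<T>)\<close>, conjugate-linear in the entries with index in \<open>S\<close> and
  linear in the others. The entries are given as a list of length \<open>k\<close>.\<close>

definition multilinear_on_L2 ::
    "nat \<Rightarrow> nat set \<Rightarrow> ((real \<Rightarrow> complex) list \<Rightarrow> complex) \<Rightarrow> bool" where
  "multilinear_on_L2 k S F \<longleftrightarrow>
     (\<forall>ws i. length ws = k \<and> set ws \<subseteq> L2_torus \<and> i < k \<longrightarrow>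
        (\<forall>f\<in>L2_torus. \<forall>g\<in>L2_torus.
            F (ws[i := (\<lambda>x. f x + g x)]) = F (ws[i := f]) + F (ws[i := g]))
      \<and> (\<forall>f\<in>L2_torus. \<forall>c.
            F (ws[i := (\<lambda>x. c * f x)]) = (if i \<in> S then cnj c else c) * F (ws[i := f])))"

text \<open>\<open>M t u\<close> is the value at time \<open>t\<close> at \<open>u\<close>; along a function \<open>v\<close> of time the value
  \<open>M(v)(t)\<close> is \<open>M t (v t)\<close>. The coefficients of the form may depend on \<open>t\<close>, but not which entries
  are conjugated.\<close>

definition multilinear_form :: "nat \<Rightarrow> (real \<Rightarrow> (real \<Rightarrow> complex) \<Rightarrow> real) \<Rightarrow> bool" where
  "multilinear_form k M \<longleftrightarrow>
     (\<exists>S F. (\<forall>t. multilinear_on_L2 k S (F t))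
          \<and> (\<forall>t. \<forall>u\<in>L2_torus. M t u = Re (F t (replicate k u))))"

definition modified_energy ::
    "real \<Rightarrow> (nat \<Rightarrow> real \<Rightarrow> (real \<Rightarrow> complex) \<Rightarrow> real) \<Rightarrow> real \<Rightarrow> (real \<Rightarrow> complex) \<Rightarrow> real" where
  "modified_energy s N0 t u = 1/2 * (sobolev_norm s u)\<^sup>2 - (\<Sum>\<^sub>\<infinity>j\<in>{2..}. N0 j t u)"

definition superexponential_decay :: "(nat \<Rightarrow> real) \<Rightarrow> bool" where
  "superexponential_decay C \<longleftrightarrow> (\<forall>a>0. C \<in> o(\<lambda>j. exp (- a * real j)))"

end

theory Submission
  imports Defs
begin

text \<open>Every form is given by a kernel on lists of frequencies and carries the phase
  \<open>exp (- i t \<Phi>)\<close>, where \<open>\<Phi>\<close> is the alternating sum of the fourth powers of the frequencies: in a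
  normal form iteration the phases of the single steps telescope to \<open>\<Phi>\<close>, so no trees are needed to
  index the terms. By Cauchy--Schwarz a square summable kernel gives a form bounded on \<open>L\<^sup>2\<close>.

  A step splits a form at \<open>|\<Phi>| = \<theta>\<close>. The part with small \<open>\<Phi>\<close> is kept; in the other one
  \<open>exp (- i t \<Phi>)\<close> is integrated by parts in time, which divides the kernel by \<open>\<Phi>\<close>, and the time
  derivatives of the entries are replaced by the equation. With \<open>(n\<^sub>1, n\<^sub>2, n\<^sub>3) = (n+a, n+a-b, n-b)\<close>
  one has \<open>\<phi> = ab(3(2n+a-b)\<^sup>2+a\<^sup>2+b\<^sup>2)\<close>; it is injective in each offset and at least
  \<open>min |a| |b| ^ 4\<close>. This makes the sum of \<open>|\<mu> \<plusminus> \<phi>|\<close> to the power \<open>- 9/8 - \<delta>\<close> over the offsets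
  \<open>O(|\<mu>|^\<delta>)\<close> for \<open>\<delta> > 1/4\<close>, so that the sum \<open>W\<^sub>j\<close> of \<open>|\<Phi>|^\<delta> |kernel|\<^sup>2\<close> is propagated from step to
  step. It is finite at the start for \<open>\<delta> = (2-s)/4\<close>, because the symmetrised energy symbol is
  \<open>O(n\<^sub>m\<^sub>a\<^sub>x^(2s-1) min |a| |b|)\<close>, and thresholds \<open>\<theta>\<close> growing like a power of \<open>j\<close> turn \<open>W\<^sub>j\<close> into an
  inverse factorial. For \<open>H\<^sup>s\<close> solutions, \<open>s > 1/2\<close>, all sums are differentiated termwise; the
  Weierstrass test applies because locally in time the Fourier coefficients have a common majorant
  in \<open>H\<^sup>s\<close>.\<close>

section \<open>Bounded sums of nonnegative families\<close>

text \<open>The two ends of the range of \<open>s\<close> meet two requirements on the weight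
  exponent \<delta> = (2-s)/4. Summing the children of a list over their offsets costs
  |\<mu>|^\<delta>, which the weight of the parent pays; this needs 4\<delta> = 2-s > 1, that is s <
  1. Division by \<Phi> gives a weighted child the factor |\<Phi>|^(\<delta>-2), of which the sum
  over offsets consumes the exponent 9/8+\<delta>. The surplus 7/8-2\<delta> exceeds 1/8 because
  \<delta> < 3/8, that is s > 1/2. A threshold turns this surplus into a small factor; without it
  the growing number of positions for a substitution would let the bounds grow factorially.

  Truncation at \<open>N\<close> only deletes terms, so all bounds are uniform in \<open>N\<close>.
  Two kinds of bounds run in parallel: square sums of kernels, which give the L^2 estimates of the
  theorem, and absolute sums against an H^s majorant, which justify rearranging and differentiating
  the series.\<close>

definition bounded_sum :: "('a \<Rightarrow> real) \<Rightarrow> 'a set \<Rightarrow> real \<Rightarrow> bool" where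
  "bounded_sum f A C \<longleftrightarrow> (\<forall>x\<in>A. 0 \<le> f x) \<and> f summable_on A \<and> infsum f A \<le> C"

text \<open>Control of all finite partial sums gives summability and the bound at once. The clauses
  of \<open>bounded_sum\<close> are kept together because \<open>infsum\<close> of a family that is
  not summable is 0, so a bound on \<open>infsum\<close> alone says nothing.\<close>

lemma bounded_sumI:
  assumes "\<And>x. x \<in> A \<Longrightarrow> 0 \<le> f x" and "\<And>F. finite F \<Longrightarrow> F \<subseteq> A \<Longrightarrow> sum f F \<le> C"
  shows "bounded_sum f A C"
proof -
  have "f summable_on A"
    by (rule nonneg_bdd_above_summable_on) (use assms in \<open>auto intro!: bdd_aboveI\<close>)
  then show ?thesis
    unfolding bounded_sum_def using assms by (auto intro: infsum_le_finite_sums)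
qed

lemma bounded_sum_nonneg: "bounded_sum f A C \<Longrightarrow> x \<in> A \<Longrightarrow> 0 \<le> f x"
  and bounded_sum_summable: "bounded_sum f A C \<Longrightarrow> f summable_on A"
  and bounded_sum_infsum: "bounded_sum f A C \<Longrightarrow> infsum f A \<le> C"
  by (auto simp: bounded_sum_def)

lemma bounded_sum_finite:
  assumes "bounded_sum f A C" "finite F" "F \<subseteq> A"
  shows "sum f F \<le> C"
proof -
  have "sum f F \<le> infsum f A"
    using assms by (intro finite_sum_le_infsum) (auto simp: bounded_sum_def)
  then show ?thesis
    using assms by (auto simp: bounded_sum_def)
qed

lemma bounded_sum_ge_0: "bounded_sum f A C \<Longrightarrow> 0 \<le> C"
  using bounded_sum_finite[of f A C "{}"] by auto

lemma bounded_sum_self: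
  assumes "f summable_on A" and "\<And>x. x \<in> A \<Longrightarrow> 0 \<le> f x"
  shows "bounded_sum f A (infsum f A)"
  using assms by (auto simp: bounded_sum_def)

lemma bounded_sum_mono:
  assumes "bounded_sum f A C" and "\<And>x. x \<in> A \<Longrightarrow> 0 \<le> g x" and "\<And>x. x \<in> A \<Longrightarrow> g x \<le> f x"
    and "C \<le> C'"
  shows "bounded_sum g A C'"
proof (rule bounded_sumI)
  fix F assume F: "finite F" "F \<subseteq> A"
  have "sum g F \<le> sum f F"
    using F assms by (intro sum_mono) auto
  also have "\<dots> \<le> C"
    using assms F by (intro bounded_sum_finite) auto
  finally show "sum g F \<le> C'" using assms by simp
qed (use assms in auto)

lemma bounded_sum_subset:
  assumes "bounded_sum f B C" "A \<subseteq> B"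
  shows "bounded_sum f A C"
proof (rule bounded_sumI)
  fix F assume "finite F" "F \<subseteq> A"
  then show "sum f F \<le> C"
    using assms by (intro bounded_sum_finite[OF assms(1)]) auto
qed (use assms in \<open>auto simp: bounded_sum_def\<close>)

lemma bounded_sum_cmult:
  assumes "bounded_sum f A C" "0 \<le> c"
  shows "bounded_sum (\<lambda>x. c * f x) A (c * C)"
  using assms by (auto simp: bounded_sum_def summable_on_cmult_right infsum_cmult_right' mult_left_mono)

lemma bounded_sum_add:
  assumes "bounded_sum f A C" "bounded_sum g A D"
  shows "bounded_sum (\<lambda>x. f x + g x) A (C + D)"
  using assms by (auto simp: bounded_sum_def summable_on_add infsum_add)

lemma bounded_sum_sum:
  assumes "finite I" "\<And>i. i \<in> I \<Longrightarrow> bounded_sum (f i) A (C i)"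
  shows "bounded_sum (\<lambda>x. \<Sum>i\<in>I. f i x) A (\<Sum>i\<in>I. C i)"
  using assms
proof (induction I rule: finite_induct)
  case empty
  show ?case by (simp add: bounded_sum_def)
next
  case (insert i I)
  have "bounded_sum (\<lambda>x. f i x + (\<Sum>i\<in>I. f i x)) A (C i + (\<Sum>i\<in>I. C i))"
    using insert by (intro bounded_sum_add) auto
  then show ?case using insert.hyps by simp
qed

lemma bounded_sum_indicator:
  "bounded_sum f D C \<Longrightarrow> bounded_sum (\<lambda>x. if x \<in> D then f x else 0) UNIV C"
  unfolding bounded_sum_def
  using summable_on_cong_neutral[of UNIV D "\<lambda>x. if x \<in> D then f x else 0" f]
    infsum_cong_neutral[of UNIV D "\<lambda>x. if x \<in> D then f x else 0" f] by auto

lemma bounded_sum_extend: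
  assumes "bounded_sum f D C" "D \<subseteq> A" "\<And>x. x \<in> A \<Longrightarrow> x \<notin> D \<Longrightarrow> f x = 0"
  shows "bounded_sum f A C"
proof -
  have "bounded_sum (\<lambda>x. if x \<in> D then f x else 0) A C"
    using bounded_sum_subset[OF bounded_sum_indicator[OF assms(1)]] by simp
  then show ?thesis
    by (rule bounded_sum_mono) (use assms in \<open>auto simp: bounded_sum_def\<close>)
qed

lemma bounded_sum_inj:
  assumes "bounded_sum f B C" "inj_on h A" "h ` A \<subseteq> B"
  shows "bounded_sum (\<lambda>x. f (h x)) A C"
proof (rule bounded_sumI)
  fix F assume F: "finite F" "F \<subseteq> A"
  have "sum (\<lambda>x. f (h x)) F = sum f (h ` F)"
    using F assms by (subst sum.reindex) (auto intro: inj_on_subset)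
  also have "\<dots> \<le> C"
    using F assms by (intro bounded_sum_finite[OF assms(1)]) auto
  finally show "sum (\<lambda>x. f (h x)) F \<le> C" .
qed (use assms in \<open>auto simp: bounded_sum_def\<close>)

lemma bounded_sum_reindex:
  assumes "bij_betw h A B"
  shows "bounded_sum (\<lambda>x. f (h x)) A C \<longleftrightarrow> bounded_sum f B C"
  using assms summable_on_reindex_bij_betw[OF assms, of f] infsum_reindex_bij_betw[OF assms, of f]
  by (auto simp: bounded_sum_def bij_betw_def)

lemma bounded_sum_Sigma:
  assumes "\<And>x. x \<in> A \<Longrightarrow> bounded_sum (\<lambda>y. f (x, y)) (B x) (g x)" and "bounded_sum g A C"
  shows "bounded_sum f (Sigma A B) C"
proof -
  let ?h = "\<lambda>x. infsum (\<lambda>y. f (x, y)) (B x)"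
  have h: "bounded_sum ?h A C"
    by (rule bounded_sum_mono[OF assms(2)])
       (use assms in \<open>auto simp: bounded_sum_def intro!: infsum_nonneg\<close>)
  have s: "f summable_on Sigma A B"
    by (rule summable_on_SigmaI[where g = ?h])
       (use assms h in \<open>auto simp: bounded_sum_def intro!: has_sum_infsum\<close>)
  have "infsum f (Sigma A B) = infsum ?h A"
    using infsum_Sigma_banach[OF s] by simp
  with s h assms show ?thesis
    by (auto simp: bounded_sum_def)
qed

lemma bounded_sum_Times_fst:
  assumes "bounded_sum f (A \<times> B) C"
  shows "x \<in> A \<Longrightarrow> bounded_sum (\<lambda>y. f (x, y)) B C"
    and "bounded_sum (\<lambda>x. infsum (\<lambda>y. f (x, y)) B) A C"
proof -
  show *: "bounded_sum (\<lambda>y. f (x, y)) B C" if "x \<in> A" for x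
    using bounded_sum_inj[OF assms, of "Pair x" B] that by (auto simp: inj_on_def)
  have "(\<lambda>x. infsum (\<lambda>y. f (x, y)) B) summable_on A"
    using assms by (intro summable_on_Sigma_banach) (auto simp: bounded_sum_def)
  moreover have "infsum (\<lambda>x. infsum (\<lambda>y. f (x, y)) B) A = infsum f (A \<times> B)"
    by (rule infsum_Sigma_banach) (use assms in \<open>auto simp: bounded_sum_def\<close>)
  ultimately show "bounded_sum (\<lambda>x. infsum (\<lambda>y. f (x, y)) B) A C"
    using assms * by (auto simp: bounded_sum_def intro!: infsum_nonneg)
qed

lemma bounded_sum_mult_Times:
  assumes "bounded_sum f A C" "bounded_sum g B D"
  shows "bounded_sum (\<lambda>(x, y). f x * g y) (A \<times> B) (C * D)"
proof (rule bounded_sum_Sigma)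
  fix x assume "x \<in> A"
  then show "bounded_sum (\<lambda>y. case (x, y) of (x, y) \<Rightarrow> f x * g y) B (D * f x)"
    using bounded_sum_cmult[OF assms(2), of "f x"] assms
    by (auto simp: bounded_sum_def mult.commute)
next
  show "bounded_sum (\<lambda>x. D * f x) A (C * D)"
    using bounded_sum_cmult[OF assms(1) bounded_sum_ge_0[OF assms(2)]] by (simp add: mult.commute)
qed

lemma bounded_sum_Cauchy_Schwarz:
  assumes "bounded_sum (\<lambda>x. (f x)\<^sup>2) A C" "bounded_sum (\<lambda>x. (g x)\<^sup>2) A D"
    and "\<And>x. x \<in> A \<Longrightarrow> 0 \<le> f x" "\<And>x. x \<in> A \<Longrightarrow> 0 \<le> g x"
  shows "bounded_sum (\<lambda>x. f x * g x) A (sqrt C * sqrt D)"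
proof (rule bounded_sumI)
  fix F assume F: "finite F" "F \<subseteq> A"
  have "(\<Sum>x\<in>F. f x * g x) \<le> L2_set f F * L2_set g F"
    using assms(3,4) F L2_set_mult_ineq[of f g F] by (simp add: subset_iff)
  also have "\<dots> \<le> sqrt C * sqrt D"
    unfolding L2_set_def using bounded_sum_finite[OF assms(1) F] bounded_sum_finite[OF assms(2) F]
    by (intro mult_mono) (auto intro!: bounded_sum_ge_0[OF assms(1)] sum_nonneg)
  finally show "(\<Sum>x\<in>F. f x * g x) \<le> sqrt C * sqrt D" .
qed (use assms in auto)

lemma bounded_sum_norm:
  fixes f :: "'a \<Rightarrow> 'b::banach"
  assumes "bounded_sum (\<lambda>x. norm (f x)) A C"
  shows "f summable_on A" and "norm (infsum f A) \<le> C"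
proof -
  show "f summable_on A"
    using assms abs_summable_summable by (auto simp: bounded_sum_def)
  show "norm (infsum f A) \<le> C"
    using norm_infsum_bound[of f A] assms by (auto simp: bounded_sum_def)
qed

lemma bounded_sum_norm_mono:
  fixes f :: "'a \<Rightarrow> 'b::banach"
  assumes "bounded_sum g A C" and "\<And>x. x \<in> A \<Longrightarrow> norm (f x) \<le> g x"
  shows "f summable_on A" and "norm (infsum f A) \<le> C"
  using bounded_sum_norm[OF bounded_sum_mono[OF assms(1)]] assms(2) by auto

lemma infsum_sum:
  fixes f :: "'i \<Rightarrow> 'a \<Rightarrow> 'b::{topological_comm_monoid_add,t2_space}"
  assumes "finite I" "\<And>i. i \<in> I \<Longrightarrow> f i summable_on A"
  shows "infsum (\<lambda>x. \<Sum>i\<in>I. f i x) A = (\<Sum>i\<in>I. infsum (f i) A)"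
proof (rule infsumI)
  show "((\<lambda>x. \<Sum>i\<in>I. f i x) has_sum (\<Sum>i\<in>I. infsum (f i) A)) A"
    using assms by (induction I rule: finite_induct) (auto intro!: has_sum_add)
qed

section \<open>Termwise differentiation of unordered sums\<close>

lemma has_vector_derivative_iff_quotient:
  "(f has_vector_derivative D) (at t) \<longleftrightarrow> ((\<lambda>\<tau>. (f \<tau> - f t) /\<^sub>R (\<tau> - t)) \<longlongrightarrow> D) (at t)"
proof -
  have "(f has_vector_derivative D) (at t) \<longleftrightarrow>
      ((\<lambda>\<tau>. norm (f \<tau> - f t - (\<tau> - t) *\<^sub>R D) / norm (\<tau> - t)) \<longlongrightarrow> 0) (at t)"
    unfolding has_vector_derivative_def has_derivative_iff_norm
        by (simp add: bounded_linear_scaleR_left)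
  also have "\<dots> \<longleftrightarrow> ((\<lambda>\<tau>. norm ((f \<tau> - f t) /\<^sub>R (\<tau> - t) - D)) \<longlongrightarrow> 0) (at t)"
  proof (rule filterlim_cong[OF refl refl], unfold eventually_at_filter, intro always_eventually allI
      impI)
    fix \<tau> assume "\<tau> \<noteq> t"
    then have "(f \<tau> - f t) /\<^sub>R (\<tau> - t) - D = (f \<tau> - f t - (\<tau> - t) *\<^sub>R D) /\<^sub>R (\<tau> - t)"
      by (simp add: scaleR_diff_right)
    then show "norm (f \<tau> - f t - (\<tau> - t) *\<^sub>R D) / norm (\<tau> - t) = norm ((f \<tau> - f t) /\<^sub>R (\<tau> - t) - D)"
      by (simp only: norm_scaleR) (simp add: divide_inverse mult.commute)
  qed
  also have "\<dots> \<longleftrightarrow> ((\<lambda>\<tau>. (f \<tau> - f t) /\<^sub>R (\<tau> - t)) \<longlongrightarrow> D) (at t)"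
    by (simp only: tendsto_norm_zero_iff LIM_zero_iff)
  finally show ?thesis .
qed

text \<open>The mean value inequality bounds every difference quotient of \<open>f i\<close> by
  \<open>B i\<close>. By the Weierstrass test the finite sums of quotients then converge uniformly
  near \<open>t\<close>, and the limit over index sets may be exchanged with the limit of the
  quotients.\<close>

lemma has_vector_derivative_infsum:
  fixes f :: "'i \<Rightarrow> real \<Rightarrow> 'b::banach"
  assumes deriv: "\<And>i t. i \<in> A \<Longrightarrow> t \<in> {l<..<u} \<Longrightarrow> (f i has_vector_derivative f' i t) (at t)"
    and bound: "\<And>i t. i \<in> A \<Longrightarrow> t \<in> {l<..<u} \<Longrightarrow> norm (f' i t) \<le> B i"
    and B: "B summable_on A"
    and summ: "\<And>t. t \<in> {l<..<u} \<Longrightarrow> (\<lambda>i. f i t) summable_on A"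
    and t: "t \<in> {l<..<u}"
  shows "((\<lambda>\<tau>. infsum (\<lambda>i. f i \<tau>) A) has_vector_derivative infsum (\<lambda>i. f' i t) A) (at t)"
proof -
  define q where "q = (\<lambda>i \<tau>. (f i \<tau> - f i t) /\<^sub>R (\<tau> - t))"
  have q_bound: "norm (q i \<tau>) \<le> B i" if "i \<in> A" "\<tau> \<in> {l<..<u}" for i \<tau>
  proof -
    have "norm (f i \<tau> - f i t) \<le> B i * norm (\<tau> - t)"
    proof (rule differentiable_bound[of "{l<..<u}"])
      show "(f i has_derivative (\<lambda>h. h *\<^sub>R f' i x)) (at x within {l<..<u})" if "x \<in> {l<..<u}" for x
        using deriv[OF \<open>i \<in> A\<close> that] by (auto simp: has_vector_derivative_def
            intro: has_derivative_at_withinI)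
      show "onorm (\<lambda>h. h *\<^sub>R f' i x) \<le> B i" if "x \<in> {l<..<u}" for x
        using mult_left_mono[OF bound[OF \<open>i \<in> A\<close> that] abs_ge_zero]
          by (intro onorm_le) (simp add: mult.commute)
    qed (use that t in auto)
    moreover have "0 \<le> B i" using bound[OF that(1) t] norm_ge_zero order.trans by blast
    ultimately show ?thesis
      by (auto simp: q_def divide_simps)
  qed
  have "((\<lambda>\<tau>. infsum (\<lambda>i. q i \<tau>) A) \<longlongrightarrow> infsum (\<lambda>i. f' i t) A) (at t)"
  proof (rule swap_uniform_limit')
    show "\<forall>\<^sub>F F in finite_subsets_at_top A. ((\<lambda>\<tau>. \<Sum>i\<in>F. q i \<tau>) \<longlongrightarrow> (\<Sum>i\<in>F. f' i t)) (at t)"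
    proof (rule eventually_finite_subsets_at_top_weakI)
      fix F assume F: "finite F" "F \<subseteq> A"
      show "((\<lambda>\<tau>. \<Sum>i\<in>F. q i \<tau>) \<longlongrightarrow> (\<Sum>i\<in>F. f' i t)) (at t)"
      proof (rule tendsto_sum)
        fix i assume "i \<in> F"
        then have "(f i has_vector_derivative f' i t) (at t)"
          using deriv t F by auto
        then show "(q i \<longlongrightarrow> f' i t) (at t)"
          by (simp add: q_def has_vector_derivative_iff_quotient)
      qed
    qed
    show "((\<lambda>F. \<Sum>i\<in>F. f' i t) \<longlongrightarrow> infsum (\<lambda>i. f' i t) A) (finite_subsets_at_top A)"
    proof (rule infsum_tendsto)
      have "bounded_sum B A (infsum B A)"
        using B bound t by (intro bounded_sum_self) (auto intro: order.trans[OF norm_ge_zero])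
      then show "(\<lambda>i. f' i t) summable_on A"
        by (rule bounded_sum_norm_mono) (use bound t in auto)
    qed
    show "uniform_limit {l<..<u} (\<lambda>F \<tau>. \<Sum>i\<in>F. q i \<tau>) (\<lambda>\<tau>. infsum (\<lambda>i. q i \<tau>) A)
            (finite_subsets_at_top A)"
      using q_bound B by (rule Weierstrass_m_test_general)
    show "\<forall>\<^sub>F \<tau> in at t. \<tau> \<in> {l<..<u}"
      using t by (intro eventually_at_in_open') auto
  qed auto
  moreover have "\<forall>\<^sub>F \<tau> in at t. infsum (\<lambda>i. q i \<tau>) A =
      (infsum (\<lambda>i. f i \<tau>) A - infsum (\<lambda>i. f i t) A) /\<^sub>R (\<tau> - t)"
  proof -
    have "infsum (\<lambda>i. q i \<tau>) A = (infsum (\<lambda>i. f i \<tau>) A - infsum (\<lambda>i. f i t) A) /\<^sub>R (\<tau> - t)"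
      if "\<tau> \<in> {l<..<u}" for \<tau>
    proof -
      have "infsum (\<lambda>i. f i \<tau> - f i t) A = infsum (\<lambda>i. f i \<tau>) A - infsum (\<lambda>i. f i t) A"
        using infsum_add[OF summ[OF that], of "\<lambda>i. - f i t"] summ[OF t]
        by (simp add: summable_on_uminus infsum_uminus)
      then show ?thesis
        by (simp add: q_def infsum_scaleR_right)
    qed
    then show ?thesis
      using eventually_at_in_open'[of "{l<..<u}" t] t by (auto elim!: eventually_mono)
  qed
  ultimately have "((\<lambda>\<tau>. (infsum (\<lambda>i. f i \<tau>) A - infsum (\<lambda>i. f i t) A) /\<^sub>R (\<tau> - t)) \<longlongrightarrow>
      infsum (\<lambda>i. f' i t) A) (at t)"
    by (rule Lim_transform_eventually)
  then show ?thesis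
    by (simp add: has_vector_derivative_iff_quotient)
qed

section \<open>Tensors on lists of frequencies\<close>

definition tuples :: "nat \<Rightarrow> int list set" where
  "tuples k = {ns. length ns = k}"

definition conj_odd :: "nat \<Rightarrow> complex \<Rightarrow> complex" where
  "conj_odd i z = (if even i then z else cnj z)"

text \<open>The counter is the position of the head in the full list. A tensor can thus be cut at
  any place, and the tail still knows its slots and the parity that decides about
  conjugation.\<close>

primrec tprod :: "(nat \<Rightarrow> int \<Rightarrow> 'a::comm_monoid_mult) \<Rightarrow> nat \<Rightarrow> int list \<Rightarrow> 'a" where
  "tprod us i [] = 1"
| "tprod us i (n # ns) = us i n * tprod us (Suc i) ns"

definition tensor :: "(nat \<Rightarrow> int \<Rightarrow> complex) \<Rightarrow> nat \<Rightarrow> int list \<Rightarrow> complex" where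
  "tensor bs = tprod (\<lambda>i n. conj_odd i (bs i n))"

primrec alt_phase :: "int list \<Rightarrow> int" where
  "alt_phase [] = 0"
| "alt_phase (n # ns) = n ^ 4 - alt_phase ns"

text \<open>Replacing the entry \<open>n\<close> at position \<open>k\<close> by \<open>n\<^sub>1, n\<^sub>2, n\<^sub>3\<close> with \<open>n = n\<^sub>1 - n\<^sub>2 + n\<^sub>3\<close>; the
  offsets are \<open>n\<^sub>1 - n\<close> and \<open>n - n\<^sub>3\<close>. Since two entries are added, the alternating pattern of
  conjugates is kept.\<close>

definition expand :: "nat \<Rightarrow> int list \<Rightarrow> int \<times> int \<Rightarrow> int list" where
  "expand k p = (\<lambda>(a, b). take k p @ [p ! k + a, p ! k + a - b, p ! k - b] @ drop (Suc k) p)"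

definition contract :: "nat \<Rightarrow> int list \<Rightarrow> int list" where
  "contract k ns = take k ns @ [ns ! k - ns ! Suc k + ns ! Suc (Suc k)] @ drop (k + 3) ns"

definition offsets :: "nat \<Rightarrow> int list \<Rightarrow> int \<times> int" where
  "offsets k ns = (ns ! Suc k - ns ! Suc (Suc k), ns ! k - ns ! Suc k)"

lemma conj_odd_norm [simp]: "cmod (conj_odd i z) = cmod z"
  by (simp add: conj_odd_def)

lemma conj_odd_add: "conj_odd i (x + y) = conj_odd i x + conj_odd i y"
  and conj_odd_diff: "conj_odd i (x - y) = conj_odd i x - conj_odd i y"
  and conj_odd_mult: "conj_odd i (x * y) = conj_odd i x * conj_odd i y"
  and conj_odd_add2 [simp]: "conj_odd (Suc (Suc i)) = conj_odd i"
  by (auto simp: conj_odd_def)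

lemma conj_odd_infsum: "conj_odd i (infsum f A) = infsum (\<lambda>x. conj_odd i (f x)) A"
  by (simp add: conj_odd_def)

lemma tprod_append: "tprod us i (xs @ ys) = tprod us i xs * tprod us (i + length xs) ys"
  by (induction xs arbitrary: i) (auto simp: mult.assoc)

lemma tprod_cong:
  "(\<And>j. i \<le> j \<Longrightarrow> j < i + length ns \<Longrightarrow> us j = ws j) \<Longrightarrow> tprod us i ns = tprod ws i ns"
  by (induction ns arbitrary: i) auto

lemma tensor_simps [simp]:
  "tensor bs i [] = 1" "tensor bs i (n # ns) = conj_odd i (bs i n) * tensor bs (Suc i) ns"
  by (simp_all add: tensor_def)

lemma tensor_append: "tensor bs i (xs @ ys) = tensor bs i xs * tensor bs (i + length xs) ys"
  by (simp add: tensor_def tprod_append)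

lemma tensor_cong:
  "(\<And>j. i \<le> j \<Longrightarrow> j < i + length ns \<Longrightarrow> bs j = cs j) \<Longrightarrow> tensor bs i ns = tensor cs i ns"
  unfolding tensor_def by (rule tprod_cong) simp

lemma tensor_const_add2: "tensor (\<lambda>_. a) (Suc (Suc i)) ns = tensor (\<lambda>_. a) i ns"
  by (induction ns arbitrary: i) auto

lemma tprod_const_add: "tprod (\<lambda>_. w) (Suc i) ns = tprod (\<lambda>_. w) i ns"
  by (induction ns arbitrary: i) auto

lemma tprod_const_shift: "tprod (\<lambda>_. w) i ns = tprod (\<lambda>_. w) 0 ns"
  by (induction i) (auto simp: tprod_const_add)

lemma norm_tensor: "cmod (tensor bs i ns) = tprod (\<lambda>j n. cmod (bs j n)) i ns"
  by (induction ns arbitrary: i) (auto simp: norm_mult)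

lemma tprod_nonneg: "(\<And>j n. (0::real) \<le> us j n) \<Longrightarrow> 0 \<le> tprod us i ns"
  by (induction ns arbitrary: i) auto

lemma tprod_mono:
  "(\<And>j n. (0::real) \<le> us j n) \<Longrightarrow> (\<And>j n. us j n \<le> ws j n) \<Longrightarrow> tprod us i ns \<le> tprod ws i ns"
proof (induction ns arbitrary: i)
  case (Cons n ns)
  have "0 \<le> ws i n" using Cons.prems order.trans by blast
  then show ?case using Cons by (auto intro!: mult_mono tprod_nonneg)
qed auto

lemma norm_tensor_le:
  assumes "\<And>j n. cmod (bs j n) \<le> us j n"
  shows "cmod (tensor bs i ns) \<le> tprod us i ns"
  unfolding norm_tensor using assms by (intro tprod_mono) auto

lemma tprod_power2: "(tprod us i ns :: real)\<^sup>2 = tprod (\<lambda>j n. (us j n)\<^sup>2) i ns"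
  by (induction ns arbitrary: i) (auto simp: power_mult_distrib)

lemma list_split_at: "k < length p \<Longrightarrow> p = take k p @ [p ! k] @ drop (Suc k) p"
  by (simp add: id_take_nth_drop)

lemma tprod_upd:
  assumes "k < length p"
  shows "tprod (us(k := f)) 0 p =
    tprod us 0 (take k p) * f (p ! k) * tprod us (Suc k) (drop (Suc k) p)"
proof -
  have "tprod (us(k := f)) 0 p =
      tprod (us(k := f)) 0 (take k p) * (f (p ! k) * tprod (us(k := f)) (Suc k) (drop (Suc k) p))"
    using assms by (subst list_split_at[OF assms], subst tprod_append) simp
  moreover have "tprod (us(k := f)) 0 (take k p) = tprod us 0 (take k p)"
    using assms by (intro tprod_cong) auto
  moreover have "tprod (us(k := f)) (Suc k) (drop (Suc k) p) = tprod us (Suc k) (drop (Suc k) p)"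
    by (intro tprod_cong) auto
  ultimately show ?thesis by (simp add: mult.assoc)
qed

lemma tensor_upd:
  assumes "k < length p"
  shows "tensor (bs(k := f)) 0 p =
    tensor bs 0 (take k p) * conj_odd k (f (p ! k)) * tensor bs (Suc k) (drop (Suc k) p)"
proof -
  have "(\<lambda>j n. conj_odd j ((bs(k := f)) j n)) = (\<lambda>j n. conj_odd j (bs j n))(k := \<lambda>n. conj_odd k (f n))"
    by (simp add: fun_eq_iff)
  then show ?thesis
    using assms by (simp add: tensor_def tprod_upd)
qed

lemma bij_betw_Cons: "bij_betw (\<lambda>(n, ns). n # ns) (UNIV \<times> tuples k) (tuples (Suc k))"
  by (rule bij_betwI[where g = "\<lambda>ns. (hd ns, tl ns)"])
     (auto simp: tuples_def length_Suc_conv)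

lemma tuples_0: "tuples 0 = {[]}"
  by (auto simp: tuples_def)

lemma bounded_sum_tprod:
  assumes "\<And>j. i \<le> j \<Longrightarrow> j < i + k \<Longrightarrow> bounded_sum (us j) UNIV (C j)"
  shows "bounded_sum (tprod us i) (tuples k) (\<Prod>j\<in>{i..<i+k}. C j)"
  using assms
proof (induction k arbitrary: i)
  case 0
  show ?case by (simp add: tuples_0 bounded_sum_def)
next
  case (Suc k)
  have "bounded_sum (tprod us (Suc i)) (tuples k) (\<Prod>j\<in>{Suc i..<Suc i+k}. C j)"
    by (rule Suc.IH) (use Suc.prems in auto)
  then have "bounded_sum (\<lambda>(n, ns). us i n * tprod us (Suc i) ns) (UNIV \<times> tuples k)
      (C i * (\<Prod>j\<in>{Suc i..<Suc i+k}. C j))"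
    using Suc.prems by (intro bounded_sum_mult_Times) auto
  then have "bounded_sum (\<lambda>x. tprod us i ((\<lambda>(n, ns). n # ns) x)) (UNIV \<times> tuples k)
      (C i * (\<Prod>j\<in>{Suc i..<Suc i+k}. C j))"
    by (simp add: case_prod_unfold)
  moreover have "C i * (\<Prod>j\<in>{Suc i..<Suc i+k}. C j) = (\<Prod>j\<in>{i..<i+Suc k}. C j)"
    by (subst (2) prod.atLeast_Suc_lessThan) auto
  ultimately show ?case
    using bounded_sum_reindex[OF bij_betw_Cons, of "tprod us i" k] by simp
qed

text \<open>The slots may carry different sequences because differentiation puts
  \<open>trilinear w\<close> into one slot and leaves \<open>w\<close> in the others.\<close>

lemma bounded_sum_kernel_tensor:
  assumes G: "bounded_sum (\<lambda>ns. (cmod (G ns))\<^sup>2) (tuples k) B"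
    and u: "\<And>j. j < k \<Longrightarrow> bounded_sum (\<lambda>n. (us j n)\<^sup>2) UNIV (C j)"
    and nonneg: "\<And>j n. 0 \<le> us j n"
  shows "bounded_sum (\<lambda>ns. cmod (G ns) * tprod us 0 ns) (tuples k)
    (sqrt B * sqrt (\<Prod>j<k. C j))"
proof (rule bounded_sum_Cauchy_Schwarz[OF G])
  show "bounded_sum (\<lambda>ns. (tprod us 0 ns)\<^sup>2) (tuples k) (\<Prod>j<k. C j)"
    using bounded_sum_tprod[of 0 k "\<lambda>j n. (us j n)\<^sup>2" C] u by (simp add: tprod_power2 atLeast0LessThan)
qed (use nonneg in \<open>auto intro: tprod_nonneg\<close>)

lemma tensor_const_has_vector_derivative:
  assumes "\<And>n. ((\<lambda>\<tau>. a \<tau> n) has_vector_derivative da n) (at t)"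
  shows "((\<lambda>\<tau>. tensor (\<lambda>_. a \<tau>) i ns) has_vector_derivative
    (\<Sum>k<length ns. tensor ((\<lambda>_. a t)(i + k := da)) i ns)) (at t)"
proof (induction ns arbitrary: i)
  case Nil
  show ?case by simp
next
  case (Cons n ns)
  have d: "((\<lambda>\<tau>. conj_odd i (a \<tau> n)) has_vector_derivative conj_odd i (da n)) (at t)"
    using assms[of n] has_vector_derivative_cnj[OF assms[of n]] by (auto simp: conj_odd_def)
  have 1: "tensor ((\<lambda>_. a t)(i := da)) (Suc i) ns = tensor (\<lambda>_. a t) (Suc i) ns"
    by (intro tensor_cong) auto
  have 2: "(\<Sum>k<length ns. conj_odd i (a t n) * tensor ((\<lambda>_. a t)(Suc i + k := da)) (Suc i) ns)
     = (\<Sum>k<length ns. tensor ((\<lambda>_. a t)(i + Suc k := da)) i (n # ns))"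
    by (intro sum.cong) auto
  have "((\<lambda>\<tau>. conj_odd i (a \<tau> n) * tensor (\<lambda>_. a \<tau>) (Suc i) ns) has_vector_derivative
     (conj_odd i (a t n) * (\<Sum>k<length ns. tensor ((\<lambda>_. a t)(Suc i + k := da)) (Suc i) ns)
      + conj_odd i (da n) * tensor (\<lambda>_. a t) (Suc i) ns)) (at t)"
    by (rule has_vector_derivative_mult[OF d Cons.IH])
  moreover have "conj_odd i (a t n) * (\<Sum>k<length ns. tensor ((\<lambda>_. a t)(Suc i + k := da)) (Suc i) ns)
      + conj_odd i (da n) * tensor (\<lambda>_. a t) (Suc i) ns
     = (\<Sum>k<length (n # ns). tensor ((\<lambda>_. a t)(i + k := da)) i (n # ns))"
    using 2 unfolding sum.lessThan_Suc_shift length_Cons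
    by (simp add: 1 sum_distrib_left del: fun_upd_apply) (simp add: 1)
  ultimately show ?case
    by (simp only: tensor_simps)
qed

section \<open>The phase and the substitution of three entries for one\<close>

lemma alt_phase_append: "alt_phase (xs @ ys) = alt_phase xs + (-1) ^ length xs * alt_phase ys"
  by (induction xs) auto

definition phase_off :: "int \<Rightarrow> int \<Rightarrow> int \<Rightarrow> int" where
  "phase_off n a b = a * b * (3 * (2 * n + a - b)\<^sup>2 + a\<^sup>2 + b\<^sup>2)"

lemma phase_eq_phase_off: "phase (n + a) (n + a - b) (n - b) n = phase_off n a b"
  unfolding phase_def phase_off_def by algebra

text \<open>In a conjugated slot the cubic term enters conjugated, which flips the sign of its
  phase. Hence the time factors of the parent and of the cubic term multiply to that of the child,
  with no memory of earlier steps.\<close>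

lemma alt_phase_expand:
  assumes "k < length p"
  shows "alt_phase (expand k p (a, b)) = alt_phase p + (-1) ^ k * phase_off (p ! k) a b"
proof -
  have "alt_phase p = alt_phase (take k p) + (-1) ^ k * (p ! k ^ 4 - alt_phase (drop (Suc k) p))"
    using assms by (subst list_split_at[OF assms], subst alt_phase_append) simp
  moreover have "alt_phase (expand k p (a, b)) = alt_phase (take k p) + (-1) ^ k *
      ((p!k+a) ^ 4 - ((p!k+a-b) ^ 4 - ((p!k-b) ^ 4 - alt_phase (drop (Suc k) p))))"
    using assms by (simp add: expand_def alt_phase_append)
  moreover have "(p!k+a) ^ 4 - ((p!k+a-b) ^ 4 - ((p!k-b) ^ 4 - alt_phase (drop (Suc k) p)))
      = (p ! k ^ 4 - alt_phase (drop (Suc k) p)) + phase_off (p ! k) a b"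
    using phase_eq_phase_off[of "p!k" a b] unfolding phase_def by linarith
  ultimately show ?thesis
    by (simp only: distrib_left add.assoc)
qed

lemma length_expand: "k < length p \<Longrightarrow> length (expand k p ab) = length p + 2"
  by (auto simp: expand_def split: prod.split)

lemma contract_expand: "k < length p \<Longrightarrow> contract k (expand k p ab) = p"
  by (cases ab) (simp add: expand_def contract_def nth_append flip: id_take_nth_drop)

lemma offsets_expand: "k < length p \<Longrightarrow> offsets k (expand k p ab) = ab"
  by (cases ab) (simp add: expand_def offsets_def nth_append)

lemma length_contract: "k + 2 < length ns \<Longrightarrow> length (contract k ns) = length ns - 2"
  by (auto simp: contract_def)

lemma list_split_at3:
  "k + 2 < length ns \<Longrightarrow> ns = take k ns @ [ns ! k, ns ! Suc k, ns ! Suc (Suc k)] @ drop (k + 3) ns"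
  using id_take_nth_drop[of k ns] Cons_nth_drop_Suc[of "Suc k" ns] Cons_nth_drop_Suc[of "Suc (Suc k)"
      ns]
  by (simp add: eval_nat_numeral)

lemma expand_contract: "k + 2 < length ns \<Longrightarrow> expand k (contract k ns) (offsets k ns) = ns"
  using list_split_at3[of k ns] by (simp add: expand_def contract_def offsets_def nth_append)

text \<open>This change of variables turns a sum over children into a sum over parents and offsets;
  every substitution estimate goes through it.\<close>

lemma bij_betw_expand:
  assumes "k < m"
  shows "bij_betw (\<lambda>(p, ab). expand k p ab) (tuples m \<times> UNIV) (tuples (m + 2))"
  by (rule bij_betwI[where g = "\<lambda>ns. (contract k ns, offsets k ns)"])
     (use assms in \<open>auto simp: tuples_def length_expand contract_expand offsets_expand
        length_contract expand_contract\<close>)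

lemma tensor_const_expand:
  assumes "k < length p"
  shows "tensor (\<lambda>_. a) 0 (expand k p (x, y)) =
    tensor (\<lambda>_. a) 0 (take k p) * conj_odd k (a (p!k + x) * cnj (a (p!k + x - y)) * a (p!k - y))
      * tensor (\<lambda>_. a) (Suc k) (drop (Suc k) p)"
  using assms by (simp add: expand_def tensor_append conj_odd_def tensor_const_add2)

lemma tprod_const_expand:
  assumes "k < length p"
  shows "tprod (\<lambda>_. w) 0 (expand k p (x, y)) =
    tprod (\<lambda>_. w) 0 (take k p) * (w (p!k + x) * w (p!k + x - y) * w (p!k - y))
      * tprod (\<lambda>_. w) (Suc k) (drop (Suc k) p)"
  using assms by (simp add: expand_def tprod_append tprod_const_add tprod_const_shift[of w k]
      mult.assoc)

section \<open>The phase and the energy symbol\<close>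

text \<open>The cut at 1 makes a negative power count the value 0 with weight 1. As
  \<open>0 powr p\<close> is 0, plain absolute values would silently leave out exact
  resonances.\<close>

definition zabs :: "int \<Rightarrow> real" where
  "zabs c = max 1 \<bar>real_of_int c\<bar>"

lemma zabs_ge_1 [simp]: "1 \<le> zabs c" and zabs_pos [simp]: "0 < zabs c"
  and zabs_nonneg [simp]: "0 \<le> zabs c" and abs_le_zabs: "\<bar>real_of_int c\<bar> \<le> zabs c"
  by (auto simp: zabs_def)

lemma zabs_neq_0 [simp]: "zabs c \<noteq> 0"
  by (metis less_irrefl zabs_pos)

lemma zabs_eq: "c \<noteq> 0 \<Longrightarrow> zabs c = \<bar>real_of_int c\<bar>"
  unfolding zabs_def by linarith

lemma zabs_powr_summable:
  assumes "1 < p"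
  shows "(\<lambda>c. zabs c powr - p) summable_on UNIV"
proof -
  have nat: "(\<lambda>n::nat. zabs (int n) powr - p) summable_on UNIV"
  proof -
    have "summable (\<lambda>n::nat. real n powr - p)"
      using assms by (simp add: summable_real_powr_iff)
    then have "summable (\<lambda>n. real (Suc n) powr - p)"
      by (subst summable_Suc_iff)
    then have "summable (\<lambda>n. zabs (int (Suc n)) powr - p)"
      by (simp add: zabs_def)
    then have "summable (\<lambda>n. zabs (int n) powr - p)"
      by (subst (asm) summable_Suc_iff)
    then show ?thesis
      by (intro summable_nonneg_imp_summable_on) auto
  qed
  have "(\<lambda>c. zabs c powr - p) summable_on range int"
    using nat by (subst summable_on_reindex) (auto simp: o_def)
  moreover have "(\<lambda>c. zabs c powr - p) summable_on range (\<lambda>n. - int n)"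
    using nat by (subst summable_on_reindex) (auto simp: o_def zabs_def inj_on_def)
  ultimately have "(\<lambda>c. zabs c powr - p) summable_on (range int \<union> range (\<lambda>n. - int n))"
    by (rule summable_on_union)
  moreover have "range int \<union> range (\<lambda>n. - int n) = UNIV"
    by (auto simp: image_def) (metis int_cases2)
  ultimately show ?thesis by simp
qed

definition zeta_sum :: "real \<Rightarrow> real" where
  "zeta_sum p = infsum (\<lambda>c. zabs c powr - p) UNIV"

lemma bounded_sum_zabs: "1 < p \<Longrightarrow> bounded_sum (\<lambda>c. zabs c powr - p) UNIV (zeta_sum p)"
  unfolding zeta_sum_def by (intro bounded_sum_self zabs_powr_summable) auto

lemma zeta_sum_nonneg: "0 \<le> zeta_sum p"
  unfolding zeta_sum_def by (intro infsum_nonneg) auto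

text \<open>Exchanging n1 and n3 replaces the offsets by their negatives in reverse order and keeps
  the phase, so each fact about one offset yields the fact about the other.\<close>

lemma phase_off_sym: "phase_off n (- b) (- a) = phase_off n a b"
  unfolding phase_off_def by algebra

text \<open>The difference of two values factors into \<open>a\<close>, \<open>b - b'\<close> and a
  quadratic form that is positive since \<open>a\<close> is nonzero.\<close>

lemma phase_off_inj_snd:
  assumes "a \<noteq> 0" "phase_off n a b = phase_off n a b'"
  shows "b = b'"
proof (rule ccontr)
  assume "b \<noteq> b'"
  define D where "D = 3 * (2 * n + a - b - b')\<^sup>2 + (b - b')\<^sup>2 + a\<^sup>2"
  have "phase_off n a b - phase_off n a b' = a * (b - b') * D"
    unfolding phase_off_def D_def by algebra
  moreover have "D > 0"
    using assms by (auto simp: D_def intro!: add_nonneg_pos)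
  ultimately show False using assms \<open>b \<noteq> b'\<close> by simp
qed

lemma phase_off_inj_fst:
  assumes "b \<noteq> 0" "phase_off n a b = phase_off n a' b"
  shows "a = a'"
  using phase_off_inj_snd[of "- b" n "- a" "- a'"] assms by (simp add: phase_off_sym)

lemma phase_off_eq_0_iff: "phase_off n a b = 0 \<longleftrightarrow> a = 0 \<or> b = 0"
proof -
  have "a \<noteq> 0 \<Longrightarrow> 3 * (2 * n + a - b)\<^sup>2 + a\<^sup>2 + b\<^sup>2 > 0"
    using zero_le_power2[of "2 * n + a - b"] zero_le_power2[of b] zero_less_power2[of a] by linarith
  moreover have "b \<noteq> 0 \<Longrightarrow> 3 * (2 * n + a - b)\<^sup>2 + a\<^sup>2 + b\<^sup>2 > 0"
    using zero_le_power2[of "2 * n + a - b"] zero_le_power2[of a] zero_less_power2[of b] by linarith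
  ultimately show ?thesis by (auto simp: phase_off_def)
qed

lemma abs_phase_off:
  "\<bar>real_of_int (phase_off n a b)\<bar> = \<bar>real_of_int a\<bar> * \<bar>real_of_int b\<bar> *
     (3 * (2 * real_of_int n + real_of_int a - real_of_int b)\<^sup>2 + (real_of_int a)\<^sup>2 + (real_of_int b)\<^sup>2)"
  by (simp add: phase_off_def abs_mult)

lemma phase_off_lower_fst:
  assumes "\<bar>a\<bar> \<le> \<bar>b\<bar>"
  shows "real_of_int \<bar>a\<bar> ^ 4 \<le> \<bar>real_of_int (phase_off n a b)\<bar>"
proof -
  have ab: "\<bar>real_of_int a\<bar> \<le> \<bar>real_of_int b\<bar>" using assms by linarith
  have "\<bar>real_of_int a\<bar> * \<bar>real_of_int a\<bar> * (real_of_int a)\<^sup>2 \<le> \<bar>real_of_int a\<bar> * \<bar>real_of_int b\<bar> *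
     (3 * (2 * real_of_int n + real_of_int a - real_of_int b)\<^sup>2 + (real_of_int a)\<^sup>2 + (real_of_int b)\<^sup>2)"
    using ab by (intro mult_mono) auto
  moreover have "real_of_int \<bar>a\<bar> ^ 4 = \<bar>real_of_int a\<bar> * \<bar>real_of_int a\<bar> * (real_of_int a)\<^sup>2"
    by (simp add: power4_eq_xxxx power2_eq_square flip: abs_mult)
  ultimately show ?thesis by (simp only: abs_phase_off)
qed

lemma phase_off_lower_snd:
  "\<bar>b\<bar> \<le> \<bar>a\<bar> \<Longrightarrow> real_of_int \<bar>b\<bar> ^ 4 \<le> \<bar>real_of_int (phase_off n a b)\<bar>"
  using phase_off_lower_fst[of "- b" "- a" n] by (simp add: phase_off_sym)

definition off_nz :: "(int \<times> int) set" where
  "off_nz = {(a, b). a \<noteq> 0 \<and> b \<noteq> 0}"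

text \<open>The pair \<open>(a, b)\<close> is controlled through \<open>min |a| |b| ^ 4 \<le> |phase|\<close>; once the smaller
  offset is fixed, the phase takes each value at most once.\<close>

lemma bounded_sum_phase_off:
  assumes tau: "1 < \<tau>" and d: "\<delta> = \<tau> / 4" and mu: "\<mu> \<noteq> 0" and e: "\<bar>e\<bar> = 1"
  shows "bounded_sum (\<lambda>(a, b). zabs (\<mu> + e * phase_off n a b) powr - (9/8 + \<delta>)) off_nz
    (2 * 2 powr \<delta> * zeta_sum \<tau> * zeta_sum (9/8) * \<bar>real_of_int \<mu>\<bar> powr \<delta>)"
proof -
  define c where "c = (\<lambda>a b. \<mu> + e * phase_off n a b)"
  define M where "M = (2 * \<bar>real_of_int \<mu>\<bar>) powr \<delta>"
  have e0: "e \<noteq> 0" using e by auto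
  let ?Z = "zeta_sum \<tau> * zeta_sum (9/8)"
  have S: "bounded_sum (\<lambda>(x, y). zabs x powr - \<tau> * zabs (g x y) powr - (9/8)) ((UNIV - {0}) \<times> UNIV) ?Z"
    if inj: "\<And>x. x \<noteq> 0 \<Longrightarrow> inj (g x)" for g :: "int \<Rightarrow> int \<Rightarrow> int"
  proof (rule bounded_sum_Sigma)
    fix x :: int assume "x \<in> UNIV - {0}"
    then show "bounded_sum (\<lambda>y. case (x, y) of (x, y) \<Rightarrow> zabs x powr - \<tau> * zabs (g x y) powr - (9/8))
        UNIV
        (zabs x powr - \<tau> * zeta_sum (9/8))"
      using bounded_sum_cmult[OF bounded_sum_inj[OF bounded_sum_zabs[of "9/8"] inj, of x]] by simp
  next
    show "bounded_sum (\<lambda>x. zabs x powr - \<tau> * zeta_sum (9/8)) (UNIV - {0}) ?Z"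
      using bounded_sum_cmult[OF bounded_sum_subset[OF bounded_sum_zabs[OF tau], of "UNIV - {0}"]
          zeta_sum_nonneg[of "9/8"]]
      by (simp add: mult.commute)
  qed
  have inj1: "inj (c a)" if "a \<noteq> 0" for a
    using that e0 phase_off_inj_snd[of a n] by (auto simp: inj_on_def c_def)
  have inj2: "inj (\<lambda>a. c a b)" if "b \<noteq> 0" for b
    using that e0 phase_off_inj_fst[of b n] by (auto simp: inj_on_def c_def)
  have S1: "bounded_sum (\<lambda>(a, b). zabs a powr - \<tau> * zabs (c a b) powr - (9/8)) off_nz ?Z"
    by (rule bounded_sum_subset[OF S[OF inj1]]) (auto simp: off_nz_def)
  have S2: "bounded_sum (\<lambda>(a, b). zabs b powr - \<tau> * zabs (c a b) powr - (9/8)) off_nz ?Z"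
  proof -
    have "inj_on prod.swap off_nz" and "prod.swap ` off_nz \<subseteq> (UNIV - {0}) \<times> UNIV"
      by (auto simp: off_nz_def)
    from bounded_sum_inj[OF S[OF inj2] this] show ?thesis
      by (simp only: case_prod_unfold fst_swap snd_swap)
  qed
  have "bounded_sum (\<lambda>x. M * ((case x of (a, b) \<Rightarrow> zabs a powr - \<tau> * zabs (c a b) powr - (9/8))
      + (case x of (a, b) \<Rightarrow> zabs b powr - \<tau> * zabs (c a b) powr - (9/8)))) off_nz (M * (?Z + ?Z))"
    by (intro bounded_sum_cmult bounded_sum_add S1 S2) (simp add: M_def)
  then show ?thesis
  proof (rule bounded_sum_mono)
    fix x assume "x \<in> off_nz"
    then obtain a b where x: "x = (a, b)" and a: "a \<noteq> 0" and b: "b \<noteq> 0"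
      by (auto simp: off_nz_def)
    have "\<bar>real_of_int (phase_off n a b)\<bar> = \<bar>real_of_int (e * phase_off n a b)\<bar>"
      using e by (simp add: abs_mult flip: of_int_abs)
    also have "\<dots> = \<bar>real_of_int (c a b) - real_of_int \<mu>\<bar>"
      by (simp add: c_def)
    also have "\<dots> \<le> zabs \<mu> + zabs (c a b)"
      using abs_le_zabs[of \<mu>] abs_le_zabs[of "c a b"] by linarith
    \<comment> \<open>Both numbers are at least 1, so each is at most their product.\<close>
    also have "\<dots> \<le> 2 * zabs \<mu> * zabs (c a b)"
    proof -
      have "zabs \<mu> * 1 \<le> zabs \<mu> * zabs (c a b)" "1 * zabs (c a b) \<le> zabs \<mu> * zabs (c a b)"
        by (intro mult_left_mono mult_right_mono; simp)+
      then show ?thesis by linarith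
    qed
    finally have up: "\<bar>real_of_int (phase_off n a b)\<bar> \<le> 2 * \<bar>real_of_int \<mu>\<bar> * zabs (c a b)"
      using mu by (simp add: zabs_eq)
    \<comment> \<open>\<open>m\<close> is the smaller offset. Its fourth power is at most 2 |\<mu>|
      times \<open>zabs (c a b)\<close>; raising this to \<delta> = \<tau>/4 trades the part
      \<delta> of the decay in \<open>c\<close> for the decay \<tau> in \<open>m\<close>, at the
      price \<open>M\<close>.\<close>
    have *: "zabs (c a b) powr - (9/8 + \<delta>) \<le> M * (zabs m powr - \<tau> * zabs (c a b) powr - (9/8))"
      if m: "m \<noteq> 0" "real_of_int \<bar>m\<bar> ^ 4 \<le> \<bar>real_of_int (phase_off n a b)\<bar>" for m :: int
    proof -
      have "zabs m ^ 4 \<le> 2 * \<bar>real_of_int \<mu>\<bar> * zabs (c a b)"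
        using m up by (simp add: zabs_eq)
      then have "(zabs m ^ 4) powr \<delta> \<le> (2 * \<bar>real_of_int \<mu>\<bar> * zabs (c a b)) powr \<delta>"
        using tau d by (intro powr_mono2) auto
      also have "\<dots> = M * zabs (c a b) powr \<delta>"
        by (simp add: powr_mult M_def)
      finally have "zabs m powr \<tau> \<le> M * zabs (c a b) powr \<delta>"
        by (simp add: d powr_powr flip: powr_numeral)
      then have "zabs m powr \<tau> * (zabs m powr - \<tau> * zabs (c a b) powr - (9/8 + \<delta>)) \<le>
          M * zabs (c a b) powr \<delta> * (zabs m powr - \<tau> * zabs (c a b) powr - (9/8 + \<delta>))"
        by (intro mult_right_mono) auto
      also have "\<dots> = M * (zabs m powr - \<tau> * (zabs (c a b) powr \<delta> * zabs (c a b) powr - (9/8 + \<delta>)))"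
        by (simp only: mult_ac)
      also have "zabs (c a b) powr \<delta> * zabs (c a b) powr - (9/8 + \<delta>) = zabs (c a b) powr - (9/8)"
        by (simp flip: powr_add)
      finally show ?thesis
        by (simp flip: powr_add mult.assoc)
    qed
    have "zabs (c a b) powr - (9/8 + \<delta>) \<le> M * (zabs a powr - \<tau> * zabs (c a b) powr - (9/8))
        + M * (zabs b powr - \<tau> * zabs (c a b) powr - (9/8))"
    proof (cases "\<bar>a\<bar> \<le> \<bar>b\<bar>")
      case True
      then show ?thesis
        using *[OF a phase_off_lower_fst] by (auto simp: M_def intro: add_increasing2)
    next
      case False
      then show ?thesis
        using *[OF b phase_off_lower_snd] by (auto simp: M_def intro: add_increasing)
    qed
    then show "(case x of (a, b) \<Rightarrow> zabs (\<mu> + e * phase_off n a b) powr - (9/8 + \<delta>)) \<le>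
      M * ((case x of (a, b) \<Rightarrow> zabs a powr - \<tau> * zabs (c a b) powr - (9/8))
        + (case x of (a, b) \<Rightarrow> zabs b powr - \<tau> * zabs (c a b) powr - (9/8)))"
      by (simp add: x c_def distrib_left)
  next
    show "M * (?Z + ?Z) \<le> 2 * 2 powr \<delta> * zeta_sum \<tau> * zeta_sum (9/8) * \<bar>real_of_int \<mu>\<bar> powr \<delta>"
      by (simp add: M_def powr_mult)
  qed auto
qed

section \<open>The energy symbol and its quotient by the phase\<close>

definition energy_symbol :: "real \<Rightarrow> int \<Rightarrow> int \<Rightarrow> int \<Rightarrow> real" where
  "energy_symbol s n a b = jbracket n powr (2 * s) + jbracket (n + a - b) powr (2 * s)
     - jbracket (n + a) powr (2 * s) - jbracket (n - b) powr (2 * s)"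

lemma jbracket_ge_1: "1 \<le> jbracket n" and jbracket_pos: "0 < jbracket n"
  by (auto simp: jbracket_def intro: order.strict_trans2[OF zero_less_one])

lemma jbracket_le: "jbracket n \<le> 1 + \<bar>real_of_int n\<bar>"
  unfolding jbracket_def by (rule real_le_lsqrt) (auto simp: power2_sum)

lemma zabs_le_jbracket: "zabs n \<le> jbracket n"
  unfolding jbracket_def zabs_def by (rule real_le_rsqrt) (auto simp: max_def power2_eq_square
      abs_mult_self_eq)

lemma jbracket_diff: "\<bar>jbracket m - jbracket n\<bar> \<le> \<bar>real_of_int (m - n)\<bar>"
proof -
  have eq: "jbracket n = cmod (Complex 1 (of_int n))" for n
    by (simp add: jbracket_def cmod_def)
  have "\<bar>jbracket m - jbracket n\<bar> \<le> cmod (Complex 1 (of_int m) - Complex 1 (of_int n))"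
    unfolding eq by (rule norm_triangle_ineq3)
  also have "\<dots> = \<bar>real_of_int (m - n)\<bar>"
    by (simp add: cmod_def)
  finally show ?thesis .
qed

lemma jbracket_powr_diff:
  assumes s: "1/2 < s" "s < 1" and X: "jbracket m \<le> X" "jbracket n \<le> X"
  shows "\<bar>jbracket m powr (2 * s) - jbracket n powr (2 * s)\<bar> \<le> 2 * X powr (2 * s - 1) * \<bar>real_of_int
      (m - n)\<bar>"
proof -
  have "norm (jbracket m powr (2 * s) - jbracket n powr (2 * s)) \<le> 2 * X powr (2 * s-1) * norm
      (jbracket m - jbracket n)"
  proof (rule field_differentiable_bound[of "{1..X}"])
    fix u assume u: "u \<in> {1..X}"
    show "((\<lambda>u. u powr (2 * s)) has_field_derivative 2 * s * u powr (2 * s - 1)) (at u within {1..X})"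
      using u by (auto intro!: derivative_eq_intros)
    show "norm (2 * s * u powr (2 * s-1)) \<le> 2 * X powr (2 * s-1)"
    proof -
      have "(2 * s) * u powr (2 * s - 1) \<le> 2 * X powr (2 * s - 1)"
        using u s by (intro mult_mono powr_mono2) auto
      then show ?thesis using s by (simp add: abs_mult)
    qed
  qed (use X jbracket_ge_1 in auto)
  also have "\<dots> \<le> 2 * X powr (2 * s-1) * \<bar>real_of_int (m - n)\<bar>"
    using jbracket_diff[of m n] by (intro mult_left_mono) auto
  finally show ?thesis by simp
qed

text \<open>The four terms form two differences with step \<open>a\<close>, and also two with step
  \<open>b\<close>. Multiplying the two resulting mean value bounds makes the product of both
  offsets appear.\<close>

lemma energy_symbol_bound:
  assumes s: "1/2 < s" "s < 1" and X: "X = 1 + \<bar>real_of_int n\<bar> + \<bar>real_of_int a\<bar> + \<bar>real_of_int b\<bar>"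
  shows "(energy_symbol s n a b)\<^sup>2 \<le> 16 * X powr (4 * s - 2) * (\<bar>real_of_int a\<bar> * \<bar>real_of_int b\<bar>)"
proof -
  have le: "jbracket n \<le> X" "jbracket (n + a) \<le> X" "jbracket (n - b) \<le> X" "jbracket (n + a - b) \<le> X"
    using jbracket_le[of n] jbracket_le[of "n + a"] jbracket_le[of "n - b"] jbracket_le[of "n + a - b"]
    unfolding X by auto
  have X0: "0 < X" using le jbracket_pos order.strict_trans2 by blast
  let ?P = "X powr (2 * s - 1)"
  have 1: "\<bar>energy_symbol s n a b\<bar> \<le> 4 * ?P * \<bar>real_of_int a\<bar>"
    using jbracket_powr_diff[OF s le(1,2)] jbracket_powr_diff[OF s le(4,3)]
    by (simp add: energy_symbol_def)
  have 2: "\<bar>energy_symbol s n a b\<bar> \<le> 4 * ?P * \<bar>real_of_int b\<bar>"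
    using jbracket_powr_diff[OF s le(1,3)] jbracket_powr_diff[OF s le(4,2)]
    by (simp add: energy_symbol_def)
  have "(energy_symbol s n a b)\<^sup>2 = \<bar>energy_symbol s n a b\<bar> * \<bar>energy_symbol s n a b\<bar>"
    by (simp add: power2_eq_square)
  also have "\<dots> \<le> (4 * ?P * \<bar>real_of_int a\<bar>) * (4 * ?P * \<bar>real_of_int b\<bar>)"
    using 1 2 by (intro mult_mono) auto
  also have "\<dots> = 16 * (?P * ?P) * (\<bar>real_of_int a\<bar> * \<bar>real_of_int b\<bar>)"
    by simp
  also have "?P * ?P = X powr (4 * s - 2)"
    using X0 by (simp flip: powr_add)
  finally show ?thesis .
qed

text \<open>The quadratic factor of the phase dominates the square of the frequency size
  \<open>X\<close>; in the energy kernel this pays for the growth of the symbol in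
  \<open>X\<close>.\<close>

lemma phase_off_lower:
  assumes X: "X = 1 + \<bar>real_of_int n\<bar> + \<bar>real_of_int a\<bar> + \<bar>real_of_int b\<bar>" and a: "a \<noteq> 0"
  shows "\<bar>real_of_int a\<bar> * \<bar>real_of_int b\<bar> * X\<^sup>2 / 9 \<le> \<bar>real_of_int (phase_off n a b)\<bar>"
proof -
  define c where "c = \<bar>2 * real_of_int n + real_of_int a - real_of_int b\<bar>"
  define x where "x = \<bar>real_of_int a\<bar>"
  define y where "y = \<bar>real_of_int b\<bar>"
  have x1: "1 \<le> x" using a by (simp add: x_def)
  have "X \<le> c / 2 + 5/2 * x + 3/2 * y"
  \<comment> \<open>The triangle inequality recovers |n| from \<open>c\<close>, \<open>x\<close> and
    \<open>y\<close>, and the 1 in \<open>X\<close> is absorbed by \<open>x\<close>.\<close>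
  proof -
    have "2 * \<bar>real_of_int n\<bar> \<le> c + x + y"
      unfolding c_def x_def y_def by (auto simp: abs_if)
    then show ?thesis using x1 unfolding X x_def[symmetric] y_def[symmetric] by simp
  qed
  then have "X\<^sup>2 \<le> (c / 2 + 5/2 * x + 3/2 * y)\<^sup>2"
    using X by (intro power_mono) auto
  \<comment> \<open>By Cauchy-Schwarz the factor (1/2)^2/3 + (5/2)^2 + (3/2)^2 = 103/12 suffices. It
    is rounded up to 9, and the identity below is the corresponding sum of squares with the
    remainder 5/12.\<close>
  also have "\<dots> \<le> 9 * (3 * c\<^sup>2 + x\<^sup>2 + y\<^sup>2)"
  proof -
    have "9 * (3 * c\<^sup>2 + x\<^sup>2 + y\<^sup>2) - (c / 2 + 5/2 * x + 3/2 * y)\<^sup>2 =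
        3 * (5/2 * c - x/6)\<^sup>2 + 3 * (3/2 * c - y/6)\<^sup>2 + (5/2 * y - 3/2 * x)\<^sup>2
          + 5/12 * (3 * c\<^sup>2 + x\<^sup>2 + y\<^sup>2)"
      by (simp add: power2_eq_square field_simps)
    moreover have "\<dots> \<ge> 0"
      by (intro add_nonneg_nonneg mult_nonneg_nonneg) auto
    ultimately show ?thesis by linarith
  qed
  finally have "X\<^sup>2 / 9 \<le> 3 * c\<^sup>2 + x\<^sup>2 + y\<^sup>2" by simp
  then have "x * y * (X\<^sup>2 / 9) \<le> x * y * (3 * c\<^sup>2 + x\<^sup>2 + y\<^sup>2)"
    by (intro mult_left_mono) (auto simp: x_def y_def)
  then show ?thesis
    by (simp add: abs_phase_off c_def x_def y_def)
qed

text \<open>This \<delta> balances the three frequencies: \<open>n\<close>, \<open>a\<close> and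
  \<open>b\<close> all end up with the decay exponent 2-s, summable because s < 1, so the same zeta
  sum occurs three times.\<close>

lemma bounded_sum_energy_symbol:
  assumes s: "1/2 < s" "s < 1" and d: "\<delta> = (2 - s) / 4"
  shows "bounded_sum (\<lambda>(n, a, b). (energy_symbol s n a b)\<^sup>2 * \<bar>real_of_int (phase_off n a b)\<bar> powr
      (\<delta> - 2))
    (UNIV \<times> off_nz) (1296 * zeta_sum (2 - s) ^ 3)"
proof -
  let ?z = "\<lambda>n. zabs n powr - (2 - s)"
  have "bounded_sum (\<lambda>(n, (a, b)). ?z n * (case (a, b) of (a, b) \<Rightarrow> ?z a * ?z b)) (UNIV \<times> (UNIV \<times> UNIV))
      (zeta_sum (2 - s) * (zeta_sum (2 - s) * zeta_sum (2 - s)))"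
    using s bounded_sum_mult_Times[OF bounded_sum_zabs[of "2-s"] bounded_sum_mult_Times[OF
        bounded_sum_zabs[of "2-s"] bounded_sum_zabs[of "2-s"]]]
    by (simp add: case_prod_unfold)
  then have "bounded_sum (\<lambda>(n, a, b). ?z n * (?z a * ?z b)) (UNIV \<times> off_nz) (zeta_sum (2 - s) ^ 3)"
    by (rule bounded_sum_subset[THEN bounded_sum_mono]) (auto simp: power3_eq_cube)
  from bounded_sum_cmult[OF this, of 1296]
  show ?thesis
  proof (rule bounded_sum_mono)
    fix q assume "q \<in> (UNIV :: int set) \<times> off_nz"
    then obtain n a b where q: "q = (n, a, b)" and a: "a \<noteq> 0" and b: "b \<noteq> 0"
      by (auto simp: off_nz_def)
    define X where "X = 1 + \<bar>real_of_int n\<bar> + \<bar>real_of_int a\<bar> + \<bar>real_of_int b\<bar>"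
    define P where "P = \<bar>real_of_int a\<bar> * \<bar>real_of_int b\<bar>"
    have P0: "0 < P" using a b by (simp add: P_def)
    have X1: "1 \<le> X" by (simp add: X_def)
    have "\<bar>real_of_int (phase_off n a b)\<bar> powr (\<delta> - 2) \<le> (P * X\<^sup>2 / 9) powr (\<delta> - 2)"
      using phase_off_lower[OF X_def a] s P0 X1 d by (intro powr_mono2') (auto simp: P_def)
    also have "\<dots> = P powr (\<delta> - 2) * X powr (2 * \<delta> - 4) * 9 powr (2 - \<delta>)"
      using P0 X1 by (simp add: powr_divide powr_mult powr_minus_divide[of 9] powr_diff powr_powr
          powr_add right_diff_distrib flip: powr_numeral)
    \<comment> \<open>9^(2-\<delta>) is rounded up to 81, which together with the 16 of the symbol
      gives 1296.\<close>
    also have "\<dots> \<le> P powr (\<delta> - 2) * X powr (2 * \<delta> - 4) * 9 powr 2"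
      using s d by (intro mult_left_mono powr_mono) auto
    finally have "\<bar>real_of_int (phase_off n a b)\<bar> powr (\<delta> - 2) \<le> P powr (\<delta> - 2) * X powr (2 * \<delta> - 4) *
        81"
      by simp
    then have "(energy_symbol s n a b)\<^sup>2 * \<bar>real_of_int (phase_off n a b)\<bar> powr (\<delta> - 2) \<le>
        (16 * X powr (4 * s - 2) * P) * (P powr (\<delta> - 2) * X powr (2 * \<delta> - 4) * 81)"
      using energy_symbol_bound[OF s X_def] P0 by (intro mult_mono) (auto simp: P_def)
    also have "\<dots> = 1296 * (X powr (4 * s - 2) * X powr (2 * \<delta> - 4)) * (P powr 1 * P powr (\<delta> - 2))"
      using P0 by simp
    also have "\<dots> = 1296 * X powr (7/2 * s - 5) * P powr - (1/2 + s/4)"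
    proof -
      have "4 * s - 2 + (2 * \<delta> - 4) = 7/2 * s - 5" "1 + (\<delta> - 2) = - (1/2 + s/4)"
        by (simp_all add: d field_simps)
      then show ?thesis by (simp only: powr_add[symmetric])
    qed
    \<comment> \<open>The exponent is shared as 2-s for \<open>n\<close> and 3/2 - 5s/4 for each
      offset; the latter adds up with the 1/2 + s/4 from \<open>P\<close> to 2-s again.\<close>
    also have "X powr (7/2 * s - 5) = X powr - (2 - s) * (X powr - (3/2 - 5/4 * s) * X powr -
        (3/2 - 5/4 * s))"
      by (simp flip: powr_add)
    also have "\<dots> \<le> zabs n powr - (2 - s) * (zabs a powr - (3/2 - 5/4 * s) * zabs b powr - (3/2 - 5/4 *
        s))"
      using s by (intro mult_mono powr_mono2') (auto simp: X_def zabs_def)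
    also have "P powr - (1/2 + s/4) = zabs a powr - (1/2 + s/4) * zabs b powr - (1/2 + s/4)"
      using a b by (simp add: P_def zabs_eq powr_mult)
    also have "1296 * (zabs n powr - (2 - s) * (zabs a powr - (3/2 - 5/4 * s) * zabs b powr -
        (3/2 - 5/4 * s))) *
        (zabs a powr - (1/2 + s/4) * zabs b powr - (1/2 + s/4)) =
        1296 * (zabs n powr - (2 - s) * ((zabs a powr - (3/2 - 5/4 * s) * zabs a powr - (1/2 + s/4)) *
          (zabs b powr - (3/2 - 5/4 * s) * zabs b powr - (1/2 + s/4))))"
      by simp
    also have "\<dots> = 1296 * (?z n * (?z a * ?z b))"
    proof -
      have "- (3/2 - 5/4 * s) + - (1/2 + s/4) = - (2 - s)" by simp
      then show ?thesis by (simp only: powr_add[symmetric])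
    qed
    finally show "(case q of (n, a, b) \<Rightarrow> (energy_symbol s n a b)\<^sup>2 * \<bar>real_of_int (phase_off n a b)\<bar> powr
        (\<delta> - 2))
      \<le> 1296 * (case q of (n, a, b) \<Rightarrow> ?z n * (?z a * ?z b))"
      using q by (auto simp: mult_right_mono)
  qed auto
qed

section \<open>Substituting the equation into a form\<close>

text \<open>Substituting \<open>part_field D\<close> for one entry after the other multiplies the kernel by \<open>- \<i>\<close> or
  its conjugate. The vector field of \<open>(E\<^sub>N)\<close> is the part with nonzero offsets minus the part with
  \<open>D = {(0, 0)}\<close>, which is \<open>- \<i> |v\<^sub>n|\<^sup>2 v\<^sub>n\<close>.\<close>

definition ext_kernel ::
    "(int \<times> int) set \<Rightarrow> enat \<Rightarrow> (int list \<Rightarrow> complex) \<Rightarrow> int list \<Rightarrow> complex" where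
  "ext_kernel D N M ns =
     (if \<forall>x\<in>set ns. freq_le N x
      then \<Sum>k<length ns - 2. conj_odd k (- \<i>) * (if offsets k ns \<in> D then M (contract k ns) else 0)
      else 0)"

definition trilinear :: "(int \<Rightarrow> real) \<Rightarrow> int \<Rightarrow> real" where
  "trilinear w n = (\<Sum>\<^sub>\<infinity>(x, y)\<in>UNIV. w (n + x) * w (n + x - y) * w (n - y))"

definition off_freq :: "(int \<times> int) set \<Rightarrow> enat \<Rightarrow> int \<Rightarrow> (int \<times> int) set" where
  "off_freq D N n = {(x, y) \<in> D. freq_le N (n + x) \<and> freq_le N (n + x - y) \<and> freq_le N (n - y)}"

definition part_field :: "(int \<times> int) set \<Rightarrow> enat \<Rightarrow> real \<Rightarrow> (int \<Rightarrow> complex) \<Rightarrow> int \<Rightarrow> complex" where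
  "part_field D N t a n = - \<i> * (\<Sum>\<^sub>\<infinity>(x, y)\<in>off_freq D N n.
     cis (- (of_int (phase_off n x y) * t)) * (a (n + x) * cnj (a (n + x - y)) * a (n - y)))"

definition form_sum :: "nat \<Rightarrow> (int list \<Rightarrow> complex) \<Rightarrow> real \<Rightarrow> (nat \<Rightarrow> int \<Rightarrow> complex) \<Rightarrow> complex" where
  "form_sum k G t bs =
     (\<Sum>\<^sub>\<infinity>ns\<in>tuples k. G ns * cis (- (of_int (alt_phase ns) * t)) * tensor bs 0 ns)"

text \<open>Cauchy-Schwarz over the \<open>m\<close> positions costs one factor \<open>m\<close>,
  and adding up the \<open>m\<close> pieces costs another. In each piece the children of a fixed
  parent are summed first; their bound \<open>g\<close> depends on the parent and may use that the
  kernel does not vanish there.\<close>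

lemma bounded_sum_ext_kernel:
  assumes h: "\<And>ns. 0 \<le> h ns"
    and fiber: "\<And>p k. p \<in> tuples m \<Longrightarrow> M p \<noteq> 0 \<Longrightarrow> k < m \<Longrightarrow>
      bounded_sum (\<lambda>ab. h (expand k p ab)) D (g p)"
    and M: "bounded_sum (\<lambda>p. g p * (cmod (M p))\<^sup>2) (tuples m) B"
  shows "bounded_sum (\<lambda>ns. h ns * (cmod (ext_kernel D N M ns))\<^sup>2) (tuples (m + 2))
    (real m ^ 2 * B)"
proof -
  define F where "F = (\<lambda>k ns. h ns * (if offsets k ns \<in> D then (cmod (M (contract k ns)))\<^sup>2 else 0))"
  have F: "bounded_sum (F k) (tuples (m + 2)) B" if k: "k < m" for k
  proof (subst bounded_sum_reindex[OF bij_betw_expand[OF k], symmetric], rule bounded_sum_Sigma[OF _ M])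
    fix p assume p: "p \<in> tuples m"
    show "bounded_sum (\<lambda>ab. F k (case (p, ab) of (p, ab) \<Rightarrow> expand k p ab)) UNIV (g p * (cmod (M p))\<^sup>2)"
    proof (cases "M p = 0")
      case True
      then have "F k (expand k p ab) = 0" for ab
        using p k by (simp add: F_def tuples_def contract_expand)
      then show ?thesis by (simp add: True bounded_sum_def)
    next
      case False
      have "bounded_sum (\<lambda>ab. if ab \<in> D then (cmod (M p))\<^sup>2 * h (expand k p ab) else 0) UNIV
          ((cmod (M p))\<^sup>2 * g p)"
        using fiber[OF p False k] by (intro bounded_sum_indicator bounded_sum_cmult) auto
      moreover have "F k (expand k p ab) = (if ab \<in> D then (cmod (M p))\<^sup>2 * h (expand k p ab) else 0)"
          for ab
        using p k by (simp add: F_def tuples_def contract_expand offsets_expand)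
      ultimately show ?thesis by (simp add: mult.commute)
    qed
  qed
  have "bounded_sum (\<lambda>ns. real m * (\<Sum>k<m. F k ns)) (tuples (m + 2)) (real m * (\<Sum>k<m. B))"
    by (intro bounded_sum_cmult bounded_sum_sum F) auto
  then show ?thesis
  proof (rule bounded_sum_mono)
    fix ns :: "int list" assume ns: "ns \<in> tuples (m + 2)"
    have *: "(cmod (ext_kernel D N M ns))\<^sup>2 \<le>
        real m * (\<Sum>k<m. if offsets k ns \<in> D then (cmod (M (contract k ns)))\<^sup>2 else 0)"
    proof (cases "\<forall>x\<in>set ns. freq_le N x")
      case True
      have "cmod (ext_kernel D N M ns) \<le> (\<Sum>k<m. if offsets k ns \<in> D then cmod (M (contract k ns)) else
          0)"
        using ns True by (auto simp: ext_kernel_def tuples_def norm_mult intro!: sum_norm_le)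
      then have "(cmod (ext_kernel D N M ns))\<^sup>2 \<le> (\<Sum>k<m. if offsets k ns \<in> D then cmod
          (M (contract k ns)) else 0)\<^sup>2"
        by (intro power_mono) auto
      also have "\<dots> \<le> (\<Sum>k<m. (if offsets k ns \<in> D then cmod (M (contract k ns)) else 0)\<^sup>2) * real
          (card {..<m})"
        by (rule sum_squared_le_sum_of_squares)
      also have "(\<lambda>k. (if offsets k ns \<in> D then cmod (M (contract k ns)) else 0)\<^sup>2) =
          (\<lambda>k. if offsets k ns \<in> D then (cmod (M (contract k ns)))\<^sup>2 else 0)"
        by auto
      finally show ?thesis by (simp add: mult.commute)
    qed (auto simp: ext_kernel_def intro!: mult_nonneg_nonneg sum_nonneg)
    show "h ns * (cmod (ext_kernel D N M ns))\<^sup>2 \<le> real m * (\<Sum>k<m. F k ns)"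
      using mult_left_mono[OF * h[of ns]] by (simp add: F_def sum_distrib_left mult_ac)
  qed (use h in \<open>auto simp: power2_eq_square\<close>)
qed

text \<open>A pointwise majorant of the Fourier coefficients makes the sums absolutely convergent,
  hence free to be reordered, and \<open>trilinear w\<close> in turn majorises the cubic
  terms.\<close>

locale trilinear_majorant =
  fixes w :: "int \<Rightarrow> real"
  assumes w_nonneg: "0 \<le> w n"
    and w_summable: "(\<lambda>(x, y). w (n + x) * w (n + x - y) * w (n - y)) summable_on UNIV"
begin

abbreviation upd :: "nat \<Rightarrow> nat \<Rightarrow> int \<Rightarrow> real" where
  "upd k \<equiv> (\<lambda>_. w)(k := trilinear w)"

lemma bounded_sum_trilinear:
  "bounded_sum (\<lambda>(x, y). w (n + x) * w (n + x - y) * w (n - y)) UNIV (trilinear w n)"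
  unfolding trilinear_def using w_nonneg w_summable by (intro bounded_sum_self) auto

lemma trilinear_nonneg: "0 \<le> trilinear w n"
  by (rule bounded_sum_ge_0[OF bounded_sum_trilinear])

lemma bounded_sum_expand:
  assumes k: "k < m"
    and B: "bounded_sum (\<lambda>p. cmod (M p) * tprod (upd k) 0 p) (tuples m) B"
  shows "bounded_sum (\<lambda>(p, ab). cmod (M p) * tprod (\<lambda>_. w) 0 (expand k p ab)) (tuples m \<times> UNIV) B"
proof (rule bounded_sum_Sigma[OF _ B])
  fix p assume "p \<in> tuples m"
  then have p: "k < length p" using k by (simp add: tuples_def)
  define c where "c = cmod (M p) * tprod (\<lambda>_. w) 0 (take k p) * tprod (\<lambda>_. w) (Suc k) (drop (Suc k) p)"
  have c: "0 \<le> c" by (auto simp: c_def w_nonneg intro!: mult_nonneg_nonneg tprod_nonneg)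
  have "bounded_sum (\<lambda>(x, y). c * (w (p!k + x) * w (p!k + x - y) * w (p!k - y))) UNIV (c * trilinear w
      (p!k))"
    using bounded_sum_cmult[OF bounded_sum_trilinear[of "p!k"] c] by (simp add: case_prod_unfold)
  moreover have "cmod (M p) * tprod (\<lambda>_. w) 0 (expand k p ab) =
      (case ab of (x, y) \<Rightarrow> c * (w (p!k + x) * w (p!k + x - y) * w (p!k - y)))" for ab
    by (cases ab) (simp add: tprod_const_expand[OF p] c_def mult_ac)
  ultimately show "bounded_sum (\<lambda>ab. case (p, ab) of (p, ab) \<Rightarrow> cmod (M p) * tprod (\<lambda>_. w) 0
      (expand k p ab)) UNIV
      (cmod (M p) * tprod (upd k) 0 p)"
    by (simp add: tprod_upd[OF p] c_def mult_ac)
qed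

lemma bounded_sum_ext_kernel_tprod:
  assumes B: "\<And>k. k < m \<Longrightarrow>
    bounded_sum (\<lambda>p. cmod (M p) * tprod (upd k) 0 p) (tuples m) (B k)"
  shows "bounded_sum (\<lambda>ns. cmod (ext_kernel D N M ns) * tprod (\<lambda>_. w) 0 ns) (tuples (m + 2))
      (\<Sum>k<m. B k)"
proof -
  have "bounded_sum (\<lambda>ns. cmod (M (contract k ns)) * tprod (\<lambda>_. w) 0 ns) (tuples (m + 2)) (B k)"
      if k: "k < m" for k
  proof (subst bounded_sum_reindex[OF bij_betw_expand[OF k], symmetric])
    show "bounded_sum (\<lambda>x. cmod (M (contract k (case x of (p, ab) \<Rightarrow> expand k p ab))) *
        tprod (\<lambda>_. w) 0 (case x of (p, ab) \<Rightarrow> expand k p ab)) (tuples m \<times> UNIV) (B k)"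
      by (rule bounded_sum_mono[OF bounded_sum_expand[OF k B[OF k]]])
         (use k in \<open>auto simp: tuples_def contract_expand w_nonneg intro!: mult_nonneg_nonneg
             tprod_nonneg\<close>)
  qed
  then have "bounded_sum (\<lambda>ns. \<Sum>k<m. cmod (M (contract k ns)) * tprod (\<lambda>_. w) 0 ns) (tuples (m + 2))
      (\<Sum>k<m. B k)"
    by (intro bounded_sum_sum) auto
  then show ?thesis
  proof (rule bounded_sum_mono)
    fix ns :: "int list" assume ns: "ns \<in> tuples (m + 2)"
    have "cmod (ext_kernel D N M ns) \<le> (\<Sum>k<m. cmod (M (contract k ns)))"
      using ns by (auto simp: ext_kernel_def tuples_def norm_mult intro!: sum_norm_le sum_nonneg)
    then show "cmod (ext_kernel D N M ns) * tprod (\<lambda>_. w) 0 ns \<le> (\<Sum>k<m. cmod (M (contract k ns)) * tprod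
        (\<lambda>_. w) 0 ns)"
      by (auto simp flip: sum_distrib_right intro!: mult_right_mono tprod_nonneg w_nonneg)
  qed (auto intro!: mult_nonneg_nonneg tprod_nonneg w_nonneg)
qed

lemma conj_odd_cis: "conj_odd k (cis x) = cis ((-1) ^ k * x)"
  by (simp add: conj_odd_def cis_cnj)

text \<open>Fubini in parents and offsets reads the extended kernel backwards: phase, tensor and
  conjugation all factor at the chosen slot. By \<open>supp\<close> the parent respects the
  truncation, so truncating the child concerns the three new entries only.\<close>

lemma form_sum_ext_kernel:
  assumes a: "\<And>n. cmod (a n) \<le> w n"
    and B: "\<And>k. k < m \<Longrightarrow>
      bounded_sum (\<lambda>p. cmod (M p) * tprod (upd k) 0 p) (tuples m) (B k)"
    and supp: "\<And>p x. M p \<noteq> 0 \<Longrightarrow> x \<in> set p \<Longrightarrow> freq_le N x"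
  shows "form_sum (m + 2) (ext_kernel D N M) t (\<lambda>_. a) =
    (\<Sum>\<^sub>\<infinity>p\<in>tuples m. M p * cis (- (of_int (alt_phase p) * t)) *
        (\<Sum>k<m. tensor ((\<lambda>_. a)(k := part_field D N t a)) 0 p))"
proof -
  define E where "E = (\<lambda>ns. cis (- (of_int (alt_phase ns) * t)))"
  define F where "F = (\<lambda>k ns. (if (\<forall>x\<in>set ns. freq_le N x) \<and> offsets k ns \<in> D
      then conj_odd k (- \<i>) * M (contract k ns) else 0) * E ns * tensor (\<lambda>_. a) 0 ns)"
  have F_sum: "(\<lambda>x. F k (case x of (p, ab) \<Rightarrow> expand k p ab)) summable_on tuples m \<times> UNIV" if k: "k < m"
      for k
  proof (rule bounded_sum_norm_mono[OF bounded_sum_expand[OF k B[OF k]]], clarify)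
    fix p x y assume p: "p \<in> tuples m"
    have "cmod (tensor (\<lambda>_. a) 0 (expand k p (x, y))) \<le> tprod (\<lambda>_. w) 0 (expand k p (x, y))"
      using a by (intro norm_tensor_le) auto
    then show "cmod (F k (expand k p (x, y))) \<le> cmod (M p) * tprod (\<lambda>_. w) 0 (expand k p (x, y))"
      using p k by (auto simp: F_def E_def norm_mult tuples_def contract_expand w_nonneg
          intro!: mult_left_mono mult_nonneg_nonneg tprod_nonneg)
  qed
  have F_sum': "F k summable_on tuples (m + 2)" if k: "k < m" for k
    using F_sum[OF k] by (subst (asm) summable_on_reindex_bij_betw[OF bij_betw_expand[OF k]])
  have inner: "(\<Sum>\<^sub>\<infinity>ab. F k (expand k p ab)) = M p * E p * tensor ((\<lambda>_. a)(k := part_field D N t a)) 0 p"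
    if k: "k < m" and p: "p \<in> tuples m" for k p
  proof (cases "M p = 0")
    case True
    then have "F k (expand k p ab) = 0" for ab
      using p k by (simp add: F_def tuples_def contract_expand)
    then show ?thesis by (simp add: True)
  next
    case False
    have kp: "k < length p" using k p by (simp add: tuples_def)
    let ?L = "tensor (\<lambda>_. a) 0 (take k p)" and ?R = "tensor (\<lambda>_. a) (Suc k) (drop (Suc k) p)"
    define h where "h = (\<lambda>(x, y). cis (- (of_int (phase_off (p!k) x y) * t)) *
      (a (p!k + x) * cnj (a (p!k + x - y)) * a (p!k - y)))"
    have freq: "(\<forall>z\<in>set (expand k p (x, y)). freq_le N z) \<longleftrightarrow>
        freq_le N (p!k + x) \<and> freq_le N (p!k + x - y) \<and> freq_le N (p!k - y)" for x y
      using supp[OF False] by (auto simp: expand_def dest: in_set_takeD in_set_dropD)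
    have E: "E (expand k p (x, y)) = E p * conj_odd k (cis (- (of_int (phase_off (p!k) x y) * t)))"
        for x y
      by (simp add: E_def alt_phase_expand[OF kp] conj_odd_cis cis_mult algebra_simps)
    have "F k (expand k p ab) = (if ab \<in> off_freq D N (p!k)
        then M p * E p * ?L * ?R * conj_odd k (- \<i>) * conj_odd k (h ab) else 0)" for ab
      by (cases ab) (auto simp: F_def freq E off_freq_def h_def contract_expand[OF kp] offsets_expand[OF
          kp]
        tensor_const_expand[OF kp] conj_odd_mult)
    then have "(\<Sum>\<^sub>\<infinity>ab. F k (expand k p ab)) =
        (\<Sum>\<^sub>\<infinity>ab\<in>off_freq D N (p!k). M p * E p * ?L * ?R * conj_odd k (- \<i>) * conj_odd k (h ab))"
      by (intro infsum_cong_neutral) auto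
    also have "\<dots> = M p * E p * ?L * ?R * conj_odd k (- \<i> * (\<Sum>\<^sub>\<infinity>ab\<in>off_freq D N (p!k). h ab))"
      by (simp only: infsum_cmult_right' conj_odd_mult conj_odd_infsum mult.assoc)
    also have "- \<i> * (\<Sum>\<^sub>\<infinity>ab\<in>off_freq D N (p!k). h ab) = part_field D N t a (p!k)"
      by (simp add: part_field_def h_def)
    also have "M p * E p * ?L * ?R * conj_odd k (part_field D N t a (p!k)) =
        M p * E p * tensor ((\<lambda>_. a)(k := part_field D N t a)) 0 p"
      by (simp add: tensor_upd[OF kp])
    finally show ?thesis .
  qed
  have out: "infsum (F k) (tuples (m + 2)) =
      (\<Sum>\<^sub>\<infinity>p\<in>tuples m. M p * E p * tensor ((\<lambda>_. a)(k := part_field D N t a)) 0 p)"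
    and out_sum: "(\<lambda>p. M p * E p * tensor ((\<lambda>_. a)(k := part_field D N t a)) 0 p) summable_on tuples m"
    if k: "k < m" for k
  proof -
    have "infsum (F k) (tuples (m + 2)) =
        (\<Sum>\<^sub>\<infinity>x\<in>tuples m \<times> UNIV. F k (case x of (p, ab) \<Rightarrow> expand k p ab))"
      by (rule infsum_reindex_bij_betw[OF bij_betw_expand[OF k], symmetric])
    also have "\<dots> = (\<Sum>\<^sub>\<infinity>p\<in>tuples m. \<Sum>\<^sub>\<infinity>ab. F k (expand k p ab))"
      using infsum_Sigma_banach[OF F_sum[OF k]] by simp
    also have "\<dots> = (\<Sum>\<^sub>\<infinity>p\<in>tuples m. M p * E p * tensor ((\<lambda>_. a)(k := part_field D N t a)) 0 p)"
      by (intro infsum_cong inner k)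
    finally show "infsum (F k) (tuples (m + 2)) =
      (\<Sum>\<^sub>\<infinity>p\<in>tuples m. M p * E p * tensor ((\<lambda>_. a)(k := part_field D N t a)) 0 p)" .
    have "(\<lambda>p. \<Sum>\<^sub>\<infinity>ab. F k (expand k p ab)) summable_on tuples m"
      using F_sum[OF k] by (intro summable_on_Sigma_banach) (simp add: case_prod_unfold)
    then show "(\<lambda>p. M p * E p * tensor ((\<lambda>_. a)(k := part_field D N t a)) 0 p) summable_on tuples m"
      by (subst (asm) summable_on_cong[where g = "\<lambda>p. M p * E p * tensor ((\<lambda>_. a)(k := part_field D N t
          a)) 0 p"])
         (simp_all add: inner k)
  qed
  have "form_sum (m + 2) (ext_kernel D N M) t (\<lambda>_. a) = (\<Sum>\<^sub>\<infinity>ns\<in>tuples (m + 2). \<Sum>k<m. F k ns)"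
    unfolding form_sum_def
  proof (rule infsum_cong)
    fix ns assume "ns \<in> tuples (m + 2)"
    then have "length ns - 2 = m" by (simp add: tuples_def)
    then show "ext_kernel D N M ns * cis (- (of_int (alt_phase ns) * t)) * tensor (\<lambda>_. a) 0 ns =
        (\<Sum>k<m. F k ns)"
      by (cases "\<forall>x\<in>set ns. freq_le N x")
         (simp_all add: ext_kernel_def F_def E_def sum_distrib_right if_distrib if_distribR cong:
             if_cong)
  qed
  also have "\<dots> = (\<Sum>k<m. infsum (F k) (tuples (m + 2)))"
    by (intro infsum_sum F_sum') auto
  also have "\<dots> = (\<Sum>k<m. \<Sum>\<^sub>\<infinity>p\<in>tuples m. M p * E p * tensor ((\<lambda>_. a)(k := part_field D N t a)) 0 p)"
    by (intro sum.cong out) auto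
  also have "\<dots> = (\<Sum>\<^sub>\<infinity>p\<in>tuples m. \<Sum>k<m. M p * E p * tensor ((\<lambda>_. a)(k := part_field D N t a)) 0 p)"
    by (intro infsum_sum[symmetric] out_sum) auto
  finally show ?thesis by (simp add: E_def sum_distrib_left)
qed

end

section \<open>The kernels of the normal form iteration\<close>

text \<open>The factor 1/4 averages over the four entries that can carry the weight of the energy.
  The entries are n1, n2, n3 and last n, which thus stands in a conjugated slot.\<close>

definition energy_kernel :: "real \<Rightarrow> enat \<Rightarrow> int list \<Rightarrow> complex" where
  "energy_kernel s N ns =
     (if length ns = 4 \<and> (\<forall>x\<in>set ns. freq_le N x) \<and> ns ! 0 - ns ! 1 + ns ! 2 = ns ! 3
          \<and> ns ! 0 \<noteq> ns ! 3 \<and> ns ! 2 \<noteq> ns ! 3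
      then - \<i> / 4 * of_real (energy_symbol s (ns ! 3) (ns ! 0 - ns ! 3) (ns ! 3 - ns ! 2)) else 0)"

text \<open>The index \<open>i\<close> stands for \<open>j - 2\<close>, so that \<open>nf_kernel s N i\<close> has \<open>m = 2 * i + 4\<close> entries.
  A substitution costs a factor \<open>m\<^sup>2\<close> in the square sum, which is beaten by the gain
  \<open>threshold i powr (-1/8) = m powr (-4)\<close>.\<close>

definition threshold :: "nat \<Rightarrow> real" where
  "threshold i = real (2 * i + 4) ^ 32"

text \<open>Since exp (-i t \<Phi>) is the time derivative of (i/\<Phi>) exp (-i t \<Phi>), an
  integration by parts multiplies the kernel by i/\<Phi>; the minus sign comes from moving the
  substituted equation to the other side. The first step has no threshold because the energy kernel
  vanishes wherever the phase does.\<close>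

primrec nf_kernel :: "real \<Rightarrow> enat \<Rightarrow> nat \<Rightarrow> int list \<Rightarrow> complex" where
  "nf_kernel s N 0 = (\<lambda>ns. \<i> * energy_kernel s N ns / of_int (alt_phase ns))"
| "nf_kernel s N (Suc i) = (\<lambda>ns.
     if \<bar>real_of_int (alt_phase ns)\<bar> > threshold i
     then - \<i> * ext_kernel off_nz N (nf_kernel s N i) ns / of_int (alt_phase ns) else 0)"

definition near_kernel :: "real \<Rightarrow> enat \<Rightarrow> nat \<Rightarrow> int list \<Rightarrow> complex" where
  "near_kernel s N i ns =
     (if \<bar>real_of_int (alt_phase ns)\<bar> \<le> threshold i then - ext_kernel off_nz N (nf_kernel s N i) ns else
         0)"

text \<open>Zero offsets leave the phase unchanged, so the contribution of |v_n|^2 v_n has no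
  oscillation to gain from; it is set aside at every step and becomes the remainder forms.\<close>

definition diag_kernel :: "real \<Rightarrow> enat \<Rightarrow> nat \<Rightarrow> int list \<Rightarrow> complex" where
  "diag_kernel s N i = ext_kernel {(0, 0)} N (nf_kernel s N i)"

text \<open>The summand 1 keeps the constant at least 1, so that an extra power of it can be
  inserted into upper bounds.\<close>

definition phase_const :: "real \<Rightarrow> real" where
  "phase_const s = 1 + 2 * 2 powr ((2 - s) / 4) * zeta_sum (2 - s) * zeta_sum (9/8)"

definition base_const :: "real \<Rightarrow> real" where
  "base_const s = 1296 * zeta_sum (2 - s) ^ 3"

definition weight_bound :: "real \<Rightarrow> nat \<Rightarrow> real" where
  "weight_bound s i = base_const s * phase_const s ^ i / (fact i)\<^sup>2"

lemma phase_const_ge_1: "1 \<le> phase_const s"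
  by (simp add: phase_const_def zeta_sum_nonneg)

lemma base_const_nonneg: "0 \<le> base_const s"
  by (simp add: base_const_def zeta_sum_nonneg)

lemma threshold_ge_1: "1 \<le> threshold i"
  by (simp add: threshold_def)

lemma ext_kernel_nonzero_freq: "ext_kernel D N M ns \<noteq> 0 \<Longrightarrow> x \<in> set ns \<Longrightarrow> freq_le N x"
  by (auto simp: ext_kernel_def split: if_splits)

lemma nf_kernel_freq: "nf_kernel s N i ns \<noteq> 0 \<Longrightarrow> x \<in> set ns \<Longrightarrow> freq_le N x"
  by (cases i) (auto simp: energy_kernel_def ext_kernel_nonzero_freq split: if_splits)

lemma nf_kernel_phase: "nf_kernel s N i ns \<noteq> 0 \<Longrightarrow> alt_phase ns \<noteq> 0"
  by (cases i) (auto split: if_splits)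

lemma length_4_conv: "length ns = 4 \<longleftrightarrow> (\<exists>a b c d. ns = [a, b, c, d])"
  by (auto simp: eval_nat_numeral length_Suc_conv)

lemma alt_phase_4:
  assumes "q1 - q2 + q3 = q4"
  shows "alt_phase [q1, q2, q3, q4] = phase_off q4 (q1 - q4) (q4 - q3)"
  using phase_eq_phase_off[of q4 "q1 - q4" "q4 - q3"] assms
  by (simp add: phase_def algebra_simps)

section \<open>Weighted square sums of the kernels\<close>

abbreviation phase_weight :: "real \<Rightarrow> int list \<Rightarrow> real" where
  "phase_weight s ns \<equiv> \<bar>real_of_int (alt_phase ns)\<bar> powr ((2 - s) / 4)"

lemma bounded_sum_nf_kernel_0:
  assumes s: "1/2 < s" "s < 1"
  shows "bounded_sum (\<lambda>ns. phase_weight s ns * (cmod (nf_kernel s N 0 ns))\<^sup>2)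
    (tuples 4) (base_const s)"
proof -
  let ?\<delta> = "(2 - s) / 4"
  define S where "S = {ns. length ns = 4 \<and> ns ! 0 - ns ! 1 + ns ! 2 = ns ! 3 \<and> ns ! 0 \<noteq> ns ! 3 \<and> ns ! 2
      \<noteq> (ns ! 3 :: int)}"
  define g where "g = (\<lambda>(n, a, b). (energy_symbol s n a b)\<^sup>2 * \<bar>real_of_int (phase_off n a b)\<bar> powr
      (?\<delta> - 2))"
  let ?h = "\<lambda>ns :: int list. (ns ! 3, ns ! 0 - ns ! 3, ns ! 3 - ns ! 2)"
  have "bounded_sum (\<lambda>ns. g (?h ns)) S (base_const s)"
    unfolding base_const_def
    by (rule bounded_sum_inj[OF bounded_sum_energy_symbol[OF s refl, folded g_def]])
       (auto simp: S_def inj_on_def off_nz_def length_4_conv)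
  then have "bounded_sum (\<lambda>ns. \<bar>real_of_int (alt_phase ns)\<bar> powr ?\<delta> * (cmod (nf_kernel s N 0 ns))\<^sup>2) S
      (base_const s)"
  proof (rule bounded_sum_mono)
    fix ns assume "ns \<in> S"
    then obtain q1 q2 q3 q4 where ns: "ns = [q1, q2, q3, q4]" and q: "q1 - q2 + q3 = q4" "q1 \<noteq> q4" "q3 \<noteq>
        q4"
      by (auto simp: S_def length_4_conv)
    define F where "F = \<bar>real_of_int (phase_off q4 (q1 - q4) (q4 - q3))\<bar>"
    have F: "F > 0" using q by (simp add: F_def phase_off_eq_0_iff)
    have "cmod (energy_kernel s N ns) \<le> \<bar>energy_symbol s q4 (q1 - q4) (q4 - q3)\<bar>"
      by (simp add: ns energy_kernel_def norm_mult norm_divide)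
    then have "cmod (nf_kernel s N 0 ns) \<le> \<bar>energy_symbol s q4 (q1 - q4) (q4 - q3)\<bar> / F"
      using F by (simp add: ns alt_phase_4[OF q(1)] norm_mult norm_divide F_def divide_right_mono del:
          alt_phase.simps)
    then have "(cmod (nf_kernel s N 0 ns))\<^sup>2 \<le> (\<bar>energy_symbol s q4 (q1 - q4) (q4 - q3)\<bar> / F)\<^sup>2"
      by (intro power_mono) auto
    then have "F powr ?\<delta> * (cmod (nf_kernel s N 0 ns))\<^sup>2 \<le> F powr ?\<delta> * (\<bar>energy_symbol s q4 (q1 - q4)
        (q4 - q3)\<bar> / F)\<^sup>2"
      by (intro mult_left_mono) auto
    also have "\<dots> = (energy_symbol s q4 (q1 - q4) (q4 - q3))\<^sup>2 * F powr (?\<delta> - 2)"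
      using F by (simp add: powr_diff power_divide)
    finally show "\<bar>real_of_int (alt_phase ns)\<bar> powr ?\<delta> * (cmod (nf_kernel s N 0 ns))\<^sup>2 \<le> g (?h ns)"
      by (simp add: ns alt_phase_4[OF q(1)] F_def g_def del: alt_phase.simps)
  qed auto
  then show ?thesis
    by (rule bounded_sum_extend) (auto simp: S_def tuples_def energy_kernel_def)
qed

lemma abs_minus_one_power: "\<bar>(-1) ^ k :: int\<bar> = 1"
  by (simp add: power_abs)

lemma bounded_sum_fiber_weight:
  assumes s: "1/2 < s" "s < 1" and p: "k < length p" "alt_phase p \<noteq> 0"
  shows "bounded_sum (\<lambda>ab. zabs (alt_phase (expand k p ab)) powr - (9/8 + (2 - s) / 4)) off_nz
    (phase_const s * phase_weight s p)"
proof -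
  have "bounded_sum (\<lambda>(a, b). zabs (alt_phase p + (-1) ^ k * phase_off (p ! k) a b) powr -
      (9/8 + (2 - s) / 4)) off_nz
    (2 * 2 powr ((2 - s) / 4) * zeta_sum (2 - s) * zeta_sum (9/8) * phase_weight s p)"
    using s p by (intro bounded_sum_phase_off abs_minus_one_power) auto
  then show ?thesis
    by (rule bounded_sum_mono)
       (auto simp: phase_const_def alt_phase_expand[OF p(1)] intro!: mult_right_mono)
qed

text \<open>This serves both sides of the split. They differ only in \<open>c\<close>: an inverse
  power of the threshold for the far part, the square of the threshold for the near part.\<close>

lemma bounded_sum_ext_nf_kernel:
  assumes s: "1/2 < s" "s < 1" and m: "m = 2 * i + 4"
    and W: "bounded_sum (\<lambda>ns. phase_weight s ns * (cmod (nf_kernel s N i ns))\<^sup>2)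
      (tuples m) B"
    and c: "0 \<le> c" and h0: "\<And>ns. 0 \<le> h ns"
    and h: "\<And>ns. h ns \<le> c * zabs (alt_phase ns) powr - (9/8 + (2 - s) / 4)"
  shows "bounded_sum (\<lambda>ns. h ns * (cmod (ext_kernel off_nz N (nf_kernel s N i) ns))\<^sup>2)
    (tuples (m + 2)) (real m ^ 2 * (c * phase_const s * B))"
proof (rule bounded_sum_ext_kernel[where g = "\<lambda>p. c * (phase_const s * phase_weight s p)"])
  fix p k assume p: "p \<in> tuples m" "nf_kernel s N i p \<noteq> 0" "k < m"
  have "bounded_sum (\<lambda>ab. c * zabs (alt_phase (expand k p ab)) powr - (9/8 + (2 - s) / 4)) off_nz
      (c * (phase_const s * phase_weight s p))"
    using p nf_kernel_phase by (intro bounded_sum_cmult bounded_sum_fiber_weight s c)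
        (auto simp: tuples_def)
  then show "bounded_sum (\<lambda>ab. h (expand k p ab)) off_nz (c * (phase_const s * phase_weight s p))"
    by (rule bounded_sum_mono) (use h h0 in auto)
next
  show "bounded_sum (\<lambda>p. c * (phase_const s * phase_weight s p) * (cmod (nf_kernel s N i p))\<^sup>2)
      (tuples m) (c * phase_const s * B)"
    using bounded_sum_cmult[OF W, of "c * phase_const s"] c phase_const_ge_1[of s]
        by (simp add: mult_ac)
qed (use h0 in auto)

text \<open>The decay left over after the sum over offsets, |\<Phi>|^(-1/8), is evaluated at the
  threshold.\<close>

lemma far_weight:
  assumes s: "1/2 < s" "s < 1" and c: "threshold i < \<bar>real_of_int c\<bar>"
  shows "\<bar>real_of_int c\<bar> powr ((2 - s) / 4 - 2) \<le> (1 / real (2 * i + 4) ^ 4) * zabs c powr -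
      (9/8 + (2 - s) / 4)"
proof -
  have c1: "1 \<le> \<bar>real_of_int c\<bar>" using c threshold_ge_1[of i] by linarith
  have z: "zabs c = \<bar>real_of_int c\<bar>" using c1 by (simp add: zabs_def)
  \<comment> \<open>The comparison of exponents amounts to \<delta> \<le> 3/8, which is where s >
    1/2 enters.\<close>
  have "\<bar>real_of_int c\<bar> powr ((2 - s) / 4 - 2) \<le> \<bar>real_of_int c\<bar> powr (- (1/8) + - (9/8 + (2 - s) / 4))"
    using s c1 by (intro powr_mono) (auto simp: field_simps)
  also have "\<dots> = \<bar>real_of_int c\<bar> powr - (1/8) * \<bar>real_of_int c\<bar> powr - (9/8 + (2 - s) / 4)"
    by (rule powr_add)
  also have "\<bar>real_of_int c\<bar> powr - (1/8) \<le> threshold i powr - (1/8)"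
    using c threshold_ge_1[of i] by (intro powr_mono2') auto
  also have "threshold i powr - (1/8) = 1 / real (2 * i + 4) ^ 4"
  proof -
    have "(y ^ 32) powr - (1/8) = 1 / y ^ 4" if "0 < y" for y :: real
    proof -
      have "(y ^ 32) powr - (1/8) = (y powr 32) powr - (1/8)"
        using that by simp
      also have "\<dots> = y powr - 4" by (simp only: powr_powr) simp
      also have "\<dots> = 1 / y ^ 4" using that by (simp add: powr_minus_divide)
      finally show ?thesis .
    qed
    then show ?thesis by (simp add: threshold_def)
  qed
  finally show ?thesis unfolding z by (auto simp: mult_right_mono)
qed

text \<open>Two powers of 2i+4 from the substitution against four from the threshold leave at most
  (i+1)^(-2) per step; these factors multiply up to the squared inverse factorial.\<close>

lemma bounded_sum_nf_kernel:
  assumes s: "1/2 < s" "s < 1"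
  shows "bounded_sum (\<lambda>ns. phase_weight s ns * (cmod (nf_kernel s N i ns))\<^sup>2)
    (tuples (2 * i + 4)) (weight_bound s i)"
proof (induction i)
  case 0
  show ?case using bounded_sum_nf_kernel_0[OF s] by (simp add: weight_bound_def)
next
  case (Suc i)
  let ?\<delta> = "(2 - s) / 4" and ?m = "2 * i + 4"
  define h where "h = (\<lambda>ns. if threshold i < \<bar>real_of_int (alt_phase ns)\<bar>
    then \<bar>real_of_int (alt_phase ns)\<bar> powr (?\<delta> - 2) else 0)"
  have h_bound: "bounded_sum (\<lambda>ns. h ns * (cmod (ext_kernel off_nz N (nf_kernel s N i) ns))\<^sup>2)
    (tuples (?m + 2)) (real ?m ^ 2 * ((1 / real (2 * i + 4) ^ 4) * phase_const s * weight_bound s i))"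
    by (rule bounded_sum_ext_nf_kernel[OF s refl Suc.IH]) (use far_weight[OF s] in \<open>auto simp: h_def\<close>)
  have eq: "h ns * (cmod (ext_kernel off_nz N (nf_kernel s N i) ns))\<^sup>2 =
      \<bar>real_of_int (alt_phase ns)\<bar> powr ?\<delta> * (cmod (nf_kernel s N (Suc i) ns))\<^sup>2" for ns
    using threshold_ge_1[of i] by (auto simp: h_def norm_mult norm_divide powr_diff power_divide)
  have le: "real ?m ^ 2 * ((1 / real (2 * i + 4) ^ 4) * phase_const s * weight_bound s i) \<le> weight_bound
      s (Suc i)"
  proof -
    have "real ?m ^ 2 * ((1 / real (2 * i + 4) ^ 4) * phase_const s * weight_bound s i)
        = phase_const s * weight_bound s i / (real ?m)\<^sup>2"
    proof -
      have "y ^ 2 * ((1 / y ^ 4) * c * w) = c * w / y\<^sup>2" if "0 < y" for y c w :: real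
        using that by (simp add: field_simps power2_eq_square power4_eq_xxxx)
      then show ?thesis by simp
    qed
    also have "\<dots> \<le> phase_const s * weight_bound s i / (real (Suc i))\<^sup>2"
      using phase_const_ge_1[of s] base_const_nonneg[of s]
      by (intro divide_left_mono mult_nonneg_nonneg power_mono) (auto simp: weight_bound_def)
    also have "\<dots> = base_const s * (phase_const s * phase_const s ^ i) / ((real (Suc i))\<^sup>2 * (fact i)\<^sup>2)"
      by (simp add: weight_bound_def mult.commute mult.left_commute)
    also have "\<dots> = weight_bound s (Suc i)"
      by (simp add: weight_bound_def power_mult_distrib)
    finally show ?thesis .
  qed
  have "2 * Suc i + 4 = ?m + 2" by simp
  then show ?case
    using bounded_sum_mono[OF h_bound[unfolded eq] _ order_refl le] by (simp del: nf_kernel.simps)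
qed

text \<open>On the support of the kernel the phase is a nonzero integer, so the weight is at least 1
  and may be dropped.\<close>

lemma bounded_sum_nf_kernel_L2:
  assumes s: "1/2 < s" "s < 1"
  shows "bounded_sum (\<lambda>ns. (cmod (nf_kernel s N i ns))\<^sup>2) (tuples (2 * i + 4)) (weight_bound s i)"
proof (rule bounded_sum_mono[OF bounded_sum_nf_kernel[OF s]])
  fix ns
  show "(cmod (nf_kernel s N i ns))\<^sup>2 \<le> phase_weight s ns * (cmod (nf_kernel s N i ns))\<^sup>2"
  proof (cases "nf_kernel s N i ns = 0")
    case False
    then have "1 \<le> \<bar>real_of_int (alt_phase ns)\<bar>"
      using nf_kernel_phase by fastforce
    then have "1 * (cmod (nf_kernel s N i ns))\<^sup>2 \<le> phase_weight s ns * (cmod (nf_kernel s N i ns))\<^sup>2"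
      using s by (intro mult_right_mono ge_one_powr_ge_zero) auto
    then show ?thesis by simp
  qed simp
qed auto

lemma bounded_sum_near_kernel:
  assumes s: "1/2 < s" "s < 1"
  shows "bounded_sum (\<lambda>ns. (cmod (near_kernel s N i ns))\<^sup>2) (tuples (2 * i + 4 + 2))
    (real (2 * i + 4) ^ 2 * ((threshold i)\<^sup>2 * phase_const s * weight_bound s i))"
proof -
  define h where "h = (\<lambda>ns. if \<bar>real_of_int (alt_phase ns)\<bar> \<le> threshold i then 1 else 0 :: real)"
  have "bounded_sum (\<lambda>ns. h ns * (cmod (ext_kernel off_nz N (nf_kernel s N i) ns))\<^sup>2)
    (tuples (2 * i + 4 + 2)) (real (2 * i + 4) ^ 2 * ((threshold i)\<^sup>2 * phase_const s * weight_bound s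
        i))"
  proof (rule bounded_sum_ext_nf_kernel[OF s refl bounded_sum_nf_kernel[OF s]])
    fix ns
    show "h ns \<le> (threshold i)\<^sup>2 * zabs (alt_phase ns) powr - (9/8 + (2 - s) / 4)"
    proof (cases "\<bar>real_of_int (alt_phase ns)\<bar> \<le> threshold i")
      case True
      then have "zabs (alt_phase ns) \<le> threshold i"
        using threshold_ge_1[of i] by (simp add: zabs_def)
      \<comment> \<open>Below the threshold \<theta> the constant 1 is dominated by \<theta>^2
        |\<Phi>|^(-2), and 9/8 + \<delta> is at most 2.\<close>
      then have "threshold i powr - 2 \<le> zabs (alt_phase ns) powr - 2"
        using threshold_ge_1[of i] by (intro powr_mono2') auto
      also have "\<dots> \<le> zabs (alt_phase ns) powr - (9/8 + (2 - s) / 4)"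
        using s by (intro powr_mono) (auto simp: field_simps)
      finally have "(threshold i)\<^sup>2 * threshold i powr - 2 \<le> (threshold i)\<^sup>2 * zabs (alt_phase ns) powr -
          (9/8 + (2 - s) / 4)"
        by (intro mult_left_mono) auto
      moreover have "(threshold i)\<^sup>2 * threshold i powr - 2 = 1"
        using threshold_ge_1[of i] by (simp add: powr_minus)
      ultimately show ?thesis by (simp add: h_def)
    qed (simp add: h_def)
  qed (auto simp: h_def)
  then show ?thesis
    by (rule bounded_sum_mono) (auto simp: h_def near_kernel_def)
qed

text \<open>A parent has a single child per position here, so weight and fiber bound can both be
  1.\<close>

lemma bounded_sum_diag_kernel:
  assumes s: "1/2 < s" "s < 1"
  shows "bounded_sum (\<lambda>ns. (cmod (diag_kernel s N i ns))\<^sup>2) (tuples (2 * i + 4 + 2))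
    (real (2 * i + 4) ^ 2 * weight_bound s i)"
  using bounded_sum_ext_kernel[of "\<lambda>_. 1" "2 * i + 4" "nf_kernel s N i" "{(0, 0)}" "\<lambda>_. 1" "weight_bound
      s i" N]
    bounded_sum_nf_kernel_L2[OF s, of N i]
  by (auto simp: diag_kernel_def bounded_sum_def)

text \<open>The near forms have the largest bound: the factor 2i+4 of the substitution times the
  threshold is the 33rd power, and the sum over offsets adds one more
  \<open>sqrt (phase_const s)\<close>. The other two families fit below the same sequence.\<close>

definition decay_const :: "real \<Rightarrow> nat \<Rightarrow> real" where
  "decay_const s i = real (2 * i + 4) ^ 33 * sqrt (phase_const s) ^ (i + 1) / fact i"

lemma decay_const_pos: "0 < decay_const s i"
  using phase_const_ge_1[of s] by (auto simp: decay_const_def intro!: divide_pos_pos mult_pos_pos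
      zero_less_power)

lemma sqrt_weight_bound: "sqrt (weight_bound s i) = sqrt (base_const s) * sqrt (phase_const s) ^ i /
    fact i"
  by (simp add: weight_bound_def real_sqrt_divide real_sqrt_mult real_sqrt_power)

lemma sqrt_weight_bound_le:
  "real (2 * i + 4) ^ 33 * sqrt (phase_const s) * sqrt (weight_bound s i) \<le> (sqrt (base_const s) + 1) *
      decay_const s i"
proof -
  have "real (2 * i + 4) ^ 33 * sqrt (phase_const s) * sqrt (weight_bound s i) = sqrt (base_const s) *
      decay_const s i"
    by (simp add: sqrt_weight_bound decay_const_def)
  also have "\<dots> \<le> (sqrt (base_const s) + 1) * decay_const s i"
    using decay_const_pos[of s i] by (intro mult_right_mono) auto
  finally show ?thesis .
qed

lemma sqrt_bounds:
  shows "sqrt (weight_bound s i) \<le> (sqrt (base_const s) + 1) * decay_const s i"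
    and "sqrt (real (2 * i + 4) ^ 2 * ((threshold i)\<^sup>2 * phase_const s * weight_bound s i)) \<le>
        (sqrt (base_const s) + 1) * decay_const s i"
    and "sqrt (real (2 * i + 4) ^ 2 * weight_bound s i) \<le> (sqrt (base_const s) + 1) * decay_const s i"
proof -
  have W: "0 \<le> sqrt (weight_bound s i)"
    using phase_const_ge_1[of s] base_const_nonneg[of s] by (auto simp: weight_bound_def)
  have P: "1 \<le> sqrt (phase_const s)" using phase_const_ge_1 by simp
  have 1: "1 \<le> real (2 * i + 4)" by simp
  have p33: "real (2 * i + 4) * 1 \<le> real (2 * i + 4) ^ 33"
    using power_increasing[of 1 33 "real (2 * i + 4)"] by simp
  have "1 * sqrt (weight_bound s i) \<le> (real (2 * i + 4) ^ 33 * sqrt (phase_const s)) * sqrt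
      (weight_bound s i)"
    using P W p33 1 mult_mono[of 1 "real (2 * i + 4) ^ 33" 1 "sqrt (phase_const s)"]
        by (intro mult_right_mono) auto
  then show "sqrt (weight_bound s i) \<le> (sqrt (base_const s) + 1) * decay_const s i"
    using sqrt_weight_bound_le[of i s] by linarith
  have "(real (2 * i + 4) * 1) * sqrt (weight_bound s i) \<le> (real (2 * i + 4) ^ 33 * sqrt (phase_const
      s)) * sqrt (weight_bound s i)"
    using P W p33 1 by (intro mult_right_mono mult_mono) auto
  then show "sqrt (real (2 * i + 4) ^ 2 * weight_bound s i) \<le> (sqrt (base_const s) + 1) * decay_const s
      i"
    using sqrt_weight_bound_le[of i s] by (simp add: real_sqrt_mult)
  have "sqrt (real (2 * i + 4) ^ 2 * ((threshold i)\<^sup>2 * phase_const s * weight_bound s i)) =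
      real (2 * i + 4) * threshold i * sqrt (phase_const s) * sqrt (weight_bound s i)"
    using threshold_ge_1[of i] by (simp add: real_sqrt_mult)
  also have "real (2 * i + 4) * threshold i = real (2 * i + 4) ^ 33"
    by (simp add: threshold_def flip: power_Suc)
  finally show "sqrt (real (2 * i + 4) ^ 2 * ((threshold i)\<^sup>2 * phase_const s * weight_bound s i)) \<le>
      (sqrt (base_const s) + 1) * decay_const s i"
    using sqrt_weight_bound_le[of i s] by simp
qed

section \<open>Superexponential decay of the constants\<close>

lemma power_le_fact_exp:
  fixes y :: real
  assumes "0 \<le> y"
  shows "y ^ n \<le> fact n * exp y"
proof -
  have "(\<Sum>k\<in>{n}. y ^ k /\<^sub>R fact k) \<le> (\<Sum>k. y ^ k /\<^sub>R fact k)"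
    using assms summable_exp_generic[of y] by (intro sum_le_suminf) auto
  then show ?thesis by (simp add: exp_def field_simps)
qed

text \<open>Bounding the polynomial factor by 33! times an exponential leaves a sequence of the form
  c^i / i!.\<close>

lemma decay_const_le:
  "decay_const s i \<le> fact 33 * exp 4 * sqrt (phase_const s) * ((exp 2 * sqrt (phase_const s)) ^ i / fact
      i)"
proof -
  have "real (2 * i + 4) ^ 33 \<le> fact 33 * exp (real (2 * i + 4))"
    by (rule power_le_fact_exp) auto
  also have "exp (real (2 * i + 4)) = exp 4 * exp 2 ^ i"
    by (simp add: exp_add mult.commute flip: exp_of_nat_mult)
  finally have "real (2 * i + 4) ^ 33 * (sqrt (phase_const s) ^ (i + 1) / fact i) \<le>
      fact 33 * (exp 4 * exp 2 ^ i) * (sqrt (phase_const s) ^ (i + 1) / fact i)"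
    using phase_const_ge_1[of s] by (intro mult_right_mono divide_nonneg_nonneg) auto
  then show ?thesis by (simp add: decay_const_def power_mult_distrib mult_ac)
qed

lemma decay_const_summable:
  assumes "0 \<le> x"
  shows "(\<lambda>i. decay_const s i * x ^ i) summable_on UNIV"
proof -
  let ?y = "exp 2 * sqrt (phase_const s) * x"
  have "summable (\<lambda>i. fact 33 * exp 4 * sqrt (phase_const s) * (inverse (fact i) * ?y ^ i))"
    by (intro summable_mult summable_exp)
  then have "(\<lambda>i. fact 33 * exp 4 * sqrt (phase_const s) * (inverse (fact i) * ?y ^ i)) summable_on
      UNIV"
    using assms phase_const_ge_1[of s] by (intro summable_nonneg_imp_summable_on) auto
  then show ?thesis
  proof (rule summable_on_comparison_test)
    fix i
    have "decay_const s i * x ^ i \<le> fact 33 * exp 4 * sqrt (phase_const s) *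
        ((exp 2 * sqrt (phase_const s)) ^ i / fact i) * x ^ i"
      using decay_const_le[of s i] assms by (intro mult_right_mono) auto
    then show "decay_const s i * x ^ i \<le> fact 33 * exp 4 * sqrt (phase_const s) * (inverse (fact i) * ?y
        ^ i)"
      by (simp add: power_mult_distrib field_simps)
    show "0 \<le> decay_const s i * x ^ i"
      using decay_const_pos[of s i] assms by simp
  qed
qed

text \<open>Summability against x^i for x = exp a already forces the terms to tend to 0, and
  \<open>a\<close> is arbitrary. The shift of the index by 2 costs the factor exp (2a).\<close>

lemma superexponential_decay_const: "superexponential_decay (\<lambda>j. decay_const s (j - 2))"
  unfolding superexponential_decay_def
proof (intro allI impI smalloI_tendsto)
  fix a :: real assume "a > 0"
  have "(\<lambda>i. decay_const s i * exp a ^ i) \<longlonglongrightarrow> 0"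
    using summable_LIMSEQ_zero[OF summable_on_imp_summable[OF decay_const_summable[of "exp a" s]]]
        by simp
  then have "(\<lambda>i. exp (2 * a) * (decay_const s i * exp a ^ i)) \<longlonglongrightarrow> exp (2 * a) * 0"
    by (intro tendsto_mult tendsto_const)
  moreover have "decay_const s (i + 2 - 2) / exp (- a * real (i + 2)) = exp (2 * a) * (decay_const s i *
      exp a ^ i)" for i
  proof -
    have "exp (a * real (i + 2)) = exp (2 * a + real i * a)"
      by (simp add: algebra_simps)
    also have "\<dots> = exp (2 * a) * exp a ^ i"
      by (simp only: exp_add exp_of_nat_mult)
    finally have "exp (a * real (i + 2)) = exp (2 * a) * exp a ^ i" .
    moreover have "decay_const s (i + 2 - 2) / exp (- a * real (i + 2)) = decay_const s i * exp
        (a * real (i + 2))"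
      by (simp only: mult_minus_left exp_minus divide_inverse inverse_inverse_eq diff_add_inverse2)
    ultimately show ?thesis by simp
  qed
  ultimately have "(\<lambda>i. decay_const s (i + 2 - 2) / exp (- a * real (i + 2))) \<longlonglongrightarrow> 0"
    by simp
  then show "(\<lambda>j. decay_const s (j - 2) / exp (- a * real j)) \<longlonglongrightarrow> 0"
    by (rule LIMSEQ_offset)
qed auto

section \<open>Trilinear estimates in \<open>H\<^sup>s\<close>\<close>

text \<open>Cauchy-Schwarz with \<open>g\<close> as a measure: the square of a fiber sum is at most
  the mass of \<open>g\<close> times the sum of f^2 g. It plays the role of Young's inequality with
  one factor in l^2 and two in l^1.\<close>

lemma bounded_sum_fiber_square:
  assumes g: "\<And>n. bounded_sum (\<lambda>x. g (n, x)) UNIV C"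
    and fg: "bounded_sum (\<lambda>q. (f q)\<^sup>2 * g q) UNIV E"
    and nonneg: "\<And>q. 0 \<le> f q" "\<And>q. 0 \<le> g q"
  shows "(\<lambda>x. f (n, x) * g (n, x)) summable_on UNIV"
    and "bounded_sum (\<lambda>n. (infsum (\<lambda>x. f (n, x) * g (n, x)) UNIV)\<^sup>2) UNIV (C * E)"
proof -
  have fg': "bounded_sum (\<lambda>q. (f q)\<^sup>2 * g q) (UNIV \<times> UNIV) E"
    using fg by simp
  define h where "h = (\<lambda>n. infsum (\<lambda>x. (f (n, x))\<^sup>2 * g (n, x)) UNIV)"
  have h: "bounded_sum h UNIV E"
    unfolding h_def by (rule bounded_sum_Times_fst(2)[OF fg'])
  have cs: "bounded_sum (\<lambda>x. f (n, x) * g (n, x)) UNIV (sqrt (h n) * sqrt C)" for n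
  proof -
    have "(\<lambda>x. (f (n, x))\<^sup>2 * g (n, x)) summable_on UNIV"
      using bounded_sum_Times_fst(1)[OF fg'] by (auto simp: bounded_sum_def)
    then have 1: "bounded_sum (\<lambda>x. (f (n, x) * sqrt (g (n, x)))\<^sup>2) UNIV (h n)"
      unfolding h_def using nonneg by (simp add: power_mult_distrib bounded_sum_self)
    have 2: "bounded_sum (\<lambda>x. (sqrt (g (n, x)))\<^sup>2) UNIV C"
      using g nonneg by simp
    have "bounded_sum (\<lambda>x. (f (n, x) * sqrt (g (n, x))) * sqrt (g (n, x))) UNIV (sqrt (h n) * sqrt C)"
      by (rule bounded_sum_Cauchy_Schwarz[OF 1 2]) (use nonneg in auto)
    then show ?thesis
      using nonneg by (simp add: mult.assoc)
  qed
  show "(\<lambda>x. f (n, x) * g (n, x)) summable_on UNIV"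
    using cs bounded_sum_summable by blast
  show "bounded_sum (\<lambda>n. (infsum (\<lambda>x. f (n, x) * g (n, x)) UNIV)\<^sup>2) UNIV (C * E)"
  proof (rule bounded_sum_mono[OF bounded_sum_cmult[OF h]])
    fix n
    have C: "0 \<le> C" using bounded_sum_ge_0[OF g] .
    have "0 \<le> infsum (\<lambda>x. f (n, x) * g (n, x)) UNIV"
      using nonneg by (intro infsum_nonneg) auto
    then have "(infsum (\<lambda>x. f (n, x) * g (n, x)) UNIV)\<^sup>2 \<le> (sqrt (h n) * sqrt C)\<^sup>2"
      using bounded_sum_infsum[OF cs] by (intro power_mono) auto
    also have "\<dots> = C * h n"
      using C bounded_sum_nonneg[OF h, of n] by (simp add: power_mult_distrib)
    finally show "(infsum (\<lambda>x. f (n, x) * g (n, x)) UNIV)\<^sup>2 \<le> C * h n" .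
  qed (use bounded_sum_ge_0[OF g] in auto)
qed

lemma bounded_sum_bij_UNIV:
  assumes "bij h" "bounded_sum f UNIV C"
  shows "bounded_sum (\<lambda>x. f (h x)) UNIV C"
  using bounded_sum_reindex[OF assms(1), of f C] assms(2) by simp

lemma bounded_sum_Times_UNIV:
  assumes "bounded_sum f UNIV C" "bounded_sum g UNIV D"
  shows "bounded_sum (\<lambda>x. f (fst x) * g (snd x)) UNIV (C * D)"
  using bounded_sum_mult_Times[OF assms] by (simp add: case_prod_unfold)

lemma bounded_sum_pair_12:
  fixes f g :: "int \<Rightarrow> real"
  assumes "bounded_sum f UNIV C" "bounded_sum g UNIV D"
  shows "bounded_sum (\<lambda>(x, y). f (n + x) * g (n + x - y)) UNIV (C * D)"
    and "bounded_sum (\<lambda>(x, y). f (n + x) * g (n - y)) UNIV (C * D)"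
    and "bounded_sum (\<lambda>(x, y). f (n + x - y) * g (n - y)) UNIV (C * D)"
proof -
  note * = bounded_sum_bij_UNIV[OF _ bounded_sum_Times_UNIV[OF assms]]
  have "bij (\<lambda>(x, y). (n + x, n + x - y))"
    by (rule bij_betw_byWitness[where f' = "\<lambda>(p, q). (p - n, p - q)"]) auto
  from *[OF this] show "bounded_sum (\<lambda>(x, y). f (n + x) * g (n + x - y)) UNIV (C * D)"
    by (simp add: case_prod_unfold)
  have "bij (\<lambda>(x, y). (n + x, n - y))"
    by (rule bij_betw_byWitness[where f' = "\<lambda>(p, q). (p - n, n - q)"]) auto
  from *[OF this] show "bounded_sum (\<lambda>(x, y). f (n + x) * g (n - y)) UNIV (C * D)"
    by (simp add: case_prod_unfold)
  have "bij (\<lambda>(x, y). (n + x - y, n - y))"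
    by (rule bij_betw_byWitness[where f' = "\<lambda>(p, q). (p - q, n - q)"]) auto
  from *[OF this] show "bounded_sum (\<lambda>(x, y). f (n + x - y) * g (n - y)) UNIV (C * D)"
    by (simp add: case_prod_unfold)
qed

lemma bounded_sum_triple:
  fixes f g h :: "int \<Rightarrow> real"
  assumes "bounded_sum f UNIV C" "bounded_sum g UNIV D" "bounded_sum h UNIV E"
  shows "bounded_sum (\<lambda>(n, x, y). f (n + x) * (g (n + x - y) * h (n - y))) UNIV (C * (D * E))"
proof -
  have "bij (\<lambda>(n, x, y). (n + x, n + x - y, n - y :: int))"
    by (rule bij_betw_byWitness[where f' = "\<lambda>(p, q, r). (p - q + r, q - r, p - q)"]) auto
  from bounded_sum_bij_UNIV[OF this bounded_sum_Times_UNIV[OF assms(1) bounded_sum_Times_UNIV[OF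
      assms(2,3)]]]
  show ?thesis by (simp add: case_prod_unfold)
qed

lemma jbracket_triangle: "jbracket n \<le> jbracket (n + x) + jbracket (n + x - y) + jbracket (n - y)"
proof -
  have ge: "\<bar>real_of_int m\<bar> \<le> jbracket m" for m
    using abs_le_zabs zabs_le_jbracket order.trans by blast
  have "jbracket n \<le> jbracket (n + x) + \<bar>real_of_int x\<bar>"
    using jbracket_diff[of n "n + x"] by simp
  moreover have "\<bar>real_of_int x\<bar> \<le> \<bar>real_of_int (n + x - y)\<bar> + \<bar>real_of_int (n - y)\<bar>"
    by simp
  ultimately show ?thesis using ge[of "n + x - y"] ge[of "n - y"] by linarith
qed

lemma jbracket_powr_triangle:
  assumes "0 < s" "s < 1"
  shows "jbracket n powr s \<le> 3 * jbracket (n + x) powr s + 3 * jbracket (n + x - y) powr s + 3 *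
      jbracket (n - y) powr s"
proof -
  let ?m = "max (jbracket (n + x)) (max (jbracket (n + x - y)) (jbracket (n - y)))"
  have m1: "1 \<le> ?m" using jbracket_ge_1 by (simp add: le_max_iff_disj)
  have "jbracket n powr s \<le> (3 * ?m) powr s"
    using jbracket_triangle[of n x y] assms jbracket_pos[of n] by (intro powr_mono2) auto
  also have "\<dots> = 3 powr s * ?m powr s"
    using m1 by (intro powr_mult)
  also have "\<dots> \<le> 3 * ?m powr s"
    using assms powr_mono[of s 1 3] by (intro mult_right_mono) auto
  also have "?m powr s \<le> jbracket (n + x) powr s + jbracket (n + x - y) powr s + jbracket (n - y) powr
      s"
    by (auto simp: max_def)
  finally show ?thesis by simp
qed

lemma jbracket_powr_ge_1: "0 \<le> r \<Longrightarrow> 1 \<le> jbracket n powr r"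
  using jbracket_ge_1 by (intro ge_one_powr_ge_zero) auto

lemma jbracket_powr_double: "jbracket n powr (2 * s) = (jbracket n powr s)\<^sup>2"
  by (simp add: power2_eq_square flip: powr_add)

abbreviation sobolev_sum :: "real \<Rightarrow> (int \<Rightarrow> real) \<Rightarrow> real \<Rightarrow> bool" where
  "sobolev_sum s w C \<equiv> bounded_sum (\<lambda>n. jbracket n powr (2 * s) * (w n)\<^sup>2) UNIV C"

lemma bounded_sum_sobolev_L2:
  assumes "0 \<le> s" "sobolev_sum s w B"
  shows "bounded_sum (\<lambda>n. (w n)\<^sup>2) UNIV B"
  by (rule bounded_sum_mono[OF assms(2)])
     (use mult_right_mono[OF jbracket_powr_ge_1[of "2 * s"], of "(w _)\<^sup>2"] assms(1) in auto)

lemma bounded_sum_sobolev_L1: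
  assumes s: "1/2 < s" and w: "\<And>n. 0 \<le> w n"
    and B: "sobolev_sum s w B"
  shows "bounded_sum w UNIV (sqrt (zeta_sum (2 * s)) * sqrt B)"
proof -
  have "bounded_sum (\<lambda>n. (jbracket n powr - s)\<^sup>2) UNIV (zeta_sum (2 * s))"
  proof (rule bounded_sum_mono[OF bounded_sum_zabs])
    fix n
    have "(jbracket n powr - s)\<^sup>2 = jbracket n powr - (2 * s)"
      by (simp add: power2_eq_square flip: powr_add)
    also have "\<dots> \<le> zabs n powr - (2 * s)"
      using s zabs_le_jbracket[of n] by (intro powr_mono2') auto
    finally show "(jbracket n powr - s)\<^sup>2 \<le> zabs n powr - (2 * s)" .
  qed (use s in auto)
  moreover have "bounded_sum (\<lambda>n. (jbracket n powr s * w n)\<^sup>2) UNIV B"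
    using B by (simp add: power_mult_distrib jbracket_powr_double)
  ultimately have "bounded_sum (\<lambda>n. jbracket n powr - s * (jbracket n powr s * w n)) UNIV
      (sqrt (zeta_sum (2 * s)) * sqrt B)"
    by (rule bounded_sum_Cauchy_Schwarz) (use w in auto)
  moreover have "jbracket n powr - s * (jbracket n powr s * w n) = w n" for n
    using jbracket_pos[of n] by (simp flip: powr_add mult.assoc)
  ultimately show ?thesis by simp
qed

text \<open>The 81 is 9 * 9: one 9 is the square of the 3 in \<open>jbracket_powr_triangle\<close>,
  the other comes from estimating the square of a sum of three terms with equal bounds.\<close>

definition trilinear_const :: "real \<Rightarrow> real \<Rightarrow> real" where
  "trilinear_const s B = 81 * (zeta_sum (2 * s) * B * (zeta_sum (2 * s) * B * B))"

text \<open>The weight at \<open>n\<close> is passed on to one of the three factors. That factor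
  lies in l^2 with the weight, and the other two lie in l^1 since s > 1/2.\<close>

lemma trilinear_sobolev:
  assumes s: "1/2 < s" "s < 1" and w: "\<And>n. 0 \<le> w n"
    and B: "sobolev_sum s w B"
  shows "trilinear_majorant w"
    and "sobolev_sum s (trilinear w) (trilinear_const s B)"
proof -
  define u where "u = (\<lambda>n. 3 * jbracket n powr s * w n)"
  have u0: "0 \<le> u n" for n using w by (simp add: u_def)
  have B0: "0 \<le> B" by (rule bounded_sum_ge_0[OF B])
  let ?L = "sqrt (zeta_sum (2 * s)) * sqrt B"
  have L1: "bounded_sum w UNIV ?L" by (rule bounded_sum_sobolev_L1[OF s(1) w B])
  have u2: "bounded_sum (\<lambda>n. (u n)\<^sup>2) UNIV (9 * B)"
    using bounded_sum_cmult[OF B, of 9] by (simp add: u_def power_mult_distrib jbracket_powr_double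
        mult.assoc)
  define T1 where "T1 = (\<lambda>n. \<Sum>\<^sub>\<infinity>(x, y)\<in>UNIV. u (n + x) * (w (n + x - y) * w (n - y)))"
  define T2 where "T2 = (\<lambda>n. \<Sum>\<^sub>\<infinity>(x, y)\<in>UNIV. u (n + x - y) * (w (n + x) * w (n - y)))"
  define T3 where "T3 = (\<lambda>n. \<Sum>\<^sub>\<infinity>(x, y)\<in>UNIV. u (n - y) * (w (n + x) * w (n + x - y)))"
  let ?E = "9 * B * (?L * ?L)"
  have 1: "bounded_sum (\<lambda>q. (u (fst q + fst (snd q)))\<^sup>2 * (w (fst q + fst (snd q) - snd (snd q)) * w
      (fst q - snd (snd q)))) UNIV ?E"
    using bounded_sum_triple[OF u2 L1 L1] by (simp add: case_prod_unfold)
  have 2: "bounded_sum (\<lambda>q. (u (fst q + fst (snd q) - snd (snd q)))\<^sup>2 * (w (fst q + fst (snd q)) * w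
      (fst q - snd (snd q)))) UNIV ?E"
    using bounded_sum_triple[OF L1 u2 L1] by (simp add: case_prod_unfold mult_ac)
  have 3: "bounded_sum (\<lambda>q. (u (fst q - snd (snd q)))\<^sup>2 * (w (fst q + fst (snd q)) * w (fst q + fst
      (snd q) - snd (snd q)))) UNIV ?E"
    using bounded_sum_triple[OF L1 L1 u2] by (simp add: case_prod_unfold mult_ac)
  have T1: "(\<lambda>(x, y). u (n + x) * (w (n + x - y) * w (n - y))) summable_on UNIV"
    "bounded_sum (\<lambda>n. (T1 n)\<^sup>2) UNIV (?L * ?L * ?E)" for n
    using bounded_sum_fiber_square[OF _ 1, of "?L * ?L"] bounded_sum_pair_12(3)[OF L1 L1] w u0
    by (simp_all add: T1_def case_prod_unfold)
  have T2: "(\<lambda>(x, y). u (n + x - y) * (w (n + x) * w (n - y))) summable_on UNIV"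
    "bounded_sum (\<lambda>n. (T2 n)\<^sup>2) UNIV (?L * ?L * ?E)" for n
    using bounded_sum_fiber_square[OF _ 2, of "?L * ?L"] bounded_sum_pair_12(2)[OF L1 L1] w u0
    by (simp_all add: T2_def case_prod_unfold)
  have T3: "(\<lambda>(x, y). u (n - y) * (w (n + x) * w (n + x - y))) summable_on UNIV"
    "bounded_sum (\<lambda>n. (T3 n)\<^sup>2) UNIV (?L * ?L * ?E)" for n
    using bounded_sum_fiber_square[OF _ 3, of "?L * ?L"] bounded_sum_pair_12(1)[OF L1 L1] w u0
    by (simp_all add: T3_def case_prod_unfold)
  have w_le_u: "w n \<le> u n" for n
    using mult_right_mono[OF jbracket_powr_ge_1[of s n] w[of n]] s w[of n] by (simp add: u_def)
  have summ: "(\<lambda>(x, y). w (n + x) * w (n + x - y) * w (n - y)) summable_on UNIV" for n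
  proof (rule summable_on_comparison_test[OF T1(1)[of n]], clarify)
    fix x y
    show "w (n + x) * w (n + x - y) * w (n - y) \<le> u (n + x) * (w (n + x - y) * w (n - y))"
      using w w_le_u[of "n + x"] by (simp add: mult_right_mono mult.assoc)
  qed (use w in auto)
  interpret trilinear_majorant w
    by unfold_locales (use w summ in auto)
  show "trilinear_majorant w" by unfold_locales
  have tri: "jbracket n powr s * trilinear w n \<le> T1 n + T2 n + T3 n" for n
  proof -
    have "jbracket n powr s * trilinear w n = (\<Sum>\<^sub>\<infinity>q. jbracket n powr s * (case q of (x, y) \<Rightarrow> w (n + x) *
        w (n + x - y) * w (n - y)))"
      by (simp add: trilinear_def infsum_cmult_right')
    also have "\<dots> \<le> (\<Sum>\<^sub>\<infinity>q. ((case q of (x, y) \<Rightarrow> u (n + x) * (w (n + x - y) * w (n - y)))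
        + (case q of (x, y) \<Rightarrow> u (n + x - y) * (w (n + x) * w (n - y))))
        + (case q of (x, y) \<Rightarrow> u (n - y) * (w (n + x) * w (n + x - y))))"
    proof (rule infsum_mono)
      fix q :: "int \<times> int"
      obtain x y where q: "q = (x, y)" by force
      have "jbracket n powr s * (w (n + x) * w (n + x - y) * w (n - y)) \<le>
        (3 * jbracket (n + x) powr s + 3 * jbracket (n + x - y) powr s + 3 * jbracket (n - y) powr s) *
            (w (n + x) * w (n + x - y) * w (n - y))"
        using s w by (intro mult_right_mono jbracket_powr_triangle) auto
      then show "jbracket n powr s * (case q of (x, y) \<Rightarrow> w (n + x) * w (n + x - y) * w (n - y)) \<le>
        (case q of (x, y) \<Rightarrow> u (n + x) * (w (n + x - y) * w (n - y)))
        + (case q of (x, y) \<Rightarrow> u (n + x - y) * (w (n + x) * w (n - y)))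
        + (case q of (x, y) \<Rightarrow> u (n - y) * (w (n + x) * w (n + x - y)))"
        by (simp add: q u_def algebra_simps)
    qed (intro summable_on_add summable_on_cmult_right T1 T2 T3 summ)+
    also have "\<dots> = T1 n + T2 n + T3 n"
      by (simp add: infsum_add T1 T2 T3 summable_on_add T1_def T2_def T3_def)
    finally show ?thesis .
  qed
  have "bounded_sum (\<lambda>n. 3 * ((T1 n)\<^sup>2 + (T2 n)\<^sup>2 + (T3 n)\<^sup>2)) UNIV (3 * (?L * ?L * ?E + ?L * ?L * ?E + ?L
      * ?L * ?E))"
    by (intro bounded_sum_cmult bounded_sum_add T1 T2 T3) auto
  then show "sobolev_sum s (trilinear w) (trilinear_const s B)"
  proof (rule bounded_sum_mono)
    fix n
    have "jbracket n powr (2 * s) * (trilinear w n)\<^sup>2 = (jbracket n powr s * trilinear w n)\<^sup>2"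
      by (simp add: power_mult_distrib jbracket_powr_double)
    also have "\<dots> \<le> (T1 n + T2 n + T3 n)\<^sup>2"
      using tri[of n] trilinear_nonneg[of n] by (intro power_mono) auto
    also have "\<dots> \<le> 3 * ((T1 n)\<^sup>2 + (T2 n)\<^sup>2 + (T3 n)\<^sup>2)"
    proof -
      have "3 * ((T1 n)\<^sup>2 + (T2 n)\<^sup>2 + (T3 n)\<^sup>2) - (T1 n + T2 n + T3 n)\<^sup>2 =
        (T1 n - T2 n)\<^sup>2 + (T2 n - T3 n)\<^sup>2 + (T1 n - T3 n)\<^sup>2"
        by (simp add: power2_eq_square algebra_simps)
      then show ?thesis by (smt (verit) zero_le_power2)
    qed
    finally show "jbracket n powr (2 * s) * (trilinear w n)\<^sup>2 \<le> 3 * ((T1 n)\<^sup>2 + (T2 n)\<^sup>2 + (T3 n)\<^sup>2)" .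
  next
    have "?L * ?L = zeta_sum (2 * s) * B"
      using B0 zeta_sum_nonneg[of "2 * s"] by (simp flip: power2_eq_square add: power_mult_distrib)
    then show "3 * (?L * ?L * ?E + ?L * ?L * ?E + ?L * ?L * ?E) \<le> trilinear_const s B"
      by (simp only: trilinear_const_def) (simp add: mult_ac)
  qed auto
qed

section \<open>Symmetrisation of the energy\<close>

definition quartic :: "(int \<Rightarrow> real) \<Rightarrow> int \<times> int \<times> int \<Rightarrow> real" where
  "quartic w = (\<lambda>(n, x, y). w n * (w (n + x) * w (n + x - y) * w (n - y)))"

definition quartic_term :: "enat \<Rightarrow> real \<Rightarrow> (int \<Rightarrow> complex) \<Rightarrow> int \<times> int \<times> int \<Rightarrow> complex" where
  "quartic_term N t a = (\<lambda>(n, x, y).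
     if freq_le N n \<and> (x, y) \<in> off_freq off_nz N n
     then cis (- (of_int (phase_off n x y) * t)) * (a (n + x) * cnj (a (n + x - y)) * a (n - y)) * cnj
         (a n)
     else 0)"

text \<open>On \<open>(q\<^sub>1, q\<^sub>2, q\<^sub>3, q\<^sub>4) = (n+x, n+x-y, n-y, n)\<close> these exchange \<open>q\<^sub>1, q\<^sub>3\<close>, respectively
  \<open>q\<^sub>1, q\<^sub>2\<close> and \<open>q\<^sub>3, q\<^sub>4\<close>.\<close>

definition swap13 :: "int \<times> int \<times> int \<Rightarrow> int \<times> int \<times> int" where
  "swap13 = (\<lambda>(n, x, y). (n, - y, - x))"

definition swap12_34 :: "int \<times> int \<times> int \<Rightarrow> int \<times> int \<times> int" where
  "swap12_34 = (\<lambda>(n, x, y). (n - y, x, - y))"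

lemma bij_swap13: "bij swap13"
  by (rule bij_betw_byWitness[where f' = swap13]) (auto simp: swap13_def)

lemma bij_swap12_34: "bij swap12_34"
  by (rule bij_betw_byWitness[where f' = swap12_34]) (auto simp: swap12_34_def)

lemma quartic_swap: "quartic w (swap13 q) = quartic w q" "quartic w (swap12_34 q) = quartic w q"
proof -
  obtain n x y where q: "q = (n, x, y)" by (cases q)
  have e: "n - y + x = n + x - y" by simp
  show "quartic w (swap13 q) = quartic w q" "quartic w (swap12_34 q) = quartic w q"
    by (simp_all add: q quartic_def swap13_def swap12_34_def e)
qed

lemma phase_off_swap12_34: "phase_off (n - y) x (- y) = - phase_off n x y"
  unfolding phase_off_def by algebra

lemma quartic_term_swap:
  "quartic_term N t a (swap13 q) = quartic_term N t a q"
  "quartic_term N t a (swap12_34 q) = cnj (quartic_term N t a q)"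
proof -
  obtain n x y where q: "q = (n, x, y)" by (cases q)
  have e: "n - y + x = n + x - y" by simp
  have "(- y, - x) \<in> off_freq off_nz N n \<longleftrightarrow> (x, y) \<in> off_freq off_nz N n"
    by (auto simp: off_freq_def off_nz_def e)
  then show "quartic_term N t a (swap13 q) = quartic_term N t a q"
    by (simp add: q quartic_term_def swap13_def phase_off_sym e)
  have "freq_le N (n - y) \<and> (x, - y) \<in> off_freq off_nz N (n - y) \<longleftrightarrow>
      freq_le N n \<and> (x, y) \<in> off_freq off_nz N n"
    by (auto simp: off_freq_def off_nz_def e)
  then show "quartic_term N t a (swap12_34 q) = cnj (quartic_term N t a q)"
    by (simp add: q quartic_term_def swap12_34_def phase_off_swap12_34 e cis_cnj)
qed

lemma norm_quartic_term: "(\<And>n. cmod (a n) \<le> w n) \<Longrightarrow> cmod (quartic_term N t a q) \<le> quartic w q"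
proof -
  assume a: "\<And>n. cmod (a n) \<le> w n"
  then have w: "0 \<le> w n" for n using norm_ge_zero order.trans by blast
  obtain n x y where q: "q = (n, x, y)" by (cases q)
  have "cmod (a (n + x)) * cmod (a (n + x - y)) * cmod (a (n - y)) * cmod (a n) \<le>
      w (n + x) * w (n + x - y) * w (n - y) * w n"
    using a w by (intro mult_mono mult_nonneg_nonneg) auto
  then show ?thesis
    using w by (auto simp: q quartic_term_def quartic_def norm_mult mult_ac)
qed

lemma bounded_sum_sobolev_pairing:
  assumes s: "1/2 < s" "s < 1" and w: "\<And>n. 0 \<le> w n"
    and B: "sobolev_sum s w B"
  shows "bounded_sum (\<lambda>n. jbracket n powr (2 * s) * (w n * trilinear w n)) UNIV
    (sqrt B * sqrt (trilinear_const s B))"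
proof -
  interpret trilinear_majorant w by (rule trilinear_sobolev(1)[OF s w B])
  have "bounded_sum (\<lambda>n. (jbracket n powr s * w n) * (jbracket n powr s * trilinear w n)) UNIV
      (sqrt B * sqrt (trilinear_const s B))"
    using B trilinear_sobolev(2)[OF s w B] w trilinear_nonneg
    by (intro bounded_sum_Cauchy_Schwarz) (auto simp: power_mult_distrib jbracket_powr_double)
  moreover have "(jbracket n powr s * w n) * (jbracket n powr s * trilinear w n) =
      jbracket n powr (2 * s) * (w n * trilinear w n)" for n
    by (simp add: jbracket_powr_double power2_eq_square)
  ultimately show ?thesis by simp
qed

lemma bounded_sum_jbracket_quartic:
  assumes s: "1/2 < s" "s < 1" and w: "\<And>n. 0 \<le> w n"
    and B: "sobolev_sum s w B"
  shows "bounded_sum (\<lambda>q. jbracket (fst q) powr (2 * s) * quartic w q) UNIV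
    (sqrt B * sqrt (trilinear_const s B))"
proof -
  interpret trilinear_majorant w by (rule trilinear_sobolev(1)[OF s w B])
  have "bounded_sum (\<lambda>y. jbracket (fst (n, y)) powr (2 * s) * quartic w (n, y)) UNIV
      (jbracket n powr (2 * s) * (w n * trilinear w n))" for n
    using bounded_sum_cmult[OF bounded_sum_trilinear[of n], of "jbracket n powr (2 * s) * w n"] w[of n]
    by (simp add: quartic_def case_prod_unfold mult.assoc)
  then have "bounded_sum (\<lambda>q. jbracket (fst q) powr (2 * s) * quartic w q) (UNIV \<times> UNIV)
    (sqrt B * sqrt (trilinear_const s B))"
    by (rule bounded_sum_Sigma[OF _ bounded_sum_sobolev_pairing[OF s w B]])
  then show ?thesis by simp
qed

text \<open>The two exchanges act on the quartic terms by the identity and by conjugation, and they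
  carry the weight at \<open>n\<close> to the other three entries. So the alternating sum of the
  four weights gives twice the weighted sum minus its conjugate, that is, only the imaginary part.
  The first claim gives the energy kernel an absolute convergence that the square sums of
  \<open>nf_kernel\<close> do not provide for it.\<close>

lemma energy_symmetrization:
  assumes s: "1/2 < s" "s < 1" and w: "\<And>n. 0 \<le> w n"
    and B: "sobolev_sum s w B"
    and a: "\<And>n. cmod (a n) \<le> w n"
  shows "bounded_sum (\<lambda>ns. cmod (energy_kernel s N ns) * tprod (\<lambda>_. w) 0 ns) (tuples 4)
      (4 * (sqrt B * sqrt (trilinear_const s B)))" (is ?bound)
    and "(\<lambda>q. of_real (jbracket (fst q) powr (2 * s)) * quartic_term N t a q) summable_on UNIV"
        (is ?summ)
    and "Re (form_sum 4 (energy_kernel s N) t (\<lambda>_. a)) =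
      Re (- \<i> * (\<Sum>\<^sub>\<infinity>q. of_real (jbracket (fst q) powr (2 * s)) * quartic_term N t a q))" (is ?eq)
proof -
  let ?C = "sqrt B * sqrt (trilinear_const s B)"
  define f where "f = (\<lambda>n. jbracket n powr (2 * s))"
  define q1 q2 q3 :: "int \<times> int \<times> int \<Rightarrow> int" where
    "q1 = (\<lambda>(n, x, y). n + x)" and "q2 = (\<lambda>(n, x, y). n + x - y)" and "q3 = (\<lambda>(n, x, y). n - y)"
  note q_defs = q1_def q2_def q3_def
  have rel: "fst (swap12_34 q) = q3 q" "q3 (swap12_34 q) = fst q" "q3 (swap13 q) = q1 q" "q1
      (swap13 q) = q3 q"
    "q1 (swap12_34 q) = q2 q" "q2 (swap12_34 q) = q1 q" for q
    by (cases q; simp add: q_defs swap13_def swap12_34_def)+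
  have b4: "bounded_sum (\<lambda>q. f (fst q) * quartic w q) UNIV ?C"
    unfolding f_def by (rule bounded_sum_jbracket_quartic[OF s w B])
  have b3: "bounded_sum (\<lambda>q. f (q3 q) * quartic w q) UNIV ?C"
    using bounded_sum_bij_UNIV[OF bij_swap12_34 b4] by (simp add: rel quartic_swap)
  have b1: "bounded_sum (\<lambda>q. f (q1 q) * quartic w q) UNIV ?C"
    using bounded_sum_bij_UNIV[OF bij_swap13 b3] by (simp add: rel quartic_swap)
  have b2: "bounded_sum (\<lambda>q. f (q2 q) * quartic w q) UNIV ?C"
    using bounded_sum_bij_UNIV[OF bij_swap12_34 b1] by (simp add: rel quartic_swap)
  let ?J = "quartic_term N t a"
  have summ: "(\<lambda>q. of_real (f (e q)) * ?J q) summable_on UNIV"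
    if "bounded_sum (\<lambda>q. f (e q) * quartic w q) UNIV ?C" for e
    by (rule bounded_sum_norm_mono(1)[OF that])
       (auto simp: norm_mult f_def intro!: mult_left_mono norm_quartic_term a)
  show ?summ using summ[OF b4] by (simp add: f_def)
  define S where "S = (\<lambda>e. \<Sum>\<^sub>\<infinity>q. of_real (f (e q)) * ?J q)"
  have S3: "S q3 = cnj (S fst)"
    unfolding S_def infsum_cnj[symmetric]
    by (subst infsum_reindex_bij_betw[OF bij_swap12_34, symmetric]) (simp add: rel quartic_term_swap)
  have S1: "S q1 = S q3"
    unfolding S_def
    by (subst infsum_reindex_bij_betw[OF bij_swap13, symmetric]) (simp add: rel quartic_term_swap)
  have S2: "S q2 = cnj (S q1)"
    unfolding S_def infsum_cnj[symmetric]
    by (subst infsum_reindex_bij_betw[OF bij_swap12_34, symmetric]) (simp add: rel quartic_term_swap)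
  define psi where "psi = (\<lambda>(n, x, y). energy_symbol s n x y)"
  have psi: "psi q = f (fst q) + f (q2 q) - f (q1 q) - f (q3 q)" for q
    by (cases q) (simp add: psi_def energy_symbol_def f_def q_defs)
  have "(\<Sum>\<^sub>\<infinity>q. of_real (psi q) * ?J q) = (\<Sum>\<^sub>\<infinity>q. (of_real (f (fst q)) * ?J q + of_real (f (q2 q)) * ?J q)
      + (- (of_real (f (q1 q)) * ?J q) + - (of_real (f (q3 q)) * ?J q)))"
    by (intro infsum_cong) (simp add: psi algebra_simps)
  also have "\<dots> = S fst + S q2 + (- S q1 + - S q3)"
  proof (rule infsumI)
    have S: "((\<lambda>q. of_real (f (e q)) * ?J q) has_sum S e) UNIV"
      if "bounded_sum (\<lambda>q. f (e q) * quartic w q) UNIV ?C" for e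
      unfolding S_def by (rule has_sum_infsum[OF summ[OF that]])
    show "((\<lambda>q. (of_real (f (fst q)) * ?J q + of_real (f (q2 q)) * ?J q)
      + (- (of_real (f (q1 q)) * ?J q) + - (of_real (f (q3 q)) * ?J q))) has_sum (S fst + S q2 +
          (- S q1 + - S q3))) UNIV"
      by (intro has_sum_add has_sum_uminusI S b1 b2 b3 b4)
  qed
  also have "\<dots> = 2 * (S fst - cnj (S fst))"
    by (simp add: S2 S1 S3)
  finally have psiJ: "(\<Sum>\<^sub>\<infinity>q. of_real (psi q) * ?J q) = 2 * (S fst - cnj (S fst))" .

  define h where "h = (\<lambda>(n, x, y). [n + x, n + x - y, n - y, n :: int])"
  define R where "R = {ns :: int list. length ns = 4 \<and> ns ! 0 - ns ! 1 + ns ! 2 = ns ! 3}"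
  have bij: "bij_betw h UNIV R"
    by (rule bij_betwI[where g = "\<lambda>ns. (ns ! 3, ns ! 0 - ns ! 3, ns ! 3 - ns ! 2)"])
       (auto simp: h_def R_def length_4_conv)
  have R: "R \<subseteq> tuples 4" by (auto simp: R_def tuples_def)
  have outside: "energy_kernel s N ns = 0" if "ns \<notin> R" for ns
    using that by (auto simp: energy_kernel_def R_def)
  have EK: "energy_kernel s N (h q) = (if freq_le N (fst q) \<and> snd q \<in> off_freq off_nz N (fst q)
      then - \<i> / 4 * of_real (psi q) else 0)" for q
    by (cases q) (auto simp: energy_kernel_def h_def psi_def off_freq_def off_nz_def)
  have "Re (form_sum 4 (energy_kernel s N) t (\<lambda>_. a)) =
      Re (\<Sum>\<^sub>\<infinity>ns\<in>R. energy_kernel s N ns * cis (- (of_int (alt_phase ns) * t)) * tensor (\<lambda>_. a) 0 ns)"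
    unfolding form_sum_def using R outside by (intro arg_cong[where f = Re] infsum_cong_neutral) auto
  also have "\<dots> = Re (\<Sum>\<^sub>\<infinity>q. energy_kernel s N (h q) * cis (- (of_int (alt_phase (h q)) * t)) * tensor
      (\<lambda>_. a) 0 (h q))"
    by (rule arg_cong[OF infsum_reindex_bij_betw[OF bij, symmetric]])
  also have "(\<lambda>q. energy_kernel s N (h q) * cis (- (of_int (alt_phase (h q)) * t)) * tensor (\<lambda>_. a) 0
      (h q)) =
      (\<lambda>q. - \<i> / 4 * (of_real (psi q) * ?J q))"
  proof
    fix q :: "int \<times> int \<times> int"
    obtain n x y where q: "q = (n, x, y)" by (cases q)
    have "alt_phase (h q) = phase_off n x y"
      using alt_phase_4[of "n + x" "n + x - y" "n - y" n] by (simp add: q h_def del: alt_phase.simps)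
    moreover have "tensor (\<lambda>_. a) 0 (h q) = a (n + x) * cnj (a (n + x - y)) * a (n - y) * cnj (a n)"
      by (simp add: q h_def conj_odd_def)
    ultimately show "energy_kernel s N (h q) * cis (- (of_int (alt_phase (h q)) * t)) * tensor (\<lambda>_. a) 0
        (h q) =
      - \<i> / 4 * (of_real (psi q) * ?J q)"
      by (simp add: EK q quartic_term_def)
  qed
  also have "Re (\<Sum>\<^sub>\<infinity>q. - \<i> / 4 * (of_real (psi q) * ?J q)) = Re (- \<i> / 4 * (2 * (S fst - cnj (S fst))))"
    by (simp only: infsum_cmult_right' psiJ)
  also have "\<dots> = Re (- \<i> * S fst)"
    by simp
  finally show ?eq by (simp add: S_def f_def)

  have "bounded_sum (\<lambda>q. cmod (energy_kernel s N (h q)) * tprod (\<lambda>_. w) 0 (h q)) UNIV (4 * ?C)"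
  proof (rule bounded_sum_mono[OF bounded_sum_add[OF bounded_sum_add[OF b4 b2] bounded_sum_add[OF b1
      b3]]])
    fix q
    have r: "tprod (\<lambda>_. w) 0 (h q) = quartic w q"
      by (cases q) (simp add: h_def quartic_def)
    have r0: "0 \<le> quartic w q" using w by (cases q) (simp add: quartic_def)
    have f0: "0 \<le> f n" for n by (simp add: f_def)
    have "cmod (energy_kernel s N (h q)) \<le> \<bar>psi q\<bar>"
      by (simp add: EK norm_mult norm_divide)
    also have "\<dots> \<le> f (fst q) + f (q2 q) + (f (q1 q) + f (q3 q))"
      using f0[of "fst q"] f0[of "q1 q"] f0[of "q2 q"] f0[of "q3 q"] unfolding psi by linarith
    finally have "cmod (energy_kernel s N (h q)) * quartic w q \<le> (f (fst q) + f (q2 q) + (f (q1 q) + f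
        (q3 q))) * quartic w q"
      using r0 by (intro mult_right_mono)
    then show "cmod (energy_kernel s N (h q)) * tprod (\<lambda>_. w) 0 (h q) \<le>
      f (fst q) * quartic w q + f (q2 q) * quartic w q + (f (q1 q) * quartic w q + f (q3 q) * quartic w
          q)"
      by (simp add: r distrib_right)
  qed (auto intro!: mult_nonneg_nonneg tprod_nonneg w)
  then have "bounded_sum (\<lambda>ns. cmod (energy_kernel s N ns) * tprod (\<lambda>_. w) 0 ns) R (4 * ?C)"
    by (rule bounded_sum_reindex[OF bij, THEN iffD1])
  then show ?bound
    by (rule bounded_sum_extend) (use R outside in auto)
qed

text \<open>The nonzero offsets and (0, 0) are disjoint index sets, so even the difference of the
  two parts stays below one full sum.\<close>

lemma (in trilinear_majorant) part_field_bound: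
  assumes a: "\<And>n. cmod (a n) \<le> w n"
  shows "cmod (part_field D N t a n) \<le> trilinear w n"
    and "cmod (part_field off_nz N t a n - part_field {(0, 0)} N t a n) \<le> trilinear w n"
proof -
  define f where "f = (\<lambda>(x, y). w (n + x) * w (n + x - y) * w (n - y))"
  have f: "bounded_sum f UNIV (trilinear w n)"
    unfolding f_def by (rule bounded_sum_trilinear)
  have le: "cmod (part_field D N t a n) \<le> infsum f (off_freq D N n)" for D
  proof -
    have "bounded_sum f (off_freq D N n) (infsum f (off_freq D N n))"
      using bounded_sum_subset[OF f, of "off_freq D N n"] by (auto simp: bounded_sum_def)
    then have "cmod (\<Sum>\<^sub>\<infinity>(x, y)\<in>off_freq D N n. cis (- (of_int (phase_off n x y) * t)) * (a (n + x) * cnj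
        (a (n + x - y)) * a (n - y)))
      \<le> infsum f (off_freq D N n)"
      by (rule bounded_sum_norm_mono) (auto simp: f_def norm_mult w_nonneg intro!: mult_mono a)
    then show ?thesis by (simp add: part_field_def norm_mult)
  qed
  have sub: "infsum f A \<le> trilinear w n" for A
    by (rule bounded_sum_infsum[OF bounded_sum_subset[OF f]]) auto
  show "cmod (part_field D N t a n) \<le> trilinear w n"
    using le sub by (rule order.trans)
  have "cmod (part_field off_nz N t a n - part_field {(0, 0)} N t a n) \<le>
      infsum f (off_freq off_nz N n) + infsum f (off_freq {(0, 0)} N n)"
    using norm_triangle_ineq4 le[of off_nz] le[of "{(0, 0)}"] by (rule order.trans[OF _ add_mono])
  also have "\<dots> = infsum f (off_freq off_nz N n \<union> off_freq {(0, 0)} N n)"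
    using bounded_sum_subset[OF f, THEN bounded_sum_summable]
    by (intro infsum_Un_disjoint[symmetric]) (auto simp: off_freq_def off_nz_def)
  also have "\<dots> \<le> trilinear w n"
    by (rule sub)
  finally show "cmod (part_field off_nz N t a n - part_field {(0, 0)} N t a n) \<le> trilinear w n" .
qed

section \<open>Differentiation along a solution with a majorant\<close>

lemma cis_has_vector_derivative:
  "((\<lambda>\<tau>. cis (- (c * \<tau>))) has_vector_derivative - \<i> * of_real c * cis (- (c * t))) (at t)"
proof -
  have "((\<lambda>z. exp (- (\<i> * of_real c) * z)) has_field_derivative
      - (\<i> * of_real c) * exp (- (\<i> * of_real c) * of_real t)) (at (of_real t))"
    by (auto intro!: derivative_eq_intros)
  from has_vector_derivative_real_field[OF this] show ?thesis
    by (simp add: cis_conv_exp mult.assoc)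
qed

lemma infsum_nat_Suc:
  fixes f :: "nat \<Rightarrow> complex"
  assumes "f summable_on UNIV"
  shows "(\<lambda>i. f (Suc i)) summable_on UNIV" and "infsum f UNIV = f 0 + infsum (\<lambda>i. f (Suc i)) UNIV"
proof -
  have s: "f summable_on range Suc"
    using assms summable_on_subset_banach by blast
  then show "(\<lambda>i. f (Suc i)) summable_on UNIV"
    by (subst (asm) summable_on_reindex) (auto simp: o_def)
  have "infsum f UNIV = infsum f ({0} \<union> range Suc)"
    by (metis UNIV_nat_eq insert_is_Un)
  also have "\<dots> = infsum f {0} + infsum f (range Suc)"
    using s by (intro infsum_Un_disjoint) auto
  also have "infsum f (range Suc) = infsum (\<lambda>i. f (Suc i)) UNIV"
    by (subst infsum_reindex) (auto simp: o_def)
  finally show "infsum f UNIV = f 0 + infsum (\<lambda>i. f (Suc i)) UNIV" by simp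
qed

text \<open>Derivatives are local, so a solution is studied on an open time window where a single
  H^s majorant bounds its coefficients. Only coefficient sequences enter here, not functions on the
  torus.\<close>

locale nf_solution =
  fixes s :: real and N :: enat and a :: "real \<Rightarrow> int \<Rightarrow> complex" and w :: "int \<Rightarrow> real"
    and B l u :: real
  assumes s: "1/2 < s" "s < 1"
    and majorant_nonneg: "\<And>n. 0 \<le> w n"
    and majorant_sobolev: "sobolev_sum s w B"
    and a_le: "\<And>t n. t \<in> {l<..<u} \<Longrightarrow> cmod (a t n) \<le> w n"
    and a_deriv: "\<And>t n. t \<in> {l<..<u} \<Longrightarrow> freq_le N n \<Longrightarrow> ((\<lambda>\<tau>. a \<tau> n) has_vector_derivative
      part_field off_nz N t (a t) n - part_field {(0, 0)} N t (a t) n) (at t)"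
    and a_zero: "\<And>t n. \<not> freq_le N n \<Longrightarrow> a t n = 0"
begin

sublocale trilinear_majorant w
  by (rule trilinear_sobolev(1)[OF s majorant_nonneg majorant_sobolev])

definition da :: "real \<Rightarrow> int \<Rightarrow> complex" where
  "da t n = (if freq_le N n then part_field off_nz N t (a t) n - part_field {(0, 0)} N t (a t) n else
      0)"

lemma a_has_deriv: "t \<in> {l<..<u} \<Longrightarrow> ((\<lambda>\<tau>. a \<tau> n) has_vector_derivative da t n) (at t)"
  using a_deriv[of t n] a_zero[of n] by (auto simp: da_def)

lemma da_le: "t \<in> {l<..<u} \<Longrightarrow> cmod (da t n) \<le> trilinear w n"
  using part_field_bound(2)[of "a t" N t n] a_le[of t] trilinear_nonneg by (auto simp: da_def)

text \<open>A common constant for \<open>w\<close> and \<open>trilinear w\<close> makes the bound of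
  a tensor independent of the slot that was differentiated.\<close>

definition L2_const :: real where
  "L2_const = max 1 (max B (trilinear_const s B))"

lemma L2_const_ge_1: "1 \<le> L2_const"
  by (simp add: L2_const_def)

lemma w_L2: "bounded_sum (\<lambda>n. (w n)\<^sup>2) UNIV L2_const"
  using s by (intro bounded_sum_mono[OF bounded_sum_sobolev_L2[OF _ majorant_sobolev]])
    (auto simp: L2_const_def)

lemma trilinear_L2: "bounded_sum (\<lambda>n. (trilinear w n)\<^sup>2) UNIV L2_const"
  using s by (intro bounded_sum_mono[OF bounded_sum_sobolev_L2[OF _ trilinear_sobolev(2)[OF s
      majorant_nonneg majorant_sobolev]]])
    (auto simp: L2_const_def)

definition form_bound :: "nat \<Rightarrow> real" where
  "form_bound i = (sqrt (base_const s) + 1) * decay_const s i * L2_const ^ (i + 2)"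

lemma sqrt_L2_const: "sqrt (\<Prod>j<2 * i + 4. L2_const) = L2_const ^ (i + 2)"
proof -
  have "(\<Prod>j<2 * i + 4. L2_const) = (L2_const ^ (i + 2))\<^sup>2"
  proof -
    have "2 * i + 4 = (i + 2) * 2" by simp
    then show ?thesis by (simp only: prod_constant card_lessThan power_mult)
  qed
  moreover have "0 \<le> L2_const ^ (i + 2)"
    using L2_const_ge_1 by (intro zero_le_power) simp
  ultimately show ?thesis
    by (simp only: real_sqrt_abs abs_of_nonneg)
qed

section \<open>Absolute convergence of the forms against the majorant\<close>

lemma nf_tprod_bound:
  assumes us: "\<And>j. us j = w \<or> us j = trilinear w"
  shows "bounded_sum (\<lambda>p. cmod (nf_kernel s N i p) * tprod us 0 p) (tuples (2 * i + 4))
    (sqrt (weight_bound s i) * L2_const ^ (i + 2))"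
proof -
  have "bounded_sum (\<lambda>n. (us j n)\<^sup>2) UNIV L2_const" for j
    using us[of j] w_L2 trilinear_L2 by auto
  moreover have "0 \<le> us j n" for j n
    using us[of j] majorant_nonneg trilinear_nonneg by auto
  ultimately show ?thesis
    using bounded_sum_kernel_tensor[OF bounded_sum_nf_kernel_L2[OF s, of N i], of us "\<lambda>_. L2_const"]
    by (simp only: sqrt_L2_const)
qed

lemma sqrt_weight_form_bound:
  shows "sqrt (weight_bound s i) * L2_const ^ (i + 2) \<le> form_bound i"
    and "real (2 * i + 4) * (sqrt (weight_bound s i) * L2_const ^ (i + 2)) \<le> form_bound i"
proof -
  have "0 \<le> L2_const ^ (i + 2)" using L2_const_ge_1 by simp
  from mult_right_mono[OF sqrt_bounds(1)[of s i] this] mult_right_mono[OF sqrt_bounds(3)[of i s] this]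
  show "sqrt (weight_bound s i) * L2_const ^ (i + 2) \<le> form_bound i"
    and "real (2 * i + 4) * (sqrt (weight_bound s i) * L2_const ^ (i + 2)) \<le> form_bound i"
    by (simp_all add: form_bound_def real_sqrt_mult mult.assoc)
qed

lemma form_bound_nonneg: "0 \<le> form_bound i"
  using L2_const_ge_1 decay_const_pos[of s i] base_const_nonneg[of s] by (auto simp: form_bound_def)

lemma form_bound_summable: "form_bound summable_on UNIV"
proof -
  have "(\<lambda>i. (sqrt (base_const s) + 1) * L2_const ^ 2 * (decay_const s i * L2_const ^ i)) summable_on
      UNIV"
    using L2_const_ge_1 by (intro summable_on_cmult_right decay_const_summable) auto
  moreover have "(\<lambda>i. (sqrt (base_const s) + 1) * L2_const ^ 2 * (decay_const s i * L2_const ^ i)) =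
      form_bound"
    by (rule ext) (simp only: form_bound_def power_add mult_ac)
  ultimately show ?thesis by simp
qed

lemma upd_cases: "(upd k) j = w \<or> (upd k) j = trilinear w"
  by auto

lemma nf_tprod_w:
  "bounded_sum (\<lambda>p. cmod (nf_kernel s N i p) * tprod (\<lambda>_. w) 0 p) (tuples (2 * i + 4)) (form_bound i)"
  by (rule bounded_sum_mono[OF nf_tprod_bound _ _ sqrt_weight_form_bound(1)])
     (auto intro!: mult_nonneg_nonneg tprod_nonneg majorant_nonneg)

lemma nf_tprod_upd:
  "bounded_sum (\<lambda>p. \<Sum>k<2 * i + 4. cmod (nf_kernel s N i p) * tprod (upd k) 0 p)
    (tuples (2 * i + 4)) (form_bound i)"
proof -
  have "bounded_sum (\<lambda>p. \<Sum>k<2 * i + 4. cmod (nf_kernel s N i p) * tprod (upd k) 0 p)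
      (tuples (2 * i + 4)) (\<Sum>k<2 * i + 4. sqrt (weight_bound s i) * L2_const ^ (i + 2))"
    by (intro bounded_sum_sum nf_tprod_bound upd_cases) auto
  then show ?thesis
    by (rule bounded_sum_mono)
       (use sqrt_weight_form_bound(2)[of i] in \<open>auto intro!: sum_nonneg mult_nonneg_nonneg tprod_nonneg
         majorant_nonneg trilinear_nonneg\<close>)
qed

lemma ext_tprod_w:
  "bounded_sum (\<lambda>ns. cmod (ext_kernel D N (nf_kernel s N i) ns) * tprod (\<lambda>_. w) 0 ns)
    (tuples (2 * i + 4 + 2)) (form_bound i)"
proof -
  have "bounded_sum (\<lambda>ns. cmod (ext_kernel D N (nf_kernel s N i) ns) * tprod (\<lambda>_. w) 0 ns)
    (tuples (2 * i + 4 + 2)) (\<Sum>k<2 * i + 4. sqrt (weight_bound s i) * L2_const ^ (i + 2))"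
    by (intro bounded_sum_ext_kernel_tprod nf_tprod_bound upd_cases)
  then show ?thesis
    by (rule bounded_sum_mono)
       (use sqrt_weight_form_bound(2)[of i] in \<open>auto intro!: mult_nonneg_nonneg tprod_nonneg
           majorant_nonneg\<close>)
qed

definition phase_bound :: "nat \<Rightarrow> real" where
  "phase_bound i = (case i of 0 \<Rightarrow> 4 * (sqrt B * sqrt (trilinear_const s B)) | Suc j \<Rightarrow> form_bound j)"

definition phase_kernel :: "nat \<Rightarrow> int list \<Rightarrow> complex" where
  "phase_kernel i p = - \<i> * of_int (alt_phase p) * nf_kernel s N i p"

lemma phase_kernel_0: "phase_kernel 0 p = energy_kernel s N p"
proof (cases "energy_kernel s N p = 0")
  case False
  then obtain q1 q2 q3 q4 where p: "p = [q1, q2, q3, q4]" "q1 - q2 + q3 = q4" "q1 \<noteq> q4" "q3 \<noteq> q4"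
    by (auto simp: energy_kernel_def length_4_conv split: if_splits)
  then have "alt_phase p \<noteq> 0"
    by (simp add: alt_phase_4 phase_off_eq_0_iff del: alt_phase.simps)
  then show ?thesis by (simp add: phase_kernel_def)
qed (simp add: phase_kernel_def)

text \<open>The split at the threshold loses nothing; since the threshold is at least 1, the
  division on the far part is never by 0.\<close>

lemma phase_kernel_Suc:
  "phase_kernel (Suc i) p = - ext_kernel off_nz N (nf_kernel s N i) p - near_kernel s N i p"
  using threshold_ge_1[of i] by (auto simp: phase_kernel_def near_kernel_def)

text \<open>Multiplying by the phase undoes the last division. At index 0 this brings back the
  energy kernel, which the H^s estimate covers; later the kernel is dominated by the extension of
  the previous one.\<close>

lemma phase_tprod_w:
  "bounded_sum (\<lambda>p. cmod (phase_kernel i p) * tprod (\<lambda>_. w) 0 p) (tuples (2 * i + 4)) (phase_bound i)"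
proof (cases i)
  case 0
  have "bounded_sum (\<lambda>p. cmod (energy_kernel s N p) * tprod (\<lambda>_. w) 0 p) (tuples 4) (phase_bound 0)"
    unfolding phase_bound_def
    using energy_symmetrization(1)[OF s majorant_nonneg majorant_sobolev, of "\<lambda>_. 0"] majorant_nonneg
        by simp
  then show ?thesis by (simp add: 0 phase_kernel_0)
next
  case (Suc j)
  have "cmod (phase_kernel i p) \<le> cmod (ext_kernel off_nz N (nf_kernel s N j) p)" for p
    by (simp add: Suc phase_kernel_Suc near_kernel_def)
  then have "bounded_sum (\<lambda>p. cmod (phase_kernel i p) * tprod (\<lambda>_. w) 0 p) (tuples (2 * j + 4 + 2))
      (form_bound j)"
    by (intro bounded_sum_mono[OF ext_tprod_w[of off_nz j]])
       (auto intro!: mult_nonneg_nonneg mult_right_mono tprod_nonneg majorant_nonneg)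
  then show ?thesis by (simp add: Suc phase_bound_def)
qed

lemma phase_bound_summable: "phase_bound summable_on UNIV"
proof -
  have "phase_bound summable_on insert 0 (range Suc)"
    using form_bound_summable
    by (subst summable_on_insert_iff) (auto simp: summable_on_reindex o_def phase_bound_def)
  then show ?thesis by (simp flip: UNIV_nat_eq)
qed

section \<open>The forms along the solution and their time derivatives\<close>

lemma form_sum_bound:
  assumes "t \<in> {l<..<u}"
    and "bounded_sum (\<lambda>p. cmod (G p) * tprod (\<lambda>_. w) 0 p) (tuples m) C"
  shows "(\<lambda>p. G p * cis (- (of_int (alt_phase p) * t)) * tensor (\<lambda>_. a t) 0 p) summable_on tuples m"
    and "cmod (form_sum m G t (\<lambda>_. a t)) \<le> C"
proof -
  have *: "cmod (G p * cis (- (of_int (alt_phase p) * t)) * tensor (\<lambda>_. a t) 0 p) \<le> cmod (G p) * tprod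
      (\<lambda>_. w) 0 p" for p
    using norm_tensor_le[of "\<lambda>_. a t" "\<lambda>_. w" 0 p] a_le[OF assms(1)]
    by (auto simp: norm_mult intro!: mult_left_mono)
  show "(\<lambda>p. G p * cis (- (of_int (alt_phase p) * t)) * tensor (\<lambda>_. a t) 0 p) summable_on tuples m"
    and "cmod (form_sum m G t (\<lambda>_. a t)) \<le> C"
    unfolding form_sum_def using bounded_sum_norm_mono[OF assms(2) *] by auto
qed

definition nf_form :: "nat \<Rightarrow> real \<Rightarrow> complex" where
  "nf_form i t = form_sum (2 * i + 4) (nf_kernel s N i) t (\<lambda>_. a t)"

definition phase_form :: "nat \<Rightarrow> real \<Rightarrow> complex" where
  "phase_form i t = form_sum (2 * i + 4) (phase_kernel i) t (\<lambda>_. a t)"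

definition ext_form :: "nat \<Rightarrow> real \<Rightarrow> complex" where
  "ext_form i t = form_sum (2 * i + 4 + 2) (ext_kernel off_nz N (nf_kernel s N i)) t (\<lambda>_. a t)"

definition near_form :: "nat \<Rightarrow> real \<Rightarrow> complex" where
  "near_form i t = form_sum (2 * i + 4 + 2) (near_kernel s N i) t (\<lambda>_. a t)"

definition diag_form :: "nat \<Rightarrow> real \<Rightarrow> complex" where
  "diag_form i t = form_sum (2 * i + 4 + 2) (diag_kernel s N i) t (\<lambda>_. a t)"

text \<open>By the product rule the time factor yields the phase form, and the entries yield the
  equation in one slot after the other: the extension by nonzero offsets minus the diagonal one.
  Both contributions have summable majorants, so the sum over frequencies is differentiated
  termwise.\<close>

lemma nf_form_has_derivative:
  assumes t: "t \<in> {l<..<u}"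
  shows "(nf_form i has_vector_derivative phase_form i t + ext_form i t - diag_form i t) (at t)"
proof -
  let ?m = "2 * i + 4"
  let ?M = "nf_kernel s N i"
  let ?L = "tuples ?m"
  define E where "E = (\<lambda>p \<tau>. cis (- (of_int (alt_phase p) * \<tau>)))"
  define f1 where "f1 = (\<lambda>p \<tau>. phase_kernel i p * E p \<tau> * tensor (\<lambda>_. a \<tau>) 0 p)"
  define f2 where "f2 = (\<lambda>p \<tau>. ?M p * E p \<tau> * (\<Sum>k<?m. tensor ((\<lambda>_. a \<tau>)(k := da \<tau>)) 0 p))"
  define f3 where "f3 = (\<lambda>D p. ?M p * E p t * (\<Sum>k<?m. tensor ((\<lambda>_. a t)(k := part_field D N t (a t))) 0
      p))"
  have upd_le: "cmod (?M p * E p \<tau> * (\<Sum>k<?m. tensor ((\<lambda>_. a \<tau>)(k := g)) 0 p)) \<le>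
      (\<Sum>k<?m. cmod (?M p) * tprod (upd k) 0 p)"
    if "\<tau> \<in> {l<..<u}" "\<And>n. cmod (g n) \<le> trilinear w n" for p \<tau> g
  proof -
    have "cmod (\<Sum>k<?m. tensor ((\<lambda>_. a \<tau>)(k := g)) 0 p) \<le> (\<Sum>k<?m. tprod (upd k) 0 p)"
      using that a_le by (intro sum_norm_le norm_tensor_le) auto
    then have "cmod (?M p) * cmod (\<Sum>k<?m. tensor ((\<lambda>_. a \<tau>)(k := g)) 0 p) \<le>
        cmod (?M p) * (\<Sum>k<?m. tprod (upd k) 0 p)"
      by (rule mult_left_mono) auto
    then show ?thesis by (simp add: norm_mult E_def flip: sum_distrib_left)
  qed
  have deriv: "((\<lambda>\<tau>. infsum (\<lambda>p. ?M p * E p \<tau> * tensor (\<lambda>_. a \<tau>) 0 p) ?L) has_vector_derivative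
      infsum (\<lambda>p. f1 p t + f2 p t) ?L) (at t)"
  proof (rule has_vector_derivative_infsum[OF _ _ _ _ t])
    fix p :: "int list" and \<tau> assume p: "p \<in> ?L" and \<tau>: "\<tau> \<in> {l<..<u}"
    have "((\<lambda>\<tau>. ?M p * E p \<tau>) has_vector_derivative ?M p * (- \<i> * of_real (of_int (alt_phase p)) * E p
        \<tau>)) (at \<tau>)"
      unfolding E_def by (intro has_vector_derivative_mult_right cis_has_vector_derivative)
    then have "((\<lambda>\<tau>. ?M p * E p \<tau> * tensor (\<lambda>_. a \<tau>) 0 p) has_vector_derivative
        (?M p * E p \<tau>) * (\<Sum>k<length p. tensor ((\<lambda>_. a \<tau>)(0 + k := da \<tau>)) 0 p)
        + ?M p * (- \<i> * of_real (of_int (alt_phase p)) * E p \<tau>) * tensor (\<lambda>_. a \<tau>) 0 p) (at \<tau>)"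
      by (intro has_vector_derivative_mult tensor_const_has_vector_derivative a_has_deriv \<tau>)
    then show "((\<lambda>\<tau>. ?M p * E p \<tau> * tensor (\<lambda>_. a \<tau>) 0 p) has_vector_derivative f1 p \<tau> + f2 p \<tau>) (at \<tau>)"
      using p by (simp add: f1_def f2_def phase_kernel_def tuples_def add.commute mult_ac)
  next
    fix p :: "int list" and \<tau> assume p: "p \<in> ?L" and \<tau>: "\<tau> \<in> {l<..<u}"
    have "cmod (f1 p \<tau>) \<le> cmod (phase_kernel i p) * tprod (\<lambda>_. w) 0 p"
      using norm_tensor_le[of "\<lambda>_. a \<tau>" "\<lambda>_. w" 0 p] a_le[OF \<tau>]
      by (auto simp: f1_def E_def norm_mult intro!: mult_left_mono)
    then show "cmod (f1 p \<tau> + f2 p \<tau>) \<le> cmod (phase_kernel i p) * tprod (\<lambda>_. w) 0 p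
        + (\<Sum>k<?m. cmod (?M p) * tprod (upd k) 0 p)"
      unfolding f2_def using upd_le[OF \<tau> da_le[OF \<tau>]] by (intro norm_triangle_mono)
  next
    show "(\<lambda>p. cmod (phase_kernel i p) * tprod (\<lambda>_. w) 0 p
        + (\<Sum>k<?m. cmod (?M p) * tprod (upd k) 0 p)) summable_on ?L"
      by (intro summable_on_add bounded_sum_summable[OF phase_tprod_w] bounded_sum_summable[OF
          nf_tprod_upd])
  next
    fix \<tau> assume "\<tau> \<in> {l<..<u}"
    then show "(\<lambda>p. ?M p * E p \<tau> * tensor (\<lambda>_. a \<tau>) 0 p) summable_on ?L"
      unfolding E_def by (rule form_sum_bound(1)[OF _ nf_tprod_w])
  qed
  have f1: "(\<lambda>p. f1 p t) summable_on ?L" "infsum (\<lambda>p. f1 p t) ?L = phase_form i t"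
    unfolding f1_def E_def by (auto simp: phase_form_def form_sum_def intro:
        form_sum_bound(1)[OF t phase_tprod_w])
  have f3: "f3 D summable_on ?L" for D
    unfolding f3_def
    by (rule bounded_sum_norm_mono(1)[OF nf_tprod_upd]) (intro upd_le t part_field_bound a_le)
  have f3_sum: "infsum (f3 D) ?L = form_sum (?m + 2) (ext_kernel D N ?M) t (\<lambda>_. a t)" for D
    unfolding f3_def E_def
    by (rule form_sum_ext_kernel[symmetric, OF a_le[OF t] nf_tprod_bound[OF upd_cases] nf_kernel_freq])
  have "infsum (\<lambda>p. f2 p t) ?L = infsum (\<lambda>p. f3 off_nz p - f3 {(0, 0)} p) ?L"
  proof (rule infsum_cong)
    fix p assume p: "p \<in> ?L"
    show "f2 p t = f3 off_nz p - f3 {(0, 0)} p"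
    \<comment> \<open>Beyond \<open>N\<close> the derivative \<open>da\<close> is 0 while
      \<open>part_field\<close> need not be; the support of the kernel excludes such
      frequencies.\<close>
    proof (cases "?M p = 0")
      case False
      have "tensor ((\<lambda>_. a t)(k := da t)) 0 p = tensor ((\<lambda>_. a t)(k := part_field off_nz N t (a t))) 0 p
          - tensor ((\<lambda>_. a t)(k := part_field {(0, 0)} N t (a t))) 0 p" if k: "k < ?m" for k
      proof -
        have kp: "k < length p" using p k by (simp add: tuples_def)
        then have "freq_le N (p ! k)" using nf_kernel_freq[OF False] by simp
        then show ?thesis
          by (simp add: tensor_upd[OF kp] da_def conj_odd_diff left_diff_distrib right_diff_distrib)
      qed
      then show ?thesis
        by (simp add: f2_def f3_def right_diff_distrib sum_subtractf)
    qed (simp add: f2_def f3_def)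
  qed
  also have "\<dots> = infsum (f3 off_nz) ?L - infsum (f3 {(0, 0)}) ?L"
    using infsum_add[OF f3[of off_nz] summable_on_uminus[THEN iffD2, OF f3[of "{(0, 0)}"]]]
    by (simp add: infsum_uminus)
  finally have f2: "infsum (\<lambda>p. f2 p t) ?L = infsum (f3 off_nz) ?L - infsum (f3 {(0, 0)}) ?L" .
  have "(\<lambda>p. f2 p t) summable_on ?L"
    unfolding f2_def
    by (rule bounded_sum_norm_mono(1)[OF nf_tprod_upd]) (intro upd_le t da_le)
  then have "infsum (\<lambda>p. f1 p t + f2 p t) ?L = phase_form i t + ext_form i t - diag_form i t"
    using infsum_add[OF f1(1)] by (simp add: f1(2) f2 f3_sum ext_form_def diag_form_def diag_kernel_def)
  moreover have "nf_form i = (\<lambda>\<tau>. infsum (\<lambda>p. ?M p * E p \<tau> * tensor (\<lambda>_. a \<tau>) 0 p) ?L)"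
    by (simp add: fun_eq_iff nf_form_def form_sum_def E_def)
  ultimately show ?thesis
    using deriv by (simp only:)
qed

lemma near_tprod_w:
  "bounded_sum (\<lambda>p. cmod (near_kernel s N i p) * tprod (\<lambda>_. w) 0 p) (tuples (2 * i + 4 + 2))
    (form_bound i)"
  by (rule bounded_sum_mono[OF ext_tprod_w[of off_nz i]])
     (auto simp: near_kernel_def intro!: mult_nonneg_nonneg tprod_nonneg majorant_nonneg)

lemma ext_form_eq:
  assumes t: "t \<in> {l<..<u}"
  shows "ext_form i t = - phase_form (Suc i) t - near_form i t"
proof -
  have len: "2 * Suc i + 4 = 2 * i + 4 + 2" by simp
  let ?L = "tuples (2 * i + 4 + 2)"
  let ?g = "\<lambda>G p. G p * cis (- (of_int (alt_phase p) * t)) * tensor (\<lambda>_. a t) 0 p"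
  have "(?g (phase_kernel (Suc i)) has_sum phase_form (Suc i) t) ?L"
    using form_sum_bound(1)[OF t phase_tprod_w[of "Suc i"]]
    unfolding phase_form_def form_sum_def len by (rule has_sum_infsum)
  moreover have "(?g (near_kernel s N i) has_sum near_form i t) ?L"
    using form_sum_bound(1)[OF t near_tprod_w]
    unfolding near_form_def form_sum_def by (rule has_sum_infsum)
  ultimately have "((\<lambda>p. - ?g (phase_kernel (Suc i)) p + - ?g (near_kernel s N i) p) has_sum
      - phase_form (Suc i) t + - near_form i t) ?L"
    by (intro has_sum_add has_sum_uminusI)
  moreover have "- ?g (phase_kernel (Suc i)) p + - ?g (near_kernel s N i) p =
      ?g (ext_kernel off_nz N (nf_kernel s N i)) p" for p
    by (simp add: phase_kernel_Suc algebra_simps)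
  ultimately show ?thesis
    by (simp add: ext_form_def form_sum_def infsumI)
qed

text \<open>Each extended form cancels the next phase form up to the near part, so the series of
  derivatives telescopes to the phase form of index 0, the energy form. No remainder is left at
  infinity because the phase forms are themselves summable.\<close>

lemma nf_series_has_derivative:
  assumes t: "t \<in> {l<..<u}"
  shows "((\<lambda>\<tau>. \<Sum>\<^sub>\<infinity>i. nf_form i \<tau>) has_vector_derivative
     form_sum 4 (energy_kernel s N) t (\<lambda>_. a t) - (\<Sum>\<^sub>\<infinity>i. near_form i t) - (\<Sum>\<^sub>\<infinity>i. diag_form i t)) (at t)"
    and "(\<lambda>i. nf_form i t) summable_on UNIV"
    and "(\<lambda>i. near_form i t) summable_on UNIV"
    and "(\<lambda>i. diag_form i t) summable_on UNIV"
proof -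
  have P: "cmod (phase_form i \<tau>) \<le> phase_bound i" if "\<tau> \<in> {l<..<u}" for i \<tau>
    unfolding phase_form_def by (rule form_sum_bound(2)[OF that phase_tprod_w])
  have X: "cmod (ext_form i \<tau>) \<le> form_bound i" if "\<tau> \<in> {l<..<u}" for i \<tau>
    unfolding ext_form_def by (rule form_sum_bound(2)[OF that ext_tprod_w])
  have D: "cmod (diag_form i \<tau>) \<le> form_bound i" if "\<tau> \<in> {l<..<u}" for i \<tau>
    unfolding diag_form_def diag_kernel_def by (rule form_sum_bound(2)[OF that ext_tprod_w])
  have Y: "cmod (near_form i \<tau>) \<le> form_bound i" if "\<tau> \<in> {l<..<u}" for i \<tau>
    unfolding near_form_def by (rule form_sum_bound(2)[OF that near_tprod_w])
  have F: "cmod (nf_form i \<tau>) \<le> form_bound i" if "\<tau> \<in> {l<..<u}" for i \<tau>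
    unfolding nf_form_def by (rule form_sum_bound(2)[OF that nf_tprod_w])
  have fb: "bounded_sum form_bound UNIV (infsum form_bound UNIV)"
    by (intro bounded_sum_self form_bound_summable form_bound_nonneg)
  have pb: "bounded_sum phase_bound UNIV (infsum phase_bound UNIV)"
    using P[OF t] norm_ge_zero order.trans by (intro bounded_sum_self phase_bound_summable) blast
  have Fs: "(\<lambda>i. nf_form i \<tau>) summable_on UNIV" if "\<tau> \<in> {l<..<u}" for \<tau>
    by (rule bounded_sum_norm_mono(1)[OF fb F[OF that]])
  then show "(\<lambda>i. nf_form i t) summable_on UNIV" using t .
  show Ys: "(\<lambda>i. near_form i t) summable_on UNIV"
    by (rule bounded_sum_norm_mono(1)[OF fb Y[OF t]])
  show Ds: "(\<lambda>i. diag_form i t) summable_on UNIV"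
    by (rule bounded_sum_norm_mono(1)[OF fb D[OF t]])
  have Ps: "(\<lambda>i. phase_form i t) summable_on UNIV"
    by (rule bounded_sum_norm_mono(1)[OF pb P[OF t]])
  have "((\<lambda>\<tau>. \<Sum>\<^sub>\<infinity>i. nf_form i \<tau>) has_vector_derivative
      (\<Sum>\<^sub>\<infinity>i. phase_form i t + ext_form i t - diag_form i t)) (at t)"
  proof (rule has_vector_derivative_infsum[OF nf_form_has_derivative _ _ Fs t])
    fix i \<tau> assume \<tau>: "\<tau> \<in> {l<..<u}"
    show "cmod (phase_form i \<tau> + ext_form i \<tau> - diag_form i \<tau>) \<le> phase_bound i + form_bound i +
        form_bound i"
      using P[OF \<tau>] X[OF \<tau>] D[OF \<tau>] by (intro norm_triangle_mono order.trans[OF norm_triangle_ineq4]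
          add_mono)
  next
    show "(\<lambda>i. phase_bound i + form_bound i + form_bound i) summable_on UNIV"
      by (intro summable_on_add phase_bound_summable form_bound_summable)
  qed
  moreover have "(\<Sum>\<^sub>\<infinity>i. phase_form i t + ext_form i t - diag_form i t) =
      form_sum 4 (energy_kernel s N) t (\<lambda>_. a t) - (\<Sum>\<^sub>\<infinity>i. near_form i t) - (\<Sum>\<^sub>\<infinity>i. diag_form i t)"
  proof -
    have "(\<Sum>\<^sub>\<infinity>i. phase_form i t + ext_form i t - diag_form i t) =
        (\<Sum>\<^sub>\<infinity>i. (phase_form i t + - phase_form (Suc i) t) + (- near_form i t + - diag_form i t))"
      by (intro infsum_cong) (simp add: ext_form_eq[OF t])
    also have "\<dots> = (infsum (\<lambda>i. phase_form i t) UNIV + - infsum (\<lambda>i. phase_form (Suc i) t) UNIV)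
        + (- (\<Sum>\<^sub>\<infinity>i. near_form i t) + - (\<Sum>\<^sub>\<infinity>i. diag_form i t))"
      by (rule infsumI, intro has_sum_add has_sum_uminusI has_sum_infsum Ps Ys Ds infsum_nat_Suc(1)[OF
          Ps])
    also have "\<dots> = phase_form 0 t - (\<Sum>\<^sub>\<infinity>i. near_form i t) - (\<Sum>\<^sub>\<infinity>i. diag_form i t)"
      using infsum_nat_Suc(2)[OF Ps] by simp
    finally show ?thesis
      by (simp add: phase_form_def phase_kernel_0[abs_def])
  qed
  ultimately show "((\<lambda>\<tau>. \<Sum>\<^sub>\<infinity>i. nf_form i \<tau>) has_vector_derivative
     form_sum 4 (energy_kernel s N) t (\<lambda>_. a t) - (\<Sum>\<^sub>\<infinity>i. near_form i t) - (\<Sum>\<^sub>\<infinity>i. diag_form i t)) (at t)"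
    by (simp only:)
qed

text \<open>Pairing the equation with the coefficients gives the quartic sum with its weight at
  \<open>n\<close>, which \<open>energy_symmetrization\<close> identifies with the energy form. The
  H^s pairing of \<open>w\<close> with \<open>trilinear w\<close> is the majorant for termwise
  differentiation.\<close>

lemma energy_has_derivative:
  assumes t: "t \<in> {l<..<u}"
  shows "((\<lambda>\<tau>. 1/2 * (\<Sum>\<^sub>\<infinity>n. jbracket n powr (2 * s) * (cmod (a \<tau> n))\<^sup>2)) has_vector_derivative
    Re (form_sum 4 (energy_kernel s N) t (\<lambda>_. a t))) (at t)"
proof -
  define J where "J = quartic_term N t (a t)"
  define g where "g = (\<lambda>n. - \<i> * (\<Sum>\<^sub>\<infinity>xy. of_real (jbracket n powr (2 * s)) * J (n, xy)))"
  note sym = energy_symmetrization(2,3)[OF s majorant_nonneg majorant_sobolev a_le[OF t], of N t]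
  note wt = bounded_sum_sobolev_pairing[OF s majorant_nonneg majorant_sobolev]
  have "((\<lambda>\<tau>. \<Sum>\<^sub>\<infinity>n. jbracket n powr (2 * s) * (cmod (a \<tau> n))\<^sup>2) has_vector_derivative
      (\<Sum>\<^sub>\<infinity>n. jbracket n powr (2 * s) * (2 * Re (cnj (a t n) * da t n)))) (at t)"
  proof (rule has_vector_derivative_infsum[OF _ _ _ _ t])
    fix n \<tau> assume \<tau>: "\<tau> \<in> {l<..<u}"
    have "((\<lambda>\<tau>. a \<tau> n * cnj (a \<tau> n)) has_vector_derivative (a \<tau> n * cnj (da \<tau> n) + da \<tau> n * cnj
        (a \<tau> n))) (at \<tau>)"
      by (intro has_vector_derivative_mult has_vector_derivative_cnj a_has_deriv \<tau>)
    from bounded_linear.has_vector_derivative[OF bounded_linear_Re this]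
    have "((\<lambda>\<tau>. (cmod (a \<tau> n))\<^sup>2) has_vector_derivative 2 * Re (cnj (a \<tau> n) * da \<tau> n)) (at \<tau>)"
      by (simp add: complex_mult_cnj cmod_power2 mult_ac)
    then show "((\<lambda>\<tau>. jbracket n powr (2 * s) * (cmod (a \<tau> n))\<^sup>2) has_vector_derivative
        jbracket n powr (2 * s) * (2 * Re (cnj (a \<tau> n) * da \<tau> n))) (at \<tau>)"
      by (rule has_vector_derivative_mult_right)
    have "\<bar>Re (cnj (a \<tau> n) * da \<tau> n)\<bar> \<le> cmod (a \<tau> n) * cmod (da \<tau> n)"
      using abs_Re_le_cmod[of "cnj (a \<tau> n) * da \<tau> n"] by (simp add: norm_mult)
    also have "\<dots> \<le> w n * trilinear w n"
      using a_le[OF \<tau>] da_le[OF \<tau>] majorant_nonneg by (intro mult_mono) auto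
    finally have le: "\<bar>Re (cnj (a \<tau> n) * da \<tau> n)\<bar> \<le> w n * trilinear w n" .
    have mono: "norm (j * (2 * x)) \<le> 2 * (j * y)" if "\<bar>x\<bar> \<le> y" "0 \<le> j" for j x y :: real
      using that by (simp add: abs_mult mult_left_mono)
    show "norm (jbracket n powr (2 * s) * (2 * Re (cnj (a \<tau> n) * da \<tau> n))) \<le> 2 * (jbracket n powr
        (2 * s) * (w n * trilinear w n))"
      by (rule mono[OF le]) simp
  next
    show "(\<lambda>n. 2 * (jbracket n powr (2 * s) * (w n * trilinear w n))) summable_on UNIV"
      by (intro summable_on_cmult_right bounded_sum_summable[OF wt])
  next
    fix \<tau> assume \<tau>: "\<tau> \<in> {l<..<u}"
    have "(cmod (a \<tau> n))\<^sup>2 \<le> (w n)\<^sup>2" for n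
      using a_le[OF \<tau>] by (intro power_mono) auto
    then show "(\<lambda>n. jbracket n powr (2 * s) * (cmod (a \<tau> n))\<^sup>2) summable_on UNIV"
      by (intro bounded_sum_summable[OF bounded_sum_mono[OF majorant_sobolev]]) (auto intro!:
          mult_left_mono)
  qed
  then have "((\<lambda>\<tau>. 1/2 * (\<Sum>\<^sub>\<infinity>n. jbracket n powr (2 * s) * (cmod (a \<tau> n))\<^sup>2)) has_vector_derivative
      1/2 * (\<Sum>\<^sub>\<infinity>n. jbracket n powr (2 * s) * (2 * Re (cnj (a t n) * da t n)))) (at t)"
    by (rule has_vector_derivative_mult_right)
  also have "1/2 * (\<Sum>\<^sub>\<infinity>n. jbracket n powr (2 * s) * (2 * Re (cnj (a t n) * da t n))) =
      (\<Sum>\<^sub>\<infinity>n. 1/2 * (jbracket n powr (2 * s) * (2 * Re (cnj (a t n) * da t n))))"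
    by (rule infsum_cmult_right'[symmetric])
  also have "\<dots> = (\<Sum>\<^sub>\<infinity>n. Re (g n))"
  proof (rule infsum_cong)
    fix n
    show "1/2 * (jbracket n powr (2 * s) * (2 * Re (cnj (a t n) * da t n))) = Re (g n)"
    proof (cases "freq_le N n")
      case True
      have diag: "off_freq {(0, 0)} N n = {(0, 0)}"
        using True by (auto simp: off_freq_def)
      \<comment> \<open>The diagonal term contributes -i |a_n|^4, which is purely imaginary.\<close>
      have "cnj (a t n) * part_field {(0, 0)} N t (a t) n = - \<i> * of_real ((cmod (a t n))\<^sup>2 *
          (cmod (a t n))\<^sup>2)"
      proof -
        have "cnj (a t n) * part_field {(0, 0)} N t (a t) n = - \<i> * ((a t n * cnj (a t n)) *
            (a t n * cnj (a t n)))"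
          by (simp add: part_field_def diag phase_off_def)
        then show ?thesis
          by (simp only: complex_norm_square[symmetric] of_real_mult)
      qed
      then have diag_Re: "Re (cnj (a t n) * part_field {(0, 0)} N t (a t) n) = 0"
        by (simp only:) simp
      have "(\<Sum>\<^sub>\<infinity>xy. of_real (jbracket n powr (2 * s)) * J (n, xy)) =
          (\<Sum>\<^sub>\<infinity>(x, y)\<in>off_freq off_nz N n. of_real (jbracket n powr (2 * s)) *
            (cis (- (of_int (phase_off n x y) * t)) * (a t (n + x) * cnj (a t (n + x - y)) * a t
                (n - y)) * cnj (a t n)))"
        by (rule infsum_cong_neutral) (auto simp: J_def quartic_term_def True)
      also have "\<dots> = (\<Sum>\<^sub>\<infinity>xy\<in>off_freq off_nz N n. of_real (jbracket n powr (2 * s)) * cnj (a t n) *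
            (case xy of (x, y) \<Rightarrow> cis (- (of_int (phase_off n x y) * t)) * (a t (n + x) * cnj
                (a t (n + x - y)) * a t (n - y))))"
        by (rule infsum_cong) (auto simp: mult_ac)
      finally have "g n = of_real (jbracket n powr (2 * s)) * (cnj (a t n) * part_field off_nz N t (a t)
          n)"
        by (simp add: g_def part_field_def infsum_cmult_right' mult_ac)
      then show ?thesis
        using diag_Re by (simp add: da_def True right_diff_distrib)
    next
      case False
      then show ?thesis by (simp add: da_def g_def J_def quartic_term_def)
    qed
  qed
  also have "\<dots> = Re (infsum g UNIV)"
  proof (rule infsum_Re)
    have "(\<lambda>(n, xy). of_real (jbracket n powr (2 * s)) * J (n, xy)) summable_on UNIV \<times> UNIV"
      using sym(1) by (simp add: J_def case_prod_unfold)
    then have "(\<lambda>n. \<Sum>\<^sub>\<infinity>xy. of_real (jbracket n powr (2 * s)) * J (n, xy)) summable_on UNIV"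
      by (rule summable_on_Sigma_banach)
    then show "g summable_on UNIV"
      unfolding g_def by (rule summable_on_cmult_right)
  qed
  also have "infsum g UNIV = - \<i> * (\<Sum>\<^sub>\<infinity>n. \<Sum>\<^sub>\<infinity>xy. of_real (jbracket n powr (2 * s)) * J (n, xy))"
    unfolding g_def by (rule infsum_cmult_right')
  also have "(\<Sum>\<^sub>\<infinity>n. \<Sum>\<^sub>\<infinity>xy. of_real (jbracket n powr (2 * s)) * J (n, xy)) =
      (\<Sum>\<^sub>\<infinity>q. of_real (jbracket (fst q) powr (2 * s)) * J q)"
    using infsum_Sigma_banach[of "\<lambda>q. of_real (jbracket (fst q) powr (2 * s)) * J q" UNIV "\<lambda>_. UNIV"]
        sym(1)
    by (simp add: J_def)
  finally show ?thesis
    using sym(2) by (simp add: J_def)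
qed

end

section \<open>A majorant for solutions\<close>

lemma fourier_integrable:
  assumes "v \<in> borel_measurable borel" "set_integrable lborel {0..2*pi} (\<lambda>x. (cmod (v x))\<^sup>2)"
  shows "set_integrable lborel {0..2*pi} (\<lambda>x. v x * cis (- (of_int n * x)))"
proof -
  have int: "set_integrable lborel {0..2*pi} (\<lambda>x. 1 + (cmod (v x))\<^sup>2)"
    by (intro set_integral_add(1) assms(2) borel_integrable_atLeastAtMost' continuous_on_const)
  have meas: "set_borel_measurable lborel {0..2*pi} (\<lambda>x. v x * cis (- (of_int n * x)))"
    unfolding set_borel_measurable_def cis_conv_exp using assms(1) by measurable
  have le: "cmod (v x * cis (- (of_int n * x))) \<le> norm (1 + (cmod (v x))\<^sup>2)" for x
  proof -
    have "cmod (v x) \<le> 1 + (cmod (v x))\<^sup>2"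
    proof -
      have "(cmod (v x) - 1)\<^sup>2 = (cmod (v x))\<^sup>2 - 2 * cmod (v x) + 1"
        by (simp add: power2_eq_square algebra_simps)
      then show ?thesis
        using zero_le_power2[of "cmod (v x) - 1"] zero_le_power2[of "cmod (v x)"] by linarith
    qed
    then show ?thesis by (simp add: norm_mult)
  qed
  have "AE x in lborel. x \<in> {0..2*pi} \<longrightarrow> cmod (v x * cis (- (of_int n * x))) \<le> norm (1 + (cmod (v x))\<^sup>2)"
    by (intro AE_I2 impI le)
  then show ?thesis
    by (rule set_integrable_bound[OF int meas])
qed

lemma sobolev_fourier_integrable:
  "f \<in> sobolev r \<Longrightarrow> set_integrable lborel {0..2*pi} (\<lambda>x. f x * cis (- (of_int n * x)))"
  by (auto simp: sobolev_def intro: fourier_integrable)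

lemma fourier_coeff_add:
  assumes "f \<in> sobolev r" "g \<in> sobolev r"
  shows "fourier_coeff (\<lambda>x. f x + g x) n = fourier_coeff f n + fourier_coeff g n"
  using set_integral_add(2)[OF assms[THEN sobolev_fourier_integrable], of n n]
  by (simp add: fourier_coeff_def distrib_right add_divide_distrib)

lemma fourier_coeff_diff:
  assumes "f \<in> sobolev r" "g \<in> sobolev r"
  shows "fourier_coeff (\<lambda>x. f x - g x) n = fourier_coeff f n - fourier_coeff g n"
  using set_integral_diff(2)[OF assms[THEN sobolev_fourier_integrable], of n n]
  by (simp add: fourier_coeff_def left_diff_distrib diff_divide_distrib)

lemma fourier_coeff_cmult: "fourier_coeff (\<lambda>x. c * f x) n = c * fourier_coeff f n"
  using set_integral_mult_right[of lborel "{0..2*pi}" c "\<lambda>x. f x * cis (- (of_int n * x))"]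
  by (simp add: fourier_coeff_def mult.assoc)

lemma sobolev_norm_power2:
  "(sobolev_norm r f)\<^sup>2 = (\<Sum>\<^sub>\<infinity>n. jbracket n powr (2 * r) * (cmod (fourier_coeff f n))\<^sup>2)"
  by (simp add: sobolev_norm_def infsum_nonneg)

lemma sobolev_bounded_sum:
  "f \<in> sobolev r \<Longrightarrow> bounded_sum (\<lambda>n. jbracket n powr (2 * r) * (cmod (fourier_coeff f n))\<^sup>2) UNIV
      ((sobolev_norm r f)\<^sup>2)"
  unfolding sobolev_norm_power2 by (intro bounded_sum_self) (auto simp: sobolev_def)

lemma vector_field_eq:
  assumes "freq_le N n"
  shows "vector_field N t a n = part_field off_nz N t a n - part_field {(0, 0)} N t a n"
proof -
  have bij: "bij_betw (\<lambda>(x, y). (n + x, n + x - y, n - y)) (off_freq off_nz N n) (Gamma_trunc N n)"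
    by (rule bij_betwI[where g = "\<lambda>(n\<^sub>1, n\<^sub>2, n\<^sub>3). (n\<^sub>1 - n, n - n\<^sub>3)"])
       (auto simp: off_freq_def off_nz_def Gamma_trunc_def Gamma_set_def)
  have "(\<Sum>\<^sub>\<infinity>(n\<^sub>1, n\<^sub>2, n\<^sub>3)\<in>Gamma_trunc N n.
      exp (- \<i> * of_int (phase n\<^sub>1 n\<^sub>2 n\<^sub>3 n) * of_real t) * a n\<^sub>1 * cnj (a n\<^sub>2) * a n\<^sub>3) =
    (\<Sum>\<^sub>\<infinity>(x, y)\<in>off_freq off_nz N n.
      cis (- (of_int (phase_off n x y) * t)) * (a (n + x) * cnj (a (n + x - y)) * a (n - y)))"
    by (subst infsum_reindex_bij_betw[OF bij, symmetric])
       (auto intro!: infsum_cong simp: phase_eq_phase_off cis_conv_exp mult.assoc)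
  moreover have "off_freq {(0, 0)} N n = {(0, 0)}"
    using assms by (auto simp: off_freq_def)
  then have "part_field {(0, 0)} N t a n = - \<i> * (a n * cnj (a n) * a n)"
    by (simp add: part_field_def phase_off_def)
  then have "part_field {(0, 0)} N t a n = - \<i> * (of_real ((cmod (a n))\<^sup>2) * a n)"
    by (simp only: complex_norm_square)
  ultimately show ?thesis
    by (simp add: vector_field_def part_field_def)
qed

section \<open>Majorants of Lipschitz curves\<close>

abbreviation sobolev_L2 :: "real \<Rightarrow> (int \<Rightarrow> real) \<Rightarrow> int set \<Rightarrow> real" where
  "sobolev_L2 s w F \<equiv> L2_set (\<lambda>n. jbracket n powr s * w n) F"

lemma bounded_sum_L2_set:
  assumes "sobolev_sum s w C" "finite F"
  shows "sobolev_L2 s w F \<le> sqrt C"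
proof -
  have "(\<Sum>n\<in>F. jbracket n powr (2 * s) * (w n)\<^sup>2) \<le> C"
    by (rule bounded_sum_finite[OF assms(1,2)]) auto
  then show ?thesis
    by (simp add: L2_set_def power_mult_distrib jbracket_powr_double)
qed

text \<open>A curve that is Lipschitz in \<open>H\<^sup>s\<close> has a single majorant in \<open>H\<^sup>s\<close>: along increasing times the
  increments add up, by Minkowski, to at most the length of the curve.\<close>

lemma finite_times_majorant:
  fixes b :: "real \<Rightarrow> int \<Rightarrow> complex"
  assumes init: "sobolev_L2 s (\<lambda>n. cmod (b l n)) F \<le> A"
    and lip: "\<And>t t'. t \<in> {l..u} \<Longrightarrow> t' \<in> {l..u} \<Longrightarrow> t \<le> t' \<Longrightarrow>
      sobolev_L2 s (\<lambda>n. cmod (b t' n - b t n)) F \<le> C * (t' - t)"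
    and T: "finite T" "T \<subseteq> {l..u}"
  shows "\<exists>w. (\<forall>n. 0 \<le> w n) \<and> (\<forall>t\<in>insert l T. \<forall>n. cmod (b t n) \<le> w n)
    \<and> sobolev_L2 s w F \<le> A + C * (Max (insert l T) - l)"
  using T
proof (induction T rule: finite_linorder_max_induct)
  case empty
  show ?case using init by (intro exI[of _ "\<lambda>n. cmod (b l n)"]) auto
next
  case (insert c T)
  then obtain w where w: "\<forall>n. 0 \<le> w n" "\<forall>t\<in>insert l T. \<forall>n. cmod (b t n) \<le> w n"
    "sobolev_L2 s w F \<le> A + C * (Max (insert l T) - l)"
    by auto
  define m where "m = Max (insert l T)"
  have m: "m \<in> insert l T" unfolding m_def using insert.hyps by (intro Max_in) auto
  have c: "c \<in> {l..u}" and mlu: "m \<in> {l..u}" using insert.prems m by auto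
  have mc: "m \<le> c" using m insert.hyps c by auto
  have Max: "Max (insert l (insert c T)) = c"
    using insert.hyps c by (intro Max_eqI) (auto intro: less_imp_le)
  define w' where "w' = (\<lambda>n. w n + cmod (b c n - b m n))"
  have "cmod (b c n) \<le> w' n" for n
    using norm_triangle_sub[of "b c n" "b m n"] w(2) m unfolding w'_def by (smt (verit))
  moreover have "cmod (b t n) \<le> w' n" if "t \<in> insert l T" for t n
    using w(2) that by (auto simp: w'_def intro: add_increasing2)
  moreover have "0 \<le> w' n" for n using w(1) by (simp add: w'_def)
  moreover have "sobolev_L2 s w' F \<le> A + C * (c - l)"
  proof -
    have "sobolev_L2 s w' F \<le> sobolev_L2 s w F
        + sobolev_L2 s (\<lambda>n. cmod (b c n - b m n)) F"
      unfolding w'_def distrib_left by (rule L2_set_triangle_ineq)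
    also have "\<dots> \<le> (A + C * (m - l)) + C * (c - m)"
      using w(3) lip[OF mlu c mc] by (intro add_mono) (auto simp: m_def)
    finally show ?thesis by (simp add: algebra_simps)
  qed
  ultimately show ?case
    by (intro exI[of _ w']) (auto simp: Max)
qed

text \<open>By continuity each coefficient attains its largest modulus at some time, and these
  maxima are the majorant. A finite set of frequencies involves only finitely many such times, so
  the finite case bounds every partial sum by the same constant.\<close>

lemma lipschitz_majorant:
  fixes b :: "real \<Rightarrow> int \<Rightarrow> complex"
  assumes lu: "l \<le> u" and A: "0 \<le> A" and C: "0 \<le> C"
    and init: "\<And>F. finite F \<Longrightarrow> sobolev_L2 s (\<lambda>n. cmod (b l n)) F \<le> A"
    and lip: "\<And>F t t'. finite F \<Longrightarrow> t \<in> {l..u} \<Longrightarrow> t' \<in> {l..u} \<Longrightarrow> t \<le> t' \<Longrightarrow>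
      sobolev_L2 s (\<lambda>n. cmod (b t' n - b t n)) F \<le> C * (t' - t)"
    and cont: "\<And>n. continuous_on {l..u} (\<lambda>t. b t n)"
  obtains w where "\<And>n. 0 \<le> w n" "\<And>t n. t \<in> {l..u} \<Longrightarrow> cmod (b t n) \<le> w n"
    "sobolev_sum s w ((A + C * (u - l))\<^sup>2)"
proof -
  have "\<exists>t\<in>{l..u}. \<forall>t'\<in>{l..u}. cmod (b t' n) \<le> cmod (b t n)" for n
    using lu by (intro continuous_attains_sup continuous_on_norm cont) auto
  then obtain T where T: "\<And>n. T n \<in> {l..u}" "\<And>n t. t \<in> {l..u} \<Longrightarrow> cmod (b t n) \<le> cmod (b (T n) n)"
    by metis
  show thesis
  proof (rule that[of "\<lambda>n. cmod (b (T n) n)"])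
    show "sobolev_sum s (\<lambda>n. cmod (b (T n) n)) ((A + C * (u - l))\<^sup>2)"
    proof (rule bounded_sumI)
      fix F :: "int set" assume F: "finite F"
      have sub: "T ` F \<subseteq> {l..u}" using T(1) by blast
      obtain w where w: "\<forall>n. 0 \<le> w n" "\<forall>t\<in>insert l (T ` F). \<forall>n. cmod (b t n) \<le> w n"
        "sobolev_L2 s w F \<le> A + C * (Max (insert l (T ` F)) - l)"
        using finite_times_majorant[OF init[OF F] lip[OF F] finite_imageI[OF F] sub] by blast
      have "Max (insert l (T ` F)) \<le> u" using F T lu by (subst Max_le_iff) auto
      then have "A + C * (Max (insert l (T ` F)) - l) \<le> A + C * (u - l)"
        using C by (intro add_left_mono mult_left_mono) auto
      moreover have "sobolev_L2 s (\<lambda>n. cmod (b (T n) n)) F \<le> sobolev_L2 s w F"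
        using w by (intro L2_set_mono mult_left_mono) auto
      ultimately have "sobolev_L2 s (\<lambda>n. cmod (b (T n) n)) F \<le> A + C * (u - l)"
        using w(3) by linarith
      then have "(sobolev_L2 s (\<lambda>n. cmod (b (T n) n)) F)\<^sup>2 \<le> (A + C * (u - l))\<^sup>2"
        by (intro power_mono) (auto intro: L2_set_nonneg)
      then show "(\<Sum>n\<in>F. jbracket n powr (2 * s) * (cmod (b (T n) n))\<^sup>2) \<le> (A + C * (u - l))\<^sup>2"
        by (simp add: L2_set_def sum_nonneg power_mult_distrib jbracket_powr_double)
    qed auto
  qed (use T in auto)
qed

text \<open>To apply the real mean value theorem, the curve is paired with its own increment
  \<open>c\<close>. Cauchy-Schwarz bounds the derivative of the pairing by \<open>C * S\<close>, and
  one factor \<open>S\<close> cancels.\<close>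

lemma L2_set_lipschitz:
  fixes b :: "real \<Rightarrow> int \<Rightarrow> complex"
  assumes "t \<le> t'"
    and deriv: "\<And>\<tau> n. \<tau> \<in> {t..t'} \<Longrightarrow> ((\<lambda>\<tau>. b \<tau> n) has_vector_derivative db \<tau> n) (at \<tau>)"
    and bound: "\<And>\<tau>. \<tau> \<in> {t..t'} \<Longrightarrow> L2_set (\<lambda>n. \<omega> n * cmod (db \<tau> n)) F \<le> C"
    and \<omega>: "\<And>n. 0 \<le> \<omega> n"
  shows "L2_set (\<lambda>n. \<omega> n * cmod (b t' n - b t n)) F \<le> C * (t' - t)"
proof (cases "t = t'")
  case True
  then show ?thesis by (simp add: L2_set_def)
next
  case False
  define c where "c = (\<lambda>n. b t' n - b t n)"
  define S where "S = L2_set (\<lambda>n. \<omega> n * cmod (c n)) F"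
  define g where "g = (\<lambda>\<tau>. \<Sum>n\<in>F. (\<omega> n)\<^sup>2 * Re (b \<tau> n * cnj (c n)))"
  have g: "(g has_real_derivative (\<Sum>n\<in>F. (\<omega> n)\<^sup>2 * Re (db \<tau> n * cnj (c n)))) (at \<tau>)" if "\<tau> \<in> {t..t'}"
      for \<tau>
    unfolding g_def has_real_derivative_iff_has_vector_derivative
    by (intro has_vector_derivative_sum has_vector_derivative_mult_right has_vector_derivative_mult_left
        bounded_linear.has_vector_derivative[OF bounded_linear_Re] deriv that)
  have "\<exists>\<xi>. \<xi> > t \<and> \<xi> < t' \<and> g t' - g t = (t' - t) * (\<Sum>n\<in>F. (\<omega> n)\<^sup>2 * Re (db \<xi> n * cnj (c n)))"
  proof (rule MVT2)
    show "t < t'" using assms(1) False by simp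
    show "(g has_real_derivative (\<Sum>n\<in>F. (\<omega> n)\<^sup>2 * Re (db \<xi> n * cnj (c n)))) (at \<xi>)"
      if "t \<le> \<xi>" "\<xi> \<le> t'" for \<xi>
      using that by (intro g) simp
  qed
  then obtain \<xi> where "\<xi> > t" "\<xi> < t'"
    and g_eq: "g t' - g t = (t' - t) * (\<Sum>n\<in>F. (\<omega> n)\<^sup>2 * Re (db \<xi> n * cnj (c n)))"
    by blast
  then have \<xi>: "\<xi> \<in> {t..t'}" by simp
  have S2: "S\<^sup>2 = (\<Sum>n\<in>F. (\<omega> n)\<^sup>2 * (cmod (c n))\<^sup>2)"
    by (simp add: S_def L2_set_def sum_nonneg power_mult_distrib)
  have "Re (c n * z) = Re (b t' n * z) - Re (b t n * z)" for n z
    by (simp only: c_def left_diff_distrib minus_complex.sel)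
  then have "g t' - g t = (\<Sum>n\<in>F. (\<omega> n)\<^sup>2 * Re (c n * cnj (c n)))"
    by (simp only: g_def right_diff_distrib sum_subtractf)
  also have "\<dots> = S\<^sup>2"
    unfolding S2 by (intro sum.cong refl) (simp add: complex_mult_cnj cmod_power2)
  finally have gS: "g t' - g t = S\<^sup>2" .
  have "(\<Sum>n\<in>F. (\<omega> n)\<^sup>2 * Re (db \<xi> n * cnj (c n))) \<le> (\<Sum>n\<in>F. \<bar>\<omega> n * cmod (db \<xi> n)\<bar> * \<bar>\<omega> n * cmod (c n)\<bar>)"
  proof (rule sum_mono)
    fix n
    have "Re (db \<xi> n * cnj (c n)) \<le> cmod (db \<xi> n) * cmod (c n)"
      using complex_Re_le_cmod[of "db \<xi> n * cnj (c n)"] by (simp add: norm_mult)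
    then have "(\<omega> n)\<^sup>2 * Re (db \<xi> n * cnj (c n)) \<le> (\<omega> n)\<^sup>2 * (cmod (db \<xi> n) * cmod (c n))"
      by (rule mult_left_mono) auto
    then show "(\<omega> n)\<^sup>2 * Re (db \<xi> n * cnj (c n)) \<le> \<bar>\<omega> n * cmod (db \<xi> n)\<bar> * \<bar>\<omega> n * cmod (c n)\<bar>"
      using \<omega>[of n] by (simp add: power2_eq_square mult_ac abs_mult)
  qed
  also have "\<dots> \<le> L2_set (\<lambda>n. \<omega> n * cmod (db \<xi> n)) F * S"
    unfolding S_def by (rule L2_set_mult_ineq)
  also have "\<dots> \<le> C * S"
    unfolding S_def using bound[OF \<xi>] by (intro mult_right_mono L2_set_nonneg) auto
  finally have "S * S \<le> (t' - t) * (C * S)"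
    using g_eq assms(1) gS by (simp add: power2_eq_square mult_left_mono)
  moreover have "0 \<le> S" by (simp add: S_def L2_set_nonneg)
  moreover have "0 \<le> C" using bound[OF \<xi>] L2_set_nonneg order.trans by blast
  ultimately have "S \<le> C * (t' - t)"
    using assms(1) by (cases "S = 0") (auto simp: mult_ac)
  then show ?thesis by (simp add: S_def c_def)
qed

section \<open>Local majorants along a solution\<close>

lemma solution_locally_bounded:
  assumes "continuous_into_sobolev s v"
  obtains r B where "0 < r"
    "\<And>t. \<bar>t - t\<^sub>0\<bar> \<le> r \<Longrightarrow> sobolev_sum s (\<lambda>n. cmod (fourier_coeff (v t) n)) B"
proof -
  have mem: "v t \<in> sobolev s" for t using assms by (auto simp: continuous_into_sobolev_def)
  have "((\<lambda>t. sobolev_norm s (\<lambda>x. v t x - v t\<^sub>0 x)) \<longlongrightarrow> 0) (at t\<^sub>0)"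
    using assms by (auto simp: continuous_into_sobolev_def)
  then have "\<forall>\<^sub>F t in at t\<^sub>0. sobolev_norm s (\<lambda>x. v t x - v t\<^sub>0 x) < 1"
    by (rule order_tendstoD) auto
  then obtain d where d: "0 < d" "\<And>t. t \<noteq> t\<^sub>0 \<Longrightarrow> dist t t\<^sub>0 < d \<Longrightarrow> sobolev_norm s (\<lambda>x. v t x - v t\<^sub>0 x) < 1"
    by (auto simp: eventually_at)
  let ?q = "\<lambda>t n. jbracket n powr (2 * s) * (cmod (fourier_coeff (v t) n))\<^sup>2"
  let ?B = "2 * 1 + 2 * (sobolev_norm s (v t\<^sub>0))\<^sup>2"
  show thesis
  proof (rule that[of "d / 2" ?B])
    fix t assume t: "\<bar>t - t\<^sub>0\<bar> \<le> d / 2"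
    show "bounded_sum (?q t) UNIV ?B"
    proof (cases "t = t\<^sub>0")
      case True
      show ?thesis
        unfolding True by (rule bounded_sum_mono[OF sobolev_bounded_sum[OF mem]]) auto
    next
      case False
      have lt1: "sobolev_norm s (\<lambda>x. v t x - v t\<^sub>0 x) < 1"
        using d t False by (auto simp: dist_real_def)
      have sq: "(cmod (x - y))\<^sup>2 \<le> 2 * (cmod x)\<^sup>2 + 2 * (cmod y)\<^sup>2" for x y :: complex
      proof -
        have "(cmod (x - y))\<^sup>2 \<le> (cmod x + cmod y)\<^sup>2"
          using norm_triangle_ineq4 by (intro power_mono) auto
        also have "\<dots> \<le> 2 * (cmod x)\<^sup>2 + 2 * (cmod y)\<^sup>2"
          using zero_le_power2[of "cmod x - cmod y"] by (simp add: power2_eq_square algebra_simps)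
        finally show ?thesis .
      qed
      let ?D = "\<lambda>n. jbracket n powr (2 * s) * (cmod (fourier_coeff (\<lambda>x. v t x - v t\<^sub>0 x) n))\<^sup>2"
      \<comment> \<open>A small \<open>sobolev_norm\<close> gives no bound by itself, as it is 0
        when the family is not summable. Summability comes from both functions lying in H^s.\<close>
      have D_summ: "?D summable_on UNIV"
      proof (rule bounded_sum_summable[OF bounded_sum_mono[OF bounded_sum_add[OF
              bounded_sum_cmult[OF sobolev_bounded_sum[OF mem[of t]], of 2]
              bounded_sum_cmult[OF sobolev_bounded_sum[OF mem[of t\<^sub>0]], of 2]]]])
        fix n
        show "?D n \<le> 2 * ?q t n + 2 * ?q t\<^sub>0 n"
          using mult_left_mono[OF sq[of "fourier_coeff (v t) n" "fourier_coeff (v t\<^sub>0) n"], of "jbracket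
              n powr (2 * s)"]
          by (simp add: fourier_coeff_diff[OF mem mem] algebra_simps)
      qed auto
      have "infsum ?D UNIV \<le> 1"
      proof -
        have "sqrt (infsum ?D UNIV) < 1" using lt1 by (simp add: sobolev_norm_def)
        then show ?thesis by simp
      qed
      then have D: "bounded_sum ?D UNIV 1"
        using D_summ by (simp add: bounded_sum_def)
      have "bounded_sum (\<lambda>n. 2 * ?D n + 2 * ?q t\<^sub>0 n) UNIV ?B"
        by (intro bounded_sum_add bounded_sum_cmult D sobolev_bounded_sum mem) auto
      then show ?thesis
      proof (rule bounded_sum_mono)
        fix n
        show "?q t n \<le> 2 * ?D n + 2 * ?q t\<^sub>0 n"
          using mult_left_mono[OF sq[of "fourier_coeff (v t) n - fourier_coeff (v t\<^sub>0) n" "-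
              fourier_coeff (v t\<^sub>0) n"], of "jbracket n powr (2 * s)"]
          by (simp add: fourier_coeff_diff[OF mem mem] algebra_simps)
      qed auto
    qed
  qed (use d in auto)
qed

text \<open>Continuity into H^s bounds the norm near the given time; the equation and the trilinear
  estimate then bound the time derivative in H^s. So the coefficients form a Lipschitz curve, and
  such a curve has a majorant.\<close>

lemma solution_majorant:
  assumes s: "1/2 < s" "s < 1" and v: "solves_E s N v"
  obtains l u w B where "t\<^sub>0 \<in> {l<..<u}" "nf_solution s N (\<lambda>t. fourier_coeff (v t)) w B l u"
proof -
  define a where "a = (\<lambda>t. fourier_coeff (v t))"
  define db where "db = (\<lambda>t n. if freq_le N n then part_field off_nz N t (a t) n - part_field {(0, 0)} N
      t (a t) n else 0)"
  have zero: "a t n = 0" if "\<not> freq_le N n" for t n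
    using v that by (auto simp: solves_E_def a_def)
  have deriv: "((\<lambda>\<tau>. a \<tau> n) has_vector_derivative db t n) (at t)" for t n
    using v zero[of n] by (auto simp: solves_E_def db_def a_def simp flip: vector_field_eq)
  obtain r B where r: "0 < r"
    and B: "\<And>t. \<bar>t - t\<^sub>0\<bar> \<le> r \<Longrightarrow> sobolev_sum s (\<lambda>n. cmod (a t n)) B"
    using solution_locally_bounded[of s v t\<^sub>0] v by (auto simp: solves_E_def a_def)
  define C where "C = sqrt (trilinear_const s B)"
  have db: "sobolev_L2 s (\<lambda>n. cmod (db t n)) F \<le> C" if "\<bar>t - t\<^sub>0\<bar> \<le> r" "finite F" for t F
  proof -
    interpret trilinear_majorant "\<lambda>n. cmod (a t n)"
      by (rule trilinear_sobolev(1)[OF s _ B[OF that(1)]]) auto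
    have "cmod (db t n) \<le> trilinear (\<lambda>n. cmod (a t n)) n" for n
      using part_field_bound(2)[of "a t" N t n] trilinear_nonneg by (auto simp: db_def)
    then have "sobolev_L2 s (\<lambda>n. cmod (db t n)) F \<le> sobolev_L2 s (\<lambda>n. trilinear (\<lambda>n. cmod (a t n)) n) F"
      by (intro L2_set_mono mult_left_mono) auto
    also have "\<dots> \<le> C"
      unfolding C_def by (rule bounded_sum_L2_set[OF trilinear_sobolev(2)[OF s _ B[OF that(1)]]
          that(2)]) auto
    finally show ?thesis .
  qed
  have C0: "0 \<le> C" using db[of t\<^sub>0 "{}"] r by simp
  have B0: "0 \<le> sqrt B" using bounded_sum_ge_0[OF B[of t\<^sub>0]] r by simp
  let ?l = "t\<^sub>0 - r" and ?u = "t\<^sub>0 + r"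
  obtain w where w: "\<And>n. 0 \<le> w n" "\<And>t n. t \<in> {?l..?u} \<Longrightarrow> cmod (a t n) \<le> w n"
    "sobolev_sum s w ((sqrt B + C * (?u - ?l))\<^sup>2)"
  proof (rule lipschitz_majorant[of ?l ?u "sqrt B" C s a])
    show "sobolev_L2 s (\<lambda>n. cmod (a ?l n)) F \<le> sqrt B" if "finite F" for F
      using r by (intro bounded_sum_L2_set B that) auto
    show "sobolev_L2 s (\<lambda>n. cmod (a t' n - a t n)) F \<le> C * (t' - t)"
      if "finite F" "t \<in> {?l..?u}" "t' \<in> {?l..?u}" "t \<le> t'" for F t t'
      using that by (intro L2_set_lipschitz[where db = db] deriv db) (auto simp: abs_le_iff)
    show "continuous_on {?l..?u} (\<lambda>t. a t n)" for n
      using deriv has_vector_derivative_continuous by (intro continuous_at_imp_continuous_on) blast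
  qed (use r C0 B0 in auto)
  show thesis
  proof (rule that[of ?l ?u w "(sqrt B + C * (?u - ?l))\<^sup>2"])
    show "nf_solution s N (\<lambda>t. fourier_coeff (v t)) w ((sqrt B + C * (?u - ?l))\<^sup>2) ?l ?u"
      unfolding a_def[symmetric]
    proof
      show "((\<lambda>\<tau>. a \<tau> n) has_vector_derivative part_field off_nz N t (a t) n - part_field {(0, 0)} N t
          (a t) n) (at t)"
        if "freq_le N n" for t n
        using deriv[of n t] that by (simp add: db_def)
    qed (use s w zero in auto)
  qed (use r in auto)
qed

section \<open>The normal form expansion\<close>

lemma L2_torus_bounded_sum:
  "f \<in> L2_torus \<Longrightarrow> bounded_sum (\<lambda>n. (cmod (fourier_coeff f n))\<^sup>2) UNIV ((L2_torus_norm f)\<^sup>2)"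
  using sobolev_bounded_sum[of f 0] jbracket_pos by (simp add: less_imp_neq[symmetric])

lemma L2_torus_norm_nonneg: "0 \<le> L2_torus_norm f"
  by (simp add: sobolev_norm_def infsum_nonneg)

lemma sobolev_subset_L2_torus:
  assumes "0 \<le> s" "f \<in> sobolev s"
  shows "f \<in> L2_torus"
  using bounded_sum_summable[OF bounded_sum_sobolev_L2[OF assms(1) sobolev_bounded_sum[OF assms(2)]]]
    assms(2) jbracket_pos by (simp add: sobolev_def less_imp_neq[symmetric])

section \<open>Real multilinear forms on the torus given by kernels\<close>

definition kernel_form :: "nat \<Rightarrow> (int list \<Rightarrow> complex) \<Rightarrow> real \<Rightarrow> (real \<Rightarrow> complex) \<Rightarrow> real" where
  "kernel_form k G t f = Re (form_sum k G t (\<lambda>_. fourier_coeff f))"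

lemma kernel_form_bound:
  assumes G: "bounded_sum (\<lambda>ns. (cmod (G ns))\<^sup>2) (tuples k) C" and f: "f \<in> L2_torus"
  shows "\<bar>kernel_form k G t f\<bar> \<le> sqrt C * L2_torus_norm f ^ k"
proof -
  let ?w = "\<lambda>n. cmod (fourier_coeff f n)"
  have "bounded_sum (\<lambda>ns. cmod (G ns) * tprod (\<lambda>_. ?w) 0 ns) (tuples k)
      (sqrt C * sqrt (\<Prod>j<k. (L2_torus_norm f)\<^sup>2))"
    by (rule bounded_sum_kernel_tensor[OF G]) (auto intro: L2_torus_bounded_sum f)
  then have "cmod (form_sum k G t (\<lambda>_. fourier_coeff f)) \<le> sqrt C * sqrt (\<Prod>j<k. (L2_torus_norm f)\<^sup>2)"
    unfolding form_sum_def by (rule bounded_sum_norm_mono) (simp add: norm_mult norm_tensor)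
  moreover have "sqrt (\<Prod>j<k. (L2_torus_norm f)\<^sup>2) = L2_torus_norm f ^ k"
    using L2_torus_norm_nonneg by (simp add: real_sqrt_power)
  ultimately show ?thesis
    using abs_Re_le_cmod order.trans unfolding kernel_form_def by metis
qed

text \<open>Square summability of the kernel makes the series absolutely convergent for all entries
  in L^2, so linearity in a slot can be checked term by term. The odd slots are conjugated for every
  kernel and every time.\<close>

lemma kernel_form_multilinear:
  assumes G: "bounded_sum (\<lambda>ns. (cmod (G ns))\<^sup>2) (tuples k) C"
  shows "multilinear_form k (kernel_form k G)"
proof -
  define bs where "bs = (\<lambda>(ws :: (real \<Rightarrow> complex) list) i. fourier_coeff (ws ! i))"
  define T where "T = (\<lambda>t ws ns. G ns * cis (- (of_int (alt_phase ns) * t)) * tensor (bs ws) 0 ns)"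
  define F where "F = (\<lambda>t ws. infsum (T t ws) (tuples k))"
  have T_upd: "T t (ws[i := h]) ns = G ns * cis (- (of_int (alt_phase ns) * t)) *
      (tensor (bs ws) 0 (take i ns) * conj_odd i (fourier_coeff h (ns ! i)) * tensor (bs ws) (Suc i)
          (drop (Suc i) ns))"
    if "length ws = k" "i < k" "ns \<in> tuples k" for t ws i h ns
  proof -
    have "tensor (bs (ws[i := h])) 0 ns = tensor ((bs ws)(i := fourier_coeff h)) 0 ns"
      using that by (intro tensor_cong) (auto simp: bs_def tuples_def)
    then show ?thesis
      using that by (simp add: T_def tensor_upd tuples_def)
  qed
  have T_summable: "T t ws summable_on tuples k" if "length ws = k" "set ws \<subseteq> L2_torus" for t ws
  proof (rule bounded_sum_norm_mono(1)[OF bounded_sum_kernel_tensor[OF G]])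
    show "bounded_sum (\<lambda>n. (if j < k then cmod (bs ws j n) else 0)\<^sup>2) UNIV ((L2_torus_norm (ws ! j))\<^sup>2)"
        if "j < k" for j
      using that \<open>length ws = k\<close> \<open>set ws \<subseteq> L2_torus\<close> by (auto simp: bs_def intro!: L2_torus_bounded_sum)
    fix ns assume ns: "ns \<in> tuples k"
    have "tprod (\<lambda>j n. cmod (bs ws j n)) 0 ns = tprod (\<lambda>j n. if j < k then cmod (bs ws j n) else 0) 0
        ns"
      using ns by (intro tprod_cong) (auto simp: tuples_def)
    then show "cmod (T t ws ns) \<le> cmod (G ns) * tprod (\<lambda>j n. if j < k then cmod (bs ws j n) else 0) 0
        ns"
      by (simp add: T_def norm_mult norm_tensor)
  qed auto
  have "multilinear_on_L2 k {i. odd i} (F t)" for t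
    unfolding multilinear_on_L2_def
  proof (intro allI impI conjI ballI; elim conjE)
    fix ws i f g assume ws: "length ws = k" "set ws \<subseteq> L2_torus" "i < k" and fg: "f \<in> L2_torus" "g \<in>
        L2_torus"
    have sub: "set (ws[i := h]) \<subseteq> L2_torus" if "h \<in> L2_torus" for h
      using set_update_subset_insert[of ws i h] ws that by blast
    have "F t (ws[i := \<lambda>x. f x + g x]) = infsum (\<lambda>ns. T t (ws[i := f]) ns + T t (ws[i := g]) ns)
        (tuples k)"
      unfolding F_def using ws
      by (intro infsum_cong) (simp add: T_upd fourier_coeff_add[OF fg] conj_odd_add distrib_left
          distrib_right)
    also have "\<dots> = F t (ws[i := f]) + F t (ws[i := g])"
      unfolding F_def using ws fg by (intro infsum_add T_summable sub) auto
    finally show "F t (ws[i := \<lambda>x. f x + g x]) = F t (ws[i := f]) + F t (ws[i := g])" .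
  next
    fix ws i f c assume ws: "length ws = k" "set ws \<subseteq> L2_torus" "i < k" and f: "f \<in> L2_torus"
    have "F t (ws[i := \<lambda>x. c * f x]) = infsum (\<lambda>ns. conj_odd i c * T t (ws[i := f]) ns) (tuples k)"
      unfolding F_def using ws
      by (intro infsum_cong) (simp add: T_upd fourier_coeff_cmult conj_odd_mult)
    also have "\<dots> = conj_odd i c * F t (ws[i := f])"
      unfolding F_def by (rule infsum_cmult_right')
    finally show "F t (ws[i := \<lambda>x. c * f x]) = (if i \<in> {i. odd i} then cnj c else c) * F t (ws[i := f])"
      by (simp add: conj_odd_def)
  qed
  moreover have "kernel_form k G t f = Re (F t (replicate k f))" for t f
  proof -
    have "T t (replicate k f) ns = G ns * cis (- (of_int (alt_phase ns) * t)) * tensor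
        (\<lambda>_. fourier_coeff f) 0 ns"
      if "ns \<in> tuples k" for ns
      unfolding T_def using that tensor_cong[of 0 ns "bs (replicate k f)" "\<lambda>_. fourier_coeff f"]
      by (auto simp: bs_def tuples_def)
    then have "F t (replicate k f) = form_sum k G t (\<lambda>_. fourier_coeff f)"
      unfolding F_def form_sum_def by (rule infsum_cong)
    then show ?thesis by (simp add: kernel_form_def)
  qed
  ultimately show ?thesis
    unfolding multilinear_form_def by blast
qed

lemma infsum_from_2: "infsum f {2..} = infsum (\<lambda>i. f (i + 2)) (UNIV :: nat set)"
  and summable_on_from_2: "f summable_on {2..} \<longleftrightarrow> (\<lambda>i. f (i + 2)) summable_on (UNIV :: nat set)"
proof -
  have bij: "bij_betw (\<lambda>i. i + 2) (UNIV :: nat set) {2..}"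
    by (rule bij_betwI[where g = "\<lambda>i. i - 2"]) auto
  show "infsum f {2..} = infsum (\<lambda>i. f (i + 2)) (UNIV :: nat set)"
    using infsum_reindex_bij_betw[OF bij, of f] by simp
  show "f summable_on {2..} \<longleftrightarrow> (\<lambda>i. f (i + 2)) summable_on (UNIV :: nat set)"
    using summable_on_reindex_bij_betw[OF bij, of f] by simp
qed

section \<open>The three families of forms\<close>

definition N0_form :: "real \<Rightarrow> enat \<Rightarrow> nat \<Rightarrow> real \<Rightarrow> (real \<Rightarrow> complex) \<Rightarrow> real" where
  "N0_form s N j = kernel_form (2 * j) (nf_kernel s N (j - 2))"

definition N1_form :: "real \<Rightarrow> enat \<Rightarrow> nat \<Rightarrow> real \<Rightarrow> (real \<Rightarrow> complex) \<Rightarrow> real" where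
  "N1_form s N j = kernel_form (2 * j + 2) (near_kernel s N (j - 2))"

definition R_form :: "real \<Rightarrow> enat \<Rightarrow> nat \<Rightarrow> real \<Rightarrow> (real \<Rightarrow> complex) \<Rightarrow> real" where
  "R_form s N j = kernel_form (2 * j + 2) (diag_kernel s N (j - 2))"

abbreviation N1_sum :: "real \<Rightarrow> enat \<Rightarrow> real \<Rightarrow> (real \<Rightarrow> complex) \<Rightarrow> real" where
  "N1_sum s N t f \<equiv> (\<Sum>\<^sub>\<infinity>j\<in>{2..}. N1_form s N j t f)"

abbreviation R_sum :: "real \<Rightarrow> enat \<Rightarrow> real \<Rightarrow> (real \<Rightarrow> complex) \<Rightarrow> real" where
  "R_sum s N t f \<equiv> (\<Sum>\<^sub>\<infinity>j\<in>{2..}. R_form s N j t f)"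

lemma forms_multilinear:
  assumes s: "1/2 < s" "s < 1" and j: "2 \<le> j"
  shows "multilinear_form (2 * j) (N0_form s N j)"
    and "multilinear_form (2 * j + 2) (N1_form s N j)"
    and "multilinear_form (2 * j + 2) (R_form s N j)"
proof -
  obtain i where i: "j = i + 2" using j le_Suc_ex by (metis add.commute)
  have len: "2 * (i + 2) = 2 * i + 4" "2 * (i + 2) + 2 = 2 * i + 4 + 2" by simp_all
  show "multilinear_form (2 * j) (N0_form s N j)"
    "multilinear_form (2 * j + 2) (N1_form s N j)"
    "multilinear_form (2 * j + 2) (R_form s N j)"
    unfolding i N0_form_def N1_form_def R_form_def len diff_add_inverse2
    by (rule kernel_form_multilinear, rule bounded_sum_nf_kernel_L2[OF s] bounded_sum_near_kernel[OF s]
        bounded_sum_diag_kernel[OF s])+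
qed

lemma forms_bound:
  assumes s: "1/2 < s" "s < 1" and j: "2 \<le> j" and f: "f \<in> L2_torus"
  defines "K \<equiv> sqrt (base_const s) + 1"
  shows "\<bar>N0_form s N j t f\<bar> \<le> K * decay_const s (j - 2) * L2_torus_norm f ^ (2 * j)"
    and "\<bar>N1_form s N j t f\<bar> \<le> K * decay_const s (j - 2) * L2_torus_norm f ^ (2 * j + 2)"
    and "\<bar>R_form s N j t f\<bar> \<le> K * decay_const s (j - 2) * L2_torus_norm f ^ (2 * j + 2)"
proof -
  obtain i where i: "j = i + 2" using j le_Suc_ex by (metis add.commute)
  have len: "2 * (i + 2) = 2 * i + 4" "2 * (i + 2) + 2 = 2 * i + 4 + 2" by simp_all
  have mono: "x \<le> c * y \<Longrightarrow> c \<le> d \<Longrightarrow> 0 \<le> y \<Longrightarrow> x \<le> d * y" for x c d y :: real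
    using mult_right_mono[of c d y] by linarith
  note nonneg = zero_le_power[OF L2_torus_norm_nonneg]
  show "\<bar>N0_form s N j t f\<bar> \<le> K * decay_const s (j - 2) * L2_torus_norm f ^ (2 * j)"
    unfolding i N0_form_def len diff_add_inverse2 K_def
    by (rule mono[OF kernel_form_bound[OF bounded_sum_nf_kernel_L2[OF s] f] sqrt_bounds(1) nonneg])
  show "\<bar>N1_form s N j t f\<bar> \<le> K * decay_const s (j - 2) * L2_torus_norm f ^ (2 * j + 2)"
    unfolding i N1_form_def len diff_add_inverse2 K_def
    by (rule mono[OF kernel_form_bound[OF bounded_sum_near_kernel[OF s] f] sqrt_bounds(2) nonneg])
  show "\<bar>R_form s N j t f\<bar> \<le> K * decay_const s (j - 2) * L2_torus_norm f ^ (2 * j + 2)"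
    unfolding i R_form_def len diff_add_inverse2 K_def
    by (rule mono[OF kernel_form_bound[OF bounded_sum_diag_kernel[OF s] f] sqrt_bounds(3) nonneg])
qed

text \<open>The same value \<open>E'\<close> occurs in both derivatives, so the expansion of the
  energy and the formula for the modified energy both follow by subtraction.\<close>

lemma forms_derivative:
  assumes s: "1/2 < s" "s < 1" and v: "solves_E s N v"
  obtains E' where
    "((\<lambda>\<tau>. 1/2 * (sobolev_norm s (v \<tau>))\<^sup>2) has_real_derivative E') (at t)"
    "((\<lambda>\<tau>. \<Sum>\<^sub>\<infinity>j\<in>{2..}. N0_form s N j \<tau> (v \<tau>)) has_real_derivative
       E' - N1_sum s N t (v t) - R_sum s N t (v t)) (at t)"
proof -
  obtain l u w B where t: "t \<in> {l<..<u}" and sol: "nf_solution s N (\<lambda>t. fourier_coeff (v t)) w B l u"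
    by (rule solution_majorant[OF s v])
  interpret nf_solution s N "\<lambda>t. fourier_coeff (v t)" w B l u by (rule sol)
  let ?E = "Re (form_sum 4 (energy_kernel s N) t (\<lambda>_. fourier_coeff (v t)))"
  have len: "2 * (i + 2) = 2 * i + 4" "2 * (i + 2) + 2 = 2 * i + 4 + 2" for i :: nat by simp_all
  have N0: "(\<Sum>\<^sub>\<infinity>j\<in>{2..}. N0_form s N j \<tau> (v \<tau>)) = Re (\<Sum>\<^sub>\<infinity>i. nf_form i \<tau>)" if "\<tau> \<in> {l<..<u}" for \<tau>
    unfolding infsum_from_2 N0_form_def kernel_form_def len diff_add_inverse2 nf_form_def[symmetric]
    by (rule infsum_Re[OF nf_series_has_derivative(2)[OF that]])
  have N1: "N1_sum s N t (v t) = Re (\<Sum>\<^sub>\<infinity>i. near_form i t)"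
    unfolding infsum_from_2 N1_form_def kernel_form_def len diff_add_inverse2 near_form_def[symmetric]
    by (rule infsum_Re[OF nf_series_has_derivative(3)[OF t]])
  have R: "R_sum s N t (v t) = Re (\<Sum>\<^sub>\<infinity>i. diag_form i t)"
    unfolding infsum_from_2 R_form_def kernel_form_def len diff_add_inverse2 diag_form_def[symmetric]
    by (rule infsum_Re[OF nf_series_has_derivative(4)[OF t]])
  show thesis
  proof (rule that)
    show "((\<lambda>\<tau>. 1/2 * (sobolev_norm s (v \<tau>))\<^sup>2) has_real_derivative ?E) (at t)"
      unfolding sobolev_norm_power2 has_real_derivative_iff_has_vector_derivative
      by (rule energy_has_derivative[OF t])
    have "((\<lambda>\<tau>. Re (\<Sum>\<^sub>\<infinity>i. nf_form i \<tau>)) has_vector_derivative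
        ?E - N1_sum s N t (v t) - R_sum s N t (v t)) (at t)"
      unfolding N1 R minus_complex.sel[symmetric]
      by (rule bounded_linear.has_vector_derivative[OF bounded_linear_Re nf_series_has_derivative(1)[OF
          t]])
    then show "((\<lambda>\<tau>. \<Sum>\<^sub>\<infinity>j\<in>{2..}. N0_form s N j \<tau> (v \<tau>)) has_real_derivative
        ?E - N1_sum s N t (v t) - R_sum s N t (v t)) (at t)"
      unfolding has_real_derivative_iff_has_vector_derivative
      by (rule has_vector_derivative_transform_within_open[OF _ _ t]) (simp_all add: N0)
  qed
qed

lemma decay_series_summable:
  assumes "0 \<le> x"
  shows "(\<lambda>j. K * decay_const s (j - 2) * x ^ (2 * j + 2)) summable_on {2..}"
proof -
  have "(\<lambda>i. K * x ^ 6 * (decay_const s i * (x\<^sup>2) ^ i)) summable_on UNIV"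
    by (intro summable_on_cmult_right decay_const_summable) simp
  moreover have "K * x ^ 6 * (decay_const s i * (x\<^sup>2) ^ i) = K * decay_const s (i + 2 - 2) * x ^
      (2 * (i + 2) + 2)" for i
    by (simp add: power_mult power_add[symmetric] power2_eq_square power_mult_distrib numeral_eq_Suc)
  ultimately show ?thesis
    by (simp only: summable_on_from_2)
qed

lemma energy_bound:
  assumes s: "1/2 < s" "s < 1" and f: "f \<in> L2_torus"
  defines "K \<equiv> sqrt (base_const s) + 1"
  shows "\<bar>N1_sum s N t f + R_sum s N t f\<bar> \<le>
    2 * (\<Sum>\<^sub>\<infinity>j\<in>{2..}. K * decay_const s (j - 2) * L2_torus_norm f ^ (2 * j + 2))"
proof -
  let ?c = "\<lambda>j. K * decay_const s (j - 2) * L2_torus_norm f ^ (2 * j + 2)"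
  have c: "bounded_sum ?c {2..} (infsum ?c {2..})"
  proof (intro bounded_sum_self decay_series_summable L2_torus_norm_nonneg mult_nonneg_nonneg
      zero_le_power)
    show "0 \<le> K" by (simp add: K_def base_const_nonneg)
  qed (simp add: decay_const_pos less_imp_le)
  have "\<bar>N1_sum s N t f\<bar> \<le> infsum ?c {2..}" "\<bar>R_sum s N t f\<bar> \<le> infsum ?c {2..}"
    using bounded_sum_norm_mono(2)[OF c, of "\<lambda>j. N1_form s N j t f"] bounded_sum_norm_mono(2)[OF c, of
        "\<lambda>j. R_form s N j t f"]
      forms_bound(2,3)[OF s _ f] by (auto simp: K_def)
  then show ?thesis by linarith
qed

theorem proposition3p4:
  fixes s :: real
  assumes "1/2 < s" and "s < 1"
  shows "\<exists>(C0 :: nat \<Rightarrow> real) (C1 :: nat \<Rightarrow> real) (C2 :: nat \<Rightarrow> real) (K :: real) (Cs :: real \<Rightarrow> real).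
    (\<forall>j\<ge>2. 0 < C0 j \<and> 0 < C1 j \<and> 0 < C2 j)
    \<and> superexponential_decay C0 \<and> superexponential_decay C1 \<and> superexponential_decay C2
    \<and> 0 < K
    \<and> (\<forall>N :: enat. \<exists>(N0 :: nat \<Rightarrow> real \<Rightarrow> (real \<Rightarrow> complex) \<Rightarrow> real)
          (N1 :: nat \<Rightarrow> real \<Rightarrow> (real \<Rightarrow> complex) \<Rightarrow> real)
          (R :: nat \<Rightarrow> real \<Rightarrow> (real \<Rightarrow> complex) \<Rightarrow> real).
        (\<forall>j\<ge>2. multilinear_form (2 * j) (N0 j)
             \<and> multilinear_form (2 * j + 2) (N1 j)
             \<and> multilinear_form (2 * j + 2) (R j))
        \<and> (\<forall>v. solves_E s N v \<longrightarrow> (\<forall>t.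
              (\<lambda>\<tau>. 1/2 * (sobolev_norm s (v \<tau>))\<^sup>2) field_differentiable (at t)
            \<and> (\<lambda>\<tau>. \<Sum>\<^sub>\<infinity>j\<in>{2..}. N0 j \<tau> (v \<tau>)) field_differentiable (at t)
            \<and> deriv (\<lambda>\<tau>. 1/2 * (sobolev_norm s (v \<tau>))\<^sup>2) t
                = deriv (\<lambda>\<tau>. \<Sum>\<^sub>\<infinity>j\<in>{2..}. N0 j \<tau> (v \<tau>)) t
                  + (\<Sum>\<^sub>\<infinity>j\<in>{2..}. N1 j t (v t)) + (\<Sum>\<^sub>\<infinity>j\<in>{2..}. R j t (v t))))
        \<and> (\<forall>j\<ge>2. \<forall>t. \<forall>u\<in>L2_torus.
              \<bar>N0 j t u\<bar> \<le> K * C0 j * L2_torus_norm u ^ (2 * j)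
            \<and> \<bar>N1 j t u\<bar> \<le> K * C1 j * L2_torus_norm u ^ (2 * j + 2)
            \<and> \<bar>R j t u\<bar> \<le> K * C2 j * L2_torus_norm u ^ (2 * j + 2))
        \<and> (\<forall>v. solves_E s N v \<longrightarrow> (\<forall>t.
              (\<lambda>\<tau>. modified_energy s N0 \<tau> (v \<tau>)) field_differentiable (at t)
            \<and> \<bar>deriv (\<lambda>\<tau>. modified_energy s N0 \<tau> (v \<tau>)) t\<bar> \<le> Cs (L2_torus_norm (v t)))))"
proof -
  \<comment> \<open>One sequence serves for all three families, and \<open>K\<close> is the implicit
    constant; both depend on \<open>s\<close> only.\<close>
  define C where "C = (\<lambda>j. decay_const s (j - 2))"
  define K where "K = sqrt (base_const s) + 1"
  \<comment> \<open>The derivative of the modified energy is the sum of the near and the diagonal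
    forms; the factor 2 counts these two families.\<close>
  define Cs where "Cs = (\<lambda>x. 2 * (\<Sum>\<^sub>\<infinity>j\<in>{2..}. K * C j * x ^ (2 * j + 2)))"
  have multilinear: "\<forall>j\<ge>2. multilinear_form (2 * j) (N0_form s N j)
      \<and> multilinear_form (2 * j + 2) (N1_form s N j) \<and> multilinear_form (2 * j + 2) (R_form s N j)"
          for N
    using forms_multilinear[OF assms] by blast
  have bounds: "\<forall>j\<ge>2. \<forall>t. \<forall>u\<in>L2_torus.
      \<bar>N0_form s N j t u\<bar> \<le> K * C j * L2_torus_norm u ^ (2 * j)
      \<and> \<bar>N1_form s N j t u\<bar> \<le> K * C j * L2_torus_norm u ^ (2 * j + 2)
      \<and> \<bar>R_form s N j t u\<bar> \<le> K * C j * L2_torus_norm u ^ (2 * j + 2)" for N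
    using forms_bound[OF assms] unfolding C_def K_def by blast
  have energy: "(\<lambda>\<tau>. 1/2 * (sobolev_norm s (v \<tau>))\<^sup>2) field_differentiable (at t)
      \<and> (\<lambda>\<tau>. \<Sum>\<^sub>\<infinity>j\<in>{2..}. N0_form s N j \<tau> (v \<tau>)) field_differentiable (at t)
      \<and> deriv (\<lambda>\<tau>. 1/2 * (sobolev_norm s (v \<tau>))\<^sup>2) t
          = deriv (\<lambda>\<tau>. \<Sum>\<^sub>\<infinity>j\<in>{2..}. N0_form s N j \<tau> (v \<tau>)) t
            + N1_sum s N t (v t) + R_sum s N t (v t)"
    if v: "solves_E s N v" for N v t
  proof (rule forms_derivative[OF assms v, of t], goal_cases)
    case (1 E')
    then show ?case
      using DERIV_imp_deriv[OF 1(1)] DERIV_imp_deriv[OF 1(2)] by (auto simp: field_differentiable_def)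
  qed
  have modified: "(\<lambda>\<tau>. modified_energy s (N0_form s N) \<tau> (v \<tau>)) field_differentiable (at t)
      \<and> \<bar>deriv (\<lambda>\<tau>. modified_energy s (N0_form s N) \<tau> (v \<tau>)) t\<bar> \<le> Cs (L2_torus_norm (v t))"
    if v: "solves_E s N v" for N v t
  proof (rule forms_derivative[OF assms v, of t], goal_cases)
    case (1 E')
    have "v t \<in> sobolev s"
      using v by (simp add: solves_E_def continuous_into_sobolev_def)
    then have vt: "v t \<in> L2_torus"
      using assms(1) by (intro sobolev_subset_L2_torus) auto
    have "((\<lambda>\<tau>. modified_energy s (N0_form s N) \<tau> (v \<tau>)) has_real_derivative
        N1_sum s N t (v t) + R_sum s N t (v t)) (at t)"
      unfolding modified_energy_def using DERIV_diff[OF 1] by simp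
    then show ?case
      using energy_bound[OF assms vt, of N t]
      by (auto simp: field_differentiable_def Cs_def K_def C_def dest: DERIV_imp_deriv)
  qed
  show ?thesis
  proof (intro exI[of _ C] exI[of _ K] exI[of _ Cs] conjI allI, goal_cases)
    case (6 N)
    show ?case
      using multilinear energy bounds modified
      by (intro exI[of _ "N0_form s N"] exI[of _ "N1_form s N"] exI[of _ "R_form s N"] conjI) blast+
  qed (auto simp: C_def K_def decay_const_pos superexponential_decay_const base_const_nonneg
      intro: add_nonneg_pos)
qed

end
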